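(* Assume that $n\gg d$ as $n\to\infty$. For positive constants $r_1,r_2$ define $$ h_1=\sqrt{1-\left(\frac{r_1\,d\,(\ln(n/d))^{3/2}}{n}\right)^{\frac{2}{d-1}}}\qquad\text{and}\qquad h_2=\sqrt{1-\left(\frac{r_2\,d}{n}\right)^{\frac{2(d+1)}{(d-1)^2}}} $$ (these are well defined once $n/d$ is large enough). Then, for fixed positive constants $r_1$ sufficiently large and $r_2$ sufficiently small, $$ F_{[-1,1]}=F_{[h_1,h_2]}+o(1)\qquad\text{as }n\to\infty. $$
   Context: Asymptotic setting: $\mathbb{N}\ni n\to\infty$ and $d=d(n)\in\{2,\ldots,n-1\}$ is a function of $n$ which is either constant or tends to infinity. The notation $f\gg g$ means $g(n)/f(n)\to0$, and $o(1)$ is a sequence tending to $0$ as $n\to\infty$. Let $X_1,\ldots,X_n$ be i.i.d. random vectors uniformly distributed on the unit sphere $\mathbb{S}^{d-1}\subset\mathbb{R}^d$, and let $P_{n,d}=[X_1,\ldots,X_n]$ be their convex hull. A facet ($(d-1)$-dimensional face) of $P_{n,d}$ has height $h\in[-1,1]$ if its supporting hyperplane is $\{x\in\mathbb{R}^d:\langle x,u\rangle=h\}$ for some $u\in\mathbb{S}^{d-1}$ and $P_{n,d}\subset\{x:\langle x,u\rangle\le h\}$ (heights can be negative). For $-1\le a\le b\le1$, $F_{[a,b]}=\mathbb{E}\,\#\{\text{facets of }P_{n,d}\text{ with height in }[a,b]\}$. "For fixed positive constants $r_1$ sufficiently large and $r_2$ sufficiently small" means: there exist $R_1,R_2>0$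 such that the conclusion holds for all fixed $r_1\ge R_1$ and $0<r_2\le R_2$. *)

theory Defs
  imports "HOL-Probability.Probability" "HOL-Library.Function_Algebras"
begin

text \<open>
  The dimension varies with the number of points, so it cannot be a type. As in
  \<^const>\<open>Euclidean_space\<close> and \<^const>\<open>nsphere\<close>, the space of dimension \<open>d\<close> is the set of
  sequences vanishing from index \<open>d\<close> on, and the unit sphere in it is
  \<open>topspace (nsphere (d - 1))\<close>. With pointwise scalar multiplication the type of sequences is a
  real vector space, so the library notions of convex hull, affine hull and face apply.
\<close>

instantiation "fun" :: (type, real_vector) real_vector
begin

definition scaleR_fun :: "real \<Rightarrow> ('a \<Rightarrow> 'b) \<Rightarrow> 'a \<Rightarrow> 'b" where
  "scaleR_fun c f = (\<lambda>x. c *\<^sub>R f x)"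

instance
  by standard (simp_all add: scaleR_fun_def fun_eq_iff scaleR_add_right scaleR_add_left)

end

lemma scaleR_fun_apply [simp]: "(c *\<^sub>R f) x = c *\<^sub>R f x"
  by (simp add: scaleR_fun_def)

definition inner_upto :: "nat \<Rightarrow> (nat \<Rightarrow> real) \<Rightarrow> (nat \<Rightarrow> real) \<Rightarrow> real" where
  "inner_upto d x y = (\<Sum>i<d. x i * y i)"

definition hyperplane :: "nat \<Rightarrow> (nat \<Rightarrow> real) \<Rightarrow> real \<Rightarrow> (nat \<Rightarrow> real) set" where
  "hyperplane d u h = {x \<in> topspace (Euclidean_space d). inner_upto d x u = h}"

text \<open>
  The uniform distribution on the sphere is normalised surface measure, given here as the
  cone measure: the law of the radial projection of a uniformly distributed point of the unit
  ball.
  Functions in the space of \<open>Pi\<^sub>M {..<d} _\<close> are \<^const>\<open>undefined\<close> outside \<open>{..<d}\<close>; the radial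
  projection replaces these values by 0. It maps the origin to itself, which is a null event.
\<close>

definition unit_ball :: "nat \<Rightarrow> (nat \<Rightarrow> real) set" where
  "unit_ball d = {x \<in> space (Pi\<^sub>M {..<d} (\<lambda>_. lborel)). (\<Sum>i<d. (x i)\<^sup>2) \<le> 1}"

definition radial_proj :: "nat \<Rightarrow> (nat \<Rightarrow> real) \<Rightarrow> nat \<Rightarrow> real" where
  "radial_proj d x = (\<lambda>i. if i < d then x i / sqrt (\<Sum>j<d. (x j)\<^sup>2) else 0)"

definition uniform_sphere :: "nat \<Rightarrow> (nat \<Rightarrow> real) measure" where
  "uniform_sphere d =
     distr (uniform_measure (Pi\<^sub>M {..<d} (\<lambda>_. lborel)) (unit_ball d))
       (restrict_space borel (topspace (Euclidean_space d))) (radial_proj d)"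

text \<open>
  The library constants \<^const>\<open>aff_dim\<close> and \<^const>\<open>facet_of\<close> require a Euclidean type; the first
  definition below is the condition defining \<^const>\<open>aff_dim\<close>. Finiteness of the basis, automatic
  in a Euclidean type, has to be demanded because infinite sets have cardinality 0.
\<close>

definition has_aff_dim :: "'a::real_vector set \<Rightarrow> int \<Rightarrow> bool" where
  "has_aff_dim V k \<longleftrightarrow>
     (\<exists>B. finite B \<and> affine hull B = affine hull V \<and> \<not> affine_dependent B \<and> int (card B) = k + 1)"

definition is_facet :: "nat \<Rightarrow> (nat \<Rightarrow> real) set \<Rightarrow> (nat \<Rightarrow> real) set \<Rightarrow> bool" where
  "is_facet d P F \<longleftrightarrow> F face_of P \<and> has_aff_dim F (int d - 1)"

text \<open>The supporting hyperplane of a facet is its affine hull.\<close>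

definition facet_has_height ::
    "nat \<Rightarrow> (nat \<Rightarrow> real) set \<Rightarrow> (nat \<Rightarrow> real) set \<Rightarrow> real \<Rightarrow> bool" where
  "facet_has_height d P F h \<longleftrightarrow>
     (\<exists>u \<in> topspace (nsphere (d - 1)).
        affine hull F = hyperplane d u h \<and> (\<forall>x\<in>P. inner_upto d x u \<le> h))"

definition facets_with_height ::
    "nat \<Rightarrow> (nat \<Rightarrow> real) set \<Rightarrow> real \<Rightarrow> real \<Rightarrow> (nat \<Rightarrow> real) set set" where
  "facets_with_height d P a b = {F. is_facet d P F \<and> (\<exists>h\<in>{a..b}. facet_has_height d P F h)}"

definition random_polytope :: "nat \<Rightarrow> (nat \<Rightarrow> nat \<Rightarrow> real) \<Rightarrow> (nat \<Rightarrow> real) set" where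
  "random_polytope n X = convex hull (X ` {..<n})"

text \<open>
  The coordinates of the product space are independent, each with law \<^term>\<open>uniform_sphere d\<close>.
\<close>

definition expected_facets :: "nat \<Rightarrow> nat \<Rightarrow> real \<Rightarrow> real \<Rightarrow> real" where
  "expected_facets n d a b =
     (\<integral>X. real (card (facets_with_height d (random_polytope n X) a b))
        \<partial>Pi\<^sub>M {..<n} (\<lambda>_. uniform_sphere d))"

definition lower_height :: "real \<Rightarrow> nat \<Rightarrow> nat \<Rightarrow> real" where
  "lower_height r n d =
     sqrt (1 - (r * real d * ln (real n / real d) powr (3/2) / real n) powr (2 / (real d - 1)))"

definition upper_height :: "real \<Rightarrow> nat \<Rightarrow> nat \<Rightarrow> real" where
  "upper_height r n d =
     sqrt (1 - (r * real d / real n) powr (2 * (real d + 1) / (real d - 1)\<^sup>2))"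

end

theory Submission
  imports Defs "HOL-Real_Asymp.Real_Asymp"
begin

text \<open>
  In general position the facets correspond to the \<open>d\<close>-subsets of the points whose spanning
  hyperplane supports the polytope. Hence the expected number of facets with height outside
  \<open>[h\<^sub>1, h\<^sub>2]\<close> is at most \<open>n choose d\<close> times the probability that a fixed \<open>d\<close>-subset spans such a
  facet.

  For heights below \<open>h\<^sub>1\<close>, condition on the \<open>d\<close> points: the other \<open>n - d\<close> points miss a cap of
  height \<open>h\<^sub>1\<close>, which has probability at most \<open>2 (1 - cap)^(n - d)\<close>, and \<open>n cap\<close> is a large multiple
  of \<open>d ln (n/d)\<close>.

  For heights above \<open>h = h\<^sub>2\<close>, the hyperplane has the form \<open>{x. \<langle>x, v\<rangle> = 1}\<close> with \<open>|v| < 1/h\<close>. The set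
  of \<open>w\<close> with \<open>|\<langle>X\<^sub>i, w\<rangle> - 1| \<le> \<epsilon>\<close> for all \<open>d\<close> points is a parallelepiped around \<open>v\<close>; since the
  points lie in a cap of radius \<open>\<rho> = sqrt (1 - h^2)\<close>, Hadamard's inequality bounds its volume below by
  \<open>2 \<epsilon> (\<epsilon>/\<rho>)^(d-1)\<close>. Integrating over \<open>w\<close> and letting \<open>\<epsilon>\<close> tend to 0 bounds the probability by
  \<open>C^d \<rho>^((d-1)^2)\<close>, without a Blaschke-Petkantschin formula.
\<close>


section \<open>Isometries of Lebesgue measure\<close>

text \<open>Both heights come from balancing against \<open>n choose d\<close>, which is at most (e
  N)^d with N = n/d. The exponent in h2 makes \<rho>^((d-1)^2) equal to (r2/N)^(d+1): d of these
  factors cancel N^d, a small r2 absorbs C^d for all d at once, and the surplus factor r2/N tends to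
  0. For h1 the cap has order at least \<rho>^(d-1) / (h1 sqrt d) with \<rho>^(d-1) = r1 (ln
  N)^(3/2) / N. Since h1 sqrt d is at most of order sqrt (ln N), half a power of the logarithm is
  lost, and what remains still beats N^d. The bound for large heights is a Fubini argument: the
  expected volume of the parallelepiped is the integral over w of the probability that d independent
  points fall into a slab determined by w. The volume bound and this probability both carry the
  factor \<epsilon>^d, so it cancels. How small \<epsilon> has to be depends on the configuration;
  the limit is therefore taken with Fatou's lemma. In the plane the density of the height of a
  random point is unbounded near 1, and a direct argument replaces this one.\<close>

abbreviation lebesgue_upto :: "nat \<Rightarrow> (nat \<Rightarrow> real) measure" where
  "lebesgue_upto d \<equiv> Pi\<^sub>M {..<d} (\<lambda>_. lborel)"

interpretation lebesgue_product: product_sigma_finite "\<lambda>_::nat. lborel :: real measure"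
  by standard

text \<open>Stated for nonnegative integrals rather than for measures of sets: composition is then
  plain substitution, and a map that changes one coordinate is handled by integrating this
  coordinate first.\<close>

definition preserves_lebesgue :: "nat \<Rightarrow> ((nat \<Rightarrow> real) \<Rightarrow> nat \<Rightarrow> real) \<Rightarrow> bool" where
  "preserves_lebesgue d T \<longleftrightarrow> T \<in> measurable (lebesgue_upto d) (lebesgue_upto d) \<and>
     (\<forall>f \<in> borel_measurable (lebesgue_upto d).
        (\<integral>\<^sup>+x. f (T x) \<partial>lebesgue_upto d) = integral\<^sup>N (lebesgue_upto d) f)"

text \<open>An orthogonal map, recorded through what the volume computations use of it: invariance
  of Lebesgue measure and of inner products.\<close>

definition isometry_upto :: "nat \<Rightarrow> ((nat \<Rightarrow> real) \<Rightarrow> nat \<Rightarrow> real) \<Rightarrow> bool" where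
  "isometry_upto d T \<longleftrightarrow> preserves_lebesgue d T \<and>
     (\<forall>x y. inner_upto d (T x) (T y) = inner_upto d x y)"

lemma preserves_lebesgue_id: "preserves_lebesgue d (\<lambda>x. x)"
  by (auto simp: preserves_lebesgue_def)

lemma preserves_lebesgue_comp:
  assumes "preserves_lebesgue d S" "preserves_lebesgue d T"
  shows "preserves_lebesgue d (\<lambda>x. S (T x))"
proof -
  have S: "S \<in> measurable (lebesgue_upto d) (lebesgue_upto d)"
    and T: "T \<in> measurable (lebesgue_upto d) (lebesgue_upto d)"
    using assms by (auto simp: preserves_lebesgue_def)
  have "(\<integral>\<^sup>+x. f (S (T x)) \<partial>lebesgue_upto d) = integral\<^sup>N (lebesgue_upto d) f"
    if f: "f \<in> borel_measurable (lebesgue_upto d)" for f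
  proof -
    have "(\<lambda>x. f (S x)) \<in> borel_measurable (lebesgue_upto d)"
      using measurable_compose[OF S f] .
    then have "(\<integral>\<^sup>+x. f (S (T x)) \<partial>lebesgue_upto d) = (\<integral>\<^sup>+x. f (S x) \<partial>lebesgue_upto d)"
      using assms(2) unfolding preserves_lebesgue_def by (elim conjE) (drule (1) bspec)
    also have "\<dots> = integral\<^sup>N (lebesgue_upto d) f"
      using assms(1) f unfolding preserves_lebesgue_def by blast
    finally show ?thesis .
  qed
  then show ?thesis
    using measurable_compose[OF T S] by (auto simp: preserves_lebesgue_def)
qed

lemma preserves_lebesgue_emeasure:
  assumes "preserves_lebesgue d T" and [measurable]: "Measurable.pred (lebesgue_upto d) P"
  shows "emeasure (lebesgue_upto d) {x \<in> space (lebesgue_upto d). P (T x)} =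
         emeasure (lebesgue_upto d) {x \<in> space (lebesgue_upto d). P x}"
proof -
  have [measurable]: "T \<in> measurable (lebesgue_upto d) (lebesgue_upto d)"
    and eq: "(\<integral>\<^sup>+x. f (T x) \<partial>lebesgue_upto d) = integral\<^sup>N (lebesgue_upto d) f"
      if "f \<in> borel_measurable (lebesgue_upto d)" for f
    using assms that by (auto simp: preserves_lebesgue_def)
  let ?A = "{x \<in> space (lebesgue_upto d). P x}"
  have "emeasure (lebesgue_upto d) {x \<in> space (lebesgue_upto d). P (T x)} =
      (\<integral>\<^sup>+x. indicator {x \<in> space (lebesgue_upto d). P (T x)} x \<partial>lebesgue_upto d)"
    by simp
  also have "\<dots> = (\<integral>\<^sup>+x. indicator ?A (T x) \<partial>lebesgue_upto d)"
    using measurable_space[of T "lebesgue_upto d" "lebesgue_upto d"]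
    by (intro nn_integral_cong) (auto simp: indicator_def)
  also have "\<dots> = (\<integral>\<^sup>+x. indicator ?A x \<partial>lebesgue_upto d)"
    by (rule eq) measurable
  finally show ?thesis by simp
qed

lemma nn_integral_lebesgue_upto_coord:
  assumes "j < d" "f \<in> borel_measurable (lebesgue_upto d)"
  shows "integral\<^sup>N (lebesgue_upto d) f =
    (\<integral>\<^sup>+x. (\<integral>\<^sup>+y. f (x(j := y)) \<partial>lborel) \<partial>Pi\<^sub>M ({..<d} - {j}) (\<lambda>_. lborel))"
proof -
  have eq: "{..<d} = insert j ({..<d} - {j})" using assms by auto
  show ?thesis using assms(2)
    by (subst (1) eq) (rule lebesgue_product.product_nn_integral_insert, use eq in auto)
qed

lemma measurable_fun_upd_lebesgue:
  assumes "j < d" "g \<in> borel_measurable (lebesgue_upto d)"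
  shows "(\<lambda>x. x(j := g x)) \<in> measurable (lebesgue_upto d) (lebesgue_upto d)"
  using assms by (intro measurable_PiM_single') (auto simp: space_PiM PiE_iff extensional_def)

lemma measurable_fun_upd_line:
  assumes "j < d" "f \<in> borel_measurable (lebesgue_upto d)"
    and "x \<in> space (Pi\<^sub>M ({..<d} - {j}) (\<lambda>_. lborel :: real measure))"
  shows "(\<lambda>y. f (x(j := y))) \<in> borel_measurable borel"
proof -
  have eq: "{..<d} = insert j ({..<d} - {j})" using assms(1) by auto
  have "(\<lambda>y. x(j := y)) \<in> measurable lborel (lebesgue_upto d)"
    by (subst eq) (rule measurable_component_update[OF assms(3)], simp)
  from measurable_compose[OF this assms(2)] show ?thesis by simp
qed

lemma nn_integral_lborel_shift:
  assumes [measurable]: "f \<in> borel_measurable borel"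
  shows "(\<integral>\<^sup>+x. f (x + t) \<partial>lborel) = (\<integral>\<^sup>+x. f x \<partial>(lborel :: real measure))"
  using nn_integral_real_affine[of f 1 t] by (simp add: add.commute)

text \<open>With the other coordinates fixed, the shear translates coordinate \<open>j\<close> by a
  constant, so the inner integral over that line does not change.\<close>

lemma preserves_lebesgue_shear:
  assumes "i < d" "j < d" "i \<noteq> j"
  shows "preserves_lebesgue d (\<lambda>x. x(j := x j + a * x i))"
  unfolding preserves_lebesgue_def
proof (intro conjI ballI)
  show m: "(\<lambda>x. x(j := x j + a * x i)) \<in> measurable (lebesgue_upto d) (lebesgue_upto d)"
    using assms by (intro measurable_fun_upd_lebesgue) auto
  fix f :: "(nat \<Rightarrow> real) \<Rightarrow> ennreal" assume f: "f \<in> borel_measurable (lebesgue_upto d)"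
  note upd = measurable_fun_upd_line[OF assms(2) f]
  have "(\<integral>\<^sup>+x. f (x(j := x j + a * x i)) \<partial>lebesgue_upto d) =
    (\<integral>\<^sup>+x. (\<integral>\<^sup>+y. f (x(j := y + a * x i)) \<partial>lborel) \<partial>Pi\<^sub>M ({..<d} - {j}) (\<lambda>_. lborel))"
    using assms by (subst nn_integral_lebesgue_upto_coord[OF assms(2) measurable_compose[OF m f]]) auto
  also have "\<dots> = (\<integral>\<^sup>+x. (\<integral>\<^sup>+y. f (x(j := y)) \<partial>lborel) \<partial>Pi\<^sub>M ({..<d} - {j}) (\<lambda>_. lborel))"
    by (intro nn_integral_cong nn_integral_lborel_shift upd)
  also have "\<dots> = integral\<^sup>N (lebesgue_upto d) f"
    using nn_integral_lebesgue_upto_coord[OF assms(2) f] by simp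
  finally show "(\<integral>\<^sup>+x. f (x(j := x j + a * x i)) \<partial>lebesgue_upto d) = integral\<^sup>N (lebesgue_upto d) f" .
qed

lemma preserves_lebesgue_reflection:
  assumes "j < d"
  shows "preserves_lebesgue d (\<lambda>x. x(j := - x j))"
  unfolding preserves_lebesgue_def
proof (intro conjI ballI)
  show m: "(\<lambda>x. x(j := - x j)) \<in> measurable (lebesgue_upto d) (lebesgue_upto d)"
    using assms by (intro measurable_fun_upd_lebesgue) auto
  fix f :: "(nat \<Rightarrow> real) \<Rightarrow> ennreal" assume f: "f \<in> borel_measurable (lebesgue_upto d)"
  note upd = measurable_fun_upd_line[OF assms f]
  have "(\<integral>\<^sup>+x. f (x(j := - x j)) \<partial>lebesgue_upto d) =
    (\<integral>\<^sup>+x. (\<integral>\<^sup>+y. f (x(j := - y)) \<partial>lborel) \<partial>Pi\<^sub>M ({..<d} - {j}) (\<lambda>_. lborel))"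
    using assms by (subst nn_integral_lebesgue_upto_coord[OF assms(1) measurable_compose[OF m f]]) auto
  also have "\<dots> = (\<integral>\<^sup>+x. (\<integral>\<^sup>+y. f (x(j := y)) \<partial>lborel) \<partial>Pi\<^sub>M ({..<d} - {j}) (\<lambda>_. lborel))"
  proof (rule nn_integral_cong)
    fix x :: "nat \<Rightarrow> real" assume "x \<in> space (Pi\<^sub>M ({..<d} - {j}) (\<lambda>_. lborel))"
    from nn_integral_real_affine[OF upd[OF this], of "-1" 0]
    show "(\<integral>\<^sup>+y. f (x(j := - y)) \<partial>lborel) = (\<integral>\<^sup>+y. f (x(j := y)) \<partial>lborel)" by simp
  qed
  also have "\<dots> = integral\<^sup>N (lebesgue_upto d) f"
    using nn_integral_lebesgue_upto_coord[OF assms f] by simp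
  finally show "(\<integral>\<^sup>+x. f (x(j := - x j)) \<partial>lebesgue_upto d) = integral\<^sup>N (lebesgue_upto d) f" .
qed

lemma inner_upto_split2:
  assumes "i < d" "j < d" "i \<noteq> j"
  shows "inner_upto d x y = (\<Sum>k\<in>{..<d} - {i, j}. x k * y k) + x i * y i + x j * y j"
proof -
  have "inner_upto d x y = x i * y i + (\<Sum>k\<in>{..<d} - {i}. x k * y k)"
    unfolding inner_upto_def using assms by (intro sum.remove) auto
  also have "(\<Sum>k\<in>{..<d} - {i}. x k * y k) = x j * y j + (\<Sum>k\<in>{..<d} - {i} - {j}. x k * y k)"
    using assms by (intro sum.remove) auto
  also have "{..<d} - {i} - {j} = {..<d} - {i, j}" by auto
  finally show ?thesis by simp
qed

lemma isometry_upto_comp: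
  "isometry_upto d S \<Longrightarrow> isometry_upto d T \<Longrightarrow> isometry_upto d (\<lambda>x. S (T x))"
  by (simp add: isometry_upto_def preserves_lebesgue_comp)

lemma isometry_upto_id: "isometry_upto d (\<lambda>x. x)"
  by (simp add: isometry_upto_def preserves_lebesgue_id)

text \<open>A plane rotation by an angle other than \<open>\<pi>\<close> is a product of three shears.\<close>

lemma isometry_upto_rotation:
  assumes ij: "i < d" "j < d" "i \<noteq> j" and cs: "c\<^sup>2 + s\<^sup>2 = 1" and s: "s \<noteq> (0::real)"
  shows "isometry_upto d (\<lambda>x. x(i := c * x i - s * x j, j := s * x i + c * x j))"
proof -
  \<comment> \<open>For c = cos a and s = sin a this is - tan (a/2), the parameter of the two outer
    shears; the middle one has parameter \<open>s\<close>.\<close>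
  define t where "t = (c - 1) / s"
  have st: "s * t = c - 1" using s by (simp add: t_def)
  have tc: "t * (1 + c) = - s"
  proof -
    have "t * (1 + c) = (c\<^sup>2 - 1) / s" by (simp add: t_def power2_eq_square algebra_simps)
    also have "\<dots> = - s" using cs s by (simp add: field_simps power2_eq_square)
    finally show ?thesis .
  qed
  let ?S = "\<lambda>x::nat \<Rightarrow> real. x(i := x i + t * x j)" and ?U = "\<lambda>x. x(j := x j + s * x i)"
  have eq: "(\<lambda>x. x(i := c * x i - s * x j, j := s * x i + c * x j)) = (\<lambda>x. ?S (?U (?S x)))"
  proof (intro ext)
    fix x :: "nat \<Rightarrow> real" and k
    have j: "s * x i + c * x j = x j + s * (x i + t * x j)"
    proof -
      have "x j + s * (x i + t * x j) = s * x i + (1 + s * t) * x j" by (simp add: algebra_simps)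
      then show ?thesis using st by simp
    qed
    have "x i + t * x j + t * (x j + s * (x i + t * x j)) =
      (1 + s * t) * x i + (t * (2 + s * t)) * x j" by (simp add: algebra_simps)
    also have "\<dots> = c * x i - s * x j"
    proof -
      have "1 + s * t = c" "2 + s * t = 1 + c" using st by simp_all
      then show ?thesis using tc by (simp only:)
    qed
    finally show "(x(i := c * x i - s * x j, j := s * x i + c * x j)) k = ?S (?U (?S x)) k"
      using ij j by auto
  qed
  have "preserves_lebesgue d (\<lambda>x. x(i := c * x i - s * x j, j := s * x i + c * x j))"
    unfolding eq using ij
    by (intro preserves_lebesgue_comp[OF preserves_lebesgue_shear
          preserves_lebesgue_comp[OF preserves_lebesgue_shear preserves_lebesgue_shear]]) auto
  moreover have "inner_upto d (x(i := c * x i - s * x j, j := s * x i + c * x j))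
      (y(i := c * y i - s * y j, j := s * y i + c * y j)) = inner_upto d x y" for x y
  proof -
    have "(c * x i - s * x j) * (c * y i - s * y j) + (s * x i + c * x j) * (s * y i + c * y j) =
      (c\<^sup>2 + s\<^sup>2) * (x i * y i) + (c\<^sup>2 + s\<^sup>2) * (x j * y j)"
      by (simp add: algebra_simps power2_eq_square)
    then show ?thesis using ij cs by (simp add: inner_upto_split2[OF ij])
  qed
  ultimately show ?thesis by (simp add: isometry_upto_def)
qed

lemma isometry_upto_reflection:
  assumes "j < d"
  shows "isometry_upto d (\<lambda>x. x(j := - x j))"
proof -
  have "inner_upto d (x(j := - x j)) (y(j := - y j)) = inner_upto d x y" for x y :: "nat \<Rightarrow> real"
    unfolding inner_upto_def by (intro sum.cong) auto
  then show ?thesis using assms preserves_lebesgue_reflection by (simp add: isometry_upto_def)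
qed

text \<open>Givens rotations: the coordinates 0, 1, ... are rotated one after another into the last
  coordinate. Each rotation changes only coordinates \<open>k\<close> and \<open>d\<close>, so the
  zeros produced before survive.\<close>

lemma isometry_upto_eliminate:
  assumes "k \<le> d"
  shows "\<exists>T. isometry_upto (Suc d) T \<and> (\<forall>i<k. T x i = 0)"
  using assms
proof (induction k)
  case 0
  then show ?case using isometry_upto_id by blast
next
  case (Suc k)
  then obtain T where T: "isometry_upto (Suc d) T" "\<And>i. i < k \<Longrightarrow> T x i = 0" by auto
  show ?case
  proof (cases "T x k = 0")
    case True
    then show ?thesis using T by (metis less_Suc_eq)
  next
    case False
    define r where "r = sqrt ((T x k)\<^sup>2 + (T x d)\<^sup>2)"
    have "(T x k)\<^sup>2 + (T x d)\<^sup>2 > 0" using False by (simp add: add_pos_nonneg)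
    then have r: "r > 0" "r\<^sup>2 = (T x k)\<^sup>2 + (T x d)\<^sup>2" by (auto simp: r_def)
    define s c where "s = T x k / r" and "c = T x d / r"
    let ?R = "\<lambda>x. x(k := c * x k - s * x d, d := s * x k + c * x d)"
    have R: "isometry_upto (Suc d) ?R"
    proof (rule isometry_upto_rotation)
      show "c\<^sup>2 + s\<^sup>2 = 1"
      proof -
        have "c\<^sup>2 + s\<^sup>2 = ((T x k)\<^sup>2 + (T x d)\<^sup>2) / r\<^sup>2"
          by (simp add: s_def c_def power_divide add_divide_distrib)
        then show ?thesis using r by (metis divide_self less_irrefl power_eq_0_iff)
      qed
      show "s \<noteq> 0" using False r by (simp add: s_def)
    qed (use Suc in auto)
    have "?R (T x) i = 0" if "i < Suc k" for i
      using that T Suc.prems by (auto simp: c_def s_def less_Suc_eq)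
    then show ?thesis using isometry_upto_comp[OF R T(1)] by blast
  qed
qed

text \<open>After the elimination the last coordinate is the norm of \<open>x\<close> up to sign,
  because inner products are preserved; a reflection corrects the sign.\<close>

lemma isometry_upto_to_axis:
  "\<exists>T. isometry_upto (Suc d) T \<and> (\<forall>i<d. T x i = 0) \<and> T x d = sqrt (inner_upto (Suc d) x x)"
proof -
  obtain T where T: "isometry_upto (Suc d) T" "\<And>i. i < d \<Longrightarrow> T x i = 0"
    using isometry_upto_eliminate[of d d x] by auto
  have "inner_upto (Suc d) x x = inner_upto (Suc d) (T x) (T x)"
    using T by (simp add: isometry_upto_def)
  also have "\<dots> = (T x d)\<^sup>2" using T by (simp add: inner_upto_def power2_eq_square)
  finally have eq: "sqrt (inner_upto (Suc d) x x) = \<bar>T x d\<bar>" by simp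
  show ?thesis
  proof (cases "T x d \<ge> 0")
    case True
    then show ?thesis using T eq by auto
  next
    case False
    let ?R = "\<lambda>x. x(d := - x d)"
    have "isometry_upto (Suc d) (\<lambda>x. ?R (T x))"
      by (rule isometry_upto_comp[OF isometry_upto_reflection T(1)]) simp
    then show ?thesis using T eq False by (intro exI[of _ "\<lambda>x. ?R (T x)"]) auto
  qed
qed

section \<open>Volumes of intersections of slabs\<close>

lemma inner_upto_measurable [measurable (raw)]:
  assumes "\<And>i. i < d \<Longrightarrow> (\<lambda>x. f x i) \<in> borel_measurable M"
    and "\<And>i. i < d \<Longrightarrow> (\<lambda>x. g x i) \<in> borel_measurable M"
  shows "(\<lambda>x. inner_upto d (f x) (g x)) \<in> borel_measurable M"
  unfolding inner_upto_def using assms by (intro borel_measurable_sum borel_measurable_times) auto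

lemma inner_upto_Suc: "inner_upto (Suc d) x y = inner_upto d x y + x d * y d"
  by (simp add: inner_upto_def)

lemma inner_upto_upd [simp]:
  "inner_upto d (x(d := t)) y = inner_upto d x y" "inner_upto d x (y(d := t)) = inner_upto d x y"
  by (auto simp: inner_upto_def)

lemma inner_upto_self_nonneg [simp]: "inner_upto d x x \<ge> 0"
  by (simp add: inner_upto_def sum_nonneg)

lemma inner_upto_commute: "inner_upto d x y = inner_upto d y x"
  by (simp add: inner_upto_def mult.commute)

text \<open>For finite families this is the dual form of linear independence. It passes easily
  through a Gram-Schmidt step: prescribing the value 0 at \<open>k\<close> confines the solution to
  the orthogonal complement of \<open>y k\<close>.\<close>

definition solvable_upto :: "nat \<Rightarrow> 'i set \<Rightarrow> ('i \<Rightarrow> nat \<Rightarrow> real) \<Rightarrow> bool" where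
  "solvable_upto d I y \<longleftrightarrow> (\<forall>c. \<exists>w. \<forall>i\<in>I. inner_upto d (y i) w = c i)"

text \<open>The centres \<open>c\<close> are arbitrary, because slicing along an axis shifts them by
  amounts depending on the slice.\<close>

definition slab :: "nat \<Rightarrow> 'i set \<Rightarrow> ('i \<Rightarrow> nat \<Rightarrow> real) \<Rightarrow> ('i \<Rightarrow> real) \<Rightarrow> real \<Rightarrow> (nat \<Rightarrow> real) set" where
  "slab d I y c \<epsilon> = {w \<in> space (lebesgue_upto d). \<forall>i\<in>I. \<bar>inner_upto d (y i) w - c i\<bar> \<le> \<epsilon>}"

lemma slab_measurable [measurable]:
  assumes "finite I" shows "slab d I y c \<epsilon> \<in> sets (lebesgue_upto d)"
  unfolding slab_def using assms by measurable

text \<open>One Gram-Schmidt step: rotate \<open>y k\<close> onto the last axis and slice along it.\<close>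

lemma slab_volume_step:
  assumes I: "finite I" "k \<in> I" and solv: "solvable_upto (Suc d) I y"
    and L: "inner_upto (Suc d) (y k) (y k) \<le> L\<^sup>2" "L > 0" and \<epsilon>: "\<epsilon> > 0" and A: "A \<ge> 0"
    and IH: "\<And>z c. solvable_upto d (I - {k}) z \<Longrightarrow>
      (\<And>i. i \<in> I - {k} \<Longrightarrow> inner_upto d (z i) (z i) \<le> inner_upto (Suc d) (y i) (y i)) \<Longrightarrow>
      (\<And>i. i \<in> I - {k} \<Longrightarrow> inner_upto d (z i) (z i) \<le> inner_upto (Suc d) (y i) (y i)
          - 2 * inner_upto (Suc d) (y i) (y k) + inner_upto (Suc d) (y k) (y k)) \<Longrightarrow>
      ennreal A \<le> emeasure (lebesgue_upto d) (slab d (I - {k}) z c \<epsilon>)"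
  shows "ennreal (2 * \<epsilon> / L * A) \<le> emeasure (lebesgue_upto (Suc d)) (slab (Suc d) I y c \<epsilon>)"
proof -
  obtain T where T: "isometry_upto (Suc d) T" and T0: "\<And>i. i < d \<Longrightarrow> T (y k) i = 0"
    and Td: "T (y k) d = sqrt (inner_upto (Suc d) (y k) (y k))"
    using isometry_upto_to_axis[of d "y k"] by blast
  define l where "l = T (y k) d"
  define Y where "Y i = T (y i)" for i
  have inner_T: "inner_upto (Suc d) (T a) (T b) = inner_upto (Suc d) a b" for a b
    using T by (simp add: isometry_upto_def)
  have Yk: "inner_upto (Suc d) (Y k) w = l * w d" for w
  proof -
    have "inner_upto d (Y k) w = 0" using T0 by (simp add: inner_upto_def Y_def)
    then show ?thesis by (simp add: inner_upto_Suc Y_def l_def)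
  qed
  have "l \<ge> 0" using Td by (simp add: l_def)
  moreover have "l \<noteq> 0"
  proof
    assume "l = 0"
    obtain w where "inner_upto (Suc d) (y k) w = 1"
      using solv I unfolding solvable_upto_def by (auto dest: spec[of _ "\<lambda>_. 1"])
    then have "inner_upto (Suc d) (Y k) (T w) = 1" by (simp add: Y_def inner_T)
    then show False using \<open>l = 0\<close> Yk by simp
  qed
  moreover have "l \<le> L"
    using L Td unfolding l_def by (simp add: real_le_lsqrt)
  ultimately have l: "l > 0" "l \<le> L" by auto
  have solvY: "solvable_upto d (I - {k}) Y"
    unfolding solvable_upto_def
  proof
    fix c
    obtain w where w: "\<forall>i\<in>I. inner_upto (Suc d) (y i) w = (c(k := 0)) i"
      using solv unfolding solvable_upto_def by blast
    have "inner_upto (Suc d) (Y k) (T w) = 0" using w I by (simp add: Y_def inner_T)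
    then have "T w d = 0" using Yk l by simp
    moreover have "inner_upto (Suc d) (Y i) (T w) = c i" if "i \<in> I - {k}" for i
      using w that by (auto simp: Y_def inner_T)
    ultimately have "\<forall>i\<in>I - {k}. inner_upto d (Y i) (T w) = c i"
      by (simp add: inner_upto_Suc)
    then show "\<exists>w. \<forall>i\<in>I - {k}. inner_upto d (Y i) w = c i" by blast
  qed
  have le1: "inner_upto d (Y i) (Y i) \<le> inner_upto (Suc d) (y i) (y i)" for i
  proof -
    have "inner_upto d (Y i) (Y i) \<le> inner_upto (Suc d) (Y i) (Y i)" by (simp add: inner_upto_Suc)
    then show ?thesis by (simp add: Y_def inner_T)
  qed
  \<comment> \<open>The projection orthogonal to \<open>y k\<close> is no longer than the difference
    of \<open>y i\<close> and \<open>y k\<close>. For points close together this is far better than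
    \<open>le1\<close>.\<close>
  have le2: "inner_upto d (Y i) (Y i) \<le> inner_upto (Suc d) (y i) (y i)
          - 2 * inner_upto (Suc d) (y i) (y k) + inner_upto (Suc d) (y k) (y k)" for i
  proof -
    have e1: "inner_upto (Suc d) (y i) (y k) = l * Y i d"
      using Yk[of "Y i"] inner_T[of "y k" "y i"] by (simp add: Y_def inner_upto_commute)
    have e2: "inner_upto (Suc d) (y k) (y k) = l\<^sup>2"
      using Td by (simp add: l_def)
    have e3: "inner_upto (Suc d) (y i) (y i) = inner_upto d (Y i) (Y i) + (Y i d)\<^sup>2"
      using inner_T[of "y i" "y i"] by (simp add: Y_def inner_upto_Suc power2_eq_square)
    have "(Y i d - l)\<^sup>2 \<ge> 0" by simp
    then show ?thesis unfolding e1 e2 e3 by (simp add: power2_diff algebra_simps)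
  qed
  let ?c = "\<lambda>t i. c i - Y i d * t"
  have mem: "x(d := t) \<in> slab (Suc d) I Y c \<epsilon> \<longleftrightarrow>
      t \<in> {(c k - \<epsilon>) / l .. (c k + \<epsilon>) / l} \<and> x \<in> slab d (I - {k}) Y (?c t) \<epsilon>"
    if "x \<in> space (lebesgue_upto d)" for x :: "nat \<Rightarrow> real" and t
  proof -
    have "x(d := t) \<in> space (lebesgue_upto (Suc d))"
      using that by (auto simp: space_PiM PiE_iff extensional_def)
    moreover have "\<bar>inner_upto (Suc d) (Y k) (x(d := t)) - c k\<bar> \<le> \<epsilon> \<longleftrightarrow>
       t \<in> {(c k - \<epsilon>) / l .. (c k + \<epsilon>) / l}"
      unfolding Yk using l by (auto simp: abs_le_iff field_simps)
    moreover have "\<bar>inner_upto (Suc d) (Y i) (x(d := t)) - c i\<bar> \<le> \<epsilon> \<longleftrightarrow>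
       \<bar>inner_upto d (Y i) x - ?c t i\<bar> \<le> \<epsilon>" for i
      by (simp add: inner_upto_Suc algebra_simps)
    moreover have "(\<forall>i\<in>I. Q i) \<longleftrightarrow> Q k \<and> (\<forall>i\<in>I - {k}. Q i)" for Q using I by blast
    ultimately show ?thesis
      using that unfolding slab_def by (simp only: mem_Collect_eq) blast
  qed
  have "emeasure (lebesgue_upto (Suc d)) (slab (Suc d) I y c \<epsilon>) =
    emeasure (lebesgue_upto (Suc d)) {w \<in> space (lebesgue_upto (Suc d)).
       \<forall>i\<in>I. \<bar>inner_upto (Suc d) (Y i) (T w) - c i\<bar> \<le> \<epsilon>}"
    by (simp add: slab_def Y_def inner_T)
  also have "\<dots> = emeasure (lebesgue_upto (Suc d)) (slab (Suc d) I Y c \<epsilon>)"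
    unfolding slab_def using T I
    by (intro preserves_lebesgue_emeasure) (auto simp: isometry_upto_def)
  also have "\<dots> = (\<integral>\<^sup>+x. indicator (slab (Suc d) I Y c \<epsilon>) x \<partial>lebesgue_upto (Suc d))"
    using I by simp
  also have "\<dots> = (\<integral>\<^sup>+t. (\<integral>\<^sup>+x. indicator (slab (Suc d) I Y c \<epsilon>) (x(d := t)) \<partial>lebesgue_upto d) \<partial>lborel)"
  proof -
    have "indicator (slab (Suc d) I Y c \<epsilon>) \<in> borel_measurable (Pi\<^sub>M (insert d {..<d}) (\<lambda>_. lborel))"
      using slab_measurable[OF I(1), of "Suc d" Y c \<epsilon>] by (simp add: lessThan_Suc)
    then show ?thesis
      unfolding lessThan_Suc by (intro lebesgue_product.product_nn_integral_insert_rev) auto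
  qed
  also have "\<dots> = (\<integral>\<^sup>+t. indicator {(c k - \<epsilon>) / l .. (c k + \<epsilon>) / l} t *
      emeasure (lebesgue_upto d) (slab d (I - {k}) Y (?c t) \<epsilon>) \<partial>lborel)"
  proof (rule nn_integral_cong)
    fix t :: real
    have "(\<integral>\<^sup>+x. indicator (slab (Suc d) I Y c \<epsilon>) (x(d := t)) \<partial>lebesgue_upto d) =
      (\<integral>\<^sup>+x. indicator {(c k - \<epsilon>) / l .. (c k + \<epsilon>) / l} t *
        indicator (slab d (I - {k}) Y (?c t) \<epsilon>) x \<partial>lebesgue_upto d)"
      by (intro nn_integral_cong) (simp add: indicator_def mem)
    then show "(\<integral>\<^sup>+x. indicator (slab (Suc d) I Y c \<epsilon>) (x(d := t)) \<partial>lebesgue_upto d) =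
      indicator {(c k - \<epsilon>) / l .. (c k + \<epsilon>) / l} t *
        emeasure (lebesgue_upto d) (slab d (I - {k}) Y (?c t) \<epsilon>)"
      using I by (simp add: nn_integral_cmult)
  qed
  \<comment> \<open>\<open>A\<close> bounds every slice from below, whatever its shifted centres, so
    only the length \<open>2 * \<epsilon> / l\<close> of the range of \<open>t\<close>
    enters.\<close>
  also have "\<dots> \<ge> (\<integral>\<^sup>+t. ennreal A * indicator {(c k - \<epsilon>) / l .. (c k + \<epsilon>) / l} t \<partial>lborel)"
    using IH[OF solvY le1 le2] by (intro nn_integral_mono) (auto simp: indicator_def)
  also have "(\<integral>\<^sup>+t. ennreal A * indicator {(c k - \<epsilon>) / l .. (c k + \<epsilon>) / l} t \<partial>lborel) =
      ennreal (2 * \<epsilon> / l * A)"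
  proof -
    have "(c k + \<epsilon>) / l - (c k - \<epsilon>) / l = 2 * \<epsilon> / l" using l by (simp add: field_simps)
    moreover have "(c k - \<epsilon>) / l \<le> (c k + \<epsilon>) / l" using l \<epsilon> by (simp add: divide_right_mono)
    ultimately show ?thesis
      using A l \<epsilon> by (simp add: nn_integral_cmult mult.commute flip: ennreal_mult)
  qed
  finally have "ennreal (2 * \<epsilon> / l * A) \<le> emeasure (lebesgue_upto (Suc d)) (slab (Suc d) I y c \<epsilon>)" .
  moreover have "2 * \<epsilon> / L * A \<le> 2 * \<epsilon> / l * A"
    using l L \<epsilon> A by (intro mult_right_mono divide_left_mono) auto
  ultimately show ?thesis by (meson ennreal_leI order_trans)
qed

text \<open>Hadamard's inequality, in the form of a volume bound.\<close>

lemma slab_volume: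
  assumes "finite I" "card I = d" "solvable_upto d I y" "L > 0" "\<epsilon> > 0"
    and "\<And>i. i \<in> I \<Longrightarrow> inner_upto d (y i) (y i) \<le> L\<^sup>2"
  shows "ennreal ((2 * \<epsilon> / L) ^ d) \<le> emeasure (lebesgue_upto d) (slab d I y c \<epsilon>)"
  using assms
proof (induction d arbitrary: I y c)
  case 0
  then show ?case by (simp add: slab_def space_PiM)
next
  case (Suc d)
  then obtain k where k: "k \<in> I" by fastforce
  have "ennreal (2 * \<epsilon> / L * (2 * \<epsilon> / L) ^ d) \<le> emeasure (lebesgue_upto (Suc d)) (slab (Suc d) I y c \<epsilon>)"
  proof (rule slab_volume_step[OF _ k])
    fix z :: "'a \<Rightarrow> nat \<Rightarrow> real" and c
    assume z: "solvable_upto d (I - {k}) z"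
      "\<And>i. i \<in> I - {k} \<Longrightarrow> inner_upto d (z i) (z i) \<le> inner_upto (Suc d) (y i) (y i)"
    show "ennreal ((2 * \<epsilon> / L) ^ d) \<le> emeasure (lebesgue_upto d) (slab d (I - {k}) z c \<epsilon>)"
    proof (rule Suc.IH)
      show "inner_upto d (z i) (z i) \<le> L\<^sup>2" if "i \<in> I - {k}" for i
        using z(2)[OF that] Suc.prems(6)[of i] that by auto
    qed (use Suc.prems k z in auto)
  qed (use Suc.prems k in auto)
  then show ?case by simp
qed

text \<open>The first Gram-Schmidt step is taken at a unit vector and contributes 2 \<epsilon>. It
  replaces the other d vectors by projections no longer than |y i - y k|, and |y i - y k|^2 = 2 - 2
  <y i, y k> is at most (2 \<rho>)^2. Hadamard's bound with L = 2 \<rho> then contributes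
  \<epsilon>/\<rho> for each of them.\<close>

lemma slab_volume_clustered:
  assumes I: "finite I" "card I = Suc d" and solv: "solvable_upto (Suc d) I y"
    and pos: "\<rho> > 0" "\<epsilon> > 0"
    and unit: "\<And>i. i \<in> I \<Longrightarrow> inner_upto (Suc d) (y i) (y i) = 1"
    and close: "\<And>i j. i \<in> I \<Longrightarrow> j \<in> I \<Longrightarrow> inner_upto (Suc d) (y i) (y j) \<ge> 1 - 2 * \<rho>\<^sup>2"
  shows "ennreal (2 * \<epsilon> * (\<epsilon> / \<rho>) ^ d) \<le> emeasure (lebesgue_upto (Suc d)) (slab (Suc d) I y c \<epsilon>)"
proof -
  obtain k where k: "k \<in> I" using I by fastforce
  have "ennreal (2 * \<epsilon> / 1 * (2 * \<epsilon> / (2 * \<rho>)) ^ d) \<le>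
      emeasure (lebesgue_upto (Suc d)) (slab (Suc d) I y c \<epsilon>)"
  proof (rule slab_volume_step[OF _ k])
    fix z :: "'a \<Rightarrow> nat \<Rightarrow> real" and c
    assume z: "solvable_upto d (I - {k}) z"
      "\<And>i. i \<in> I - {k} \<Longrightarrow> inner_upto d (z i) (z i) \<le> inner_upto (Suc d) (y i) (y i)
          - 2 * inner_upto (Suc d) (y i) (y k) + inner_upto (Suc d) (y k) (y k)"
    show "ennreal ((2 * \<epsilon> / (2 * \<rho>)) ^ d) \<le> emeasure (lebesgue_upto d) (slab d (I - {k}) z c \<epsilon>)"
    proof (rule slab_volume)
      show "inner_upto d (z i) (z i) \<le> (2 * \<rho>)\<^sup>2" if "i \<in> I - {k}" for i
        using z(2)[OF that] unit[of i] unit[of k] close[of i k] that k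
        by (simp add: power_mult_distrib)
    qed (use I k z pos in auto)
  qed (use I k solv unit pos in auto)
  then show ?thesis by simp
qed

section \<open>Spherical cones\<close>

lemma ball_volume:
  assumes "r \<ge> 0" "d \<ge> 1"
  shows "emeasure (lebesgue_upto d) {x \<in> space (lebesgue_upto d). inner_upto d x x \<le> r\<^sup>2} =
    ennreal (unit_ball_vol d * r ^ d)"
proof (cases "r = 0")
  case True
  have eq: "{x \<in> space (lebesgue_upto d). inner_upto d x x \<le> r\<^sup>2} = Pi\<^sub>E {..<d} (\<lambda>_. {0::real})"
  proof -
    have "inner_upto d x x \<le> 0 \<longleftrightarrow> (\<forall>i<d. x i = 0)" for x
      using sum_nonneg_eq_0_iff[of "{..<d}" "\<lambda>i. x i * x i"]
      by (auto simp: inner_upto_def order_antisym_conv sum_nonneg)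
    then show ?thesis using True by (auto simp: space_PiM PiE_iff extensional_def fun_eq_iff)
  qed
  have "emeasure (lebesgue_upto d) (Pi\<^sub>E {..<d} (\<lambda>_. {0::real})) = (\<Prod>i<d. emeasure lborel {0::real})"
    by (rule lebesgue_product.emeasure_PiM) auto
  also have "\<dots> = ennreal (unit_ball_vol d * r ^ d)" using True assms by (simp add: power_0_left)
  finally show ?thesis unfolding eq .
next
  case False
  then have "r > 0" using assms by simp
  have "sqrt (\<Sum>i<d. (x i)\<^sup>2) \<le> r \<longleftrightarrow> inner_upto d x x \<le> r\<^sup>2" for x
    using \<open>r > 0\<close> by (simp add: inner_upto_def power2_eq_square real_sqrt_le_iff' sum_nonneg)
  then have "{x \<in> space (lebesgue_upto d). inner_upto d x x \<le> r\<^sup>2} =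
      {f. sqrt (\<Sum>i<d. (f i)\<^sup>2) \<le> r} \<inter> space (lebesgue_upto d)"
    by auto
  then show ?thesis using emeasure_cball_aux[of "{..<d}" r] \<open>r > 0\<close> by simp
qed

text \<open>The volume of the part of the unit ball of dimension d + 1 whose directions lie in the
  cap of height \<open>s\<close>. The first term is the cone with apex 0 over a d-dimensional ball
  of radius sqrt (1 - s^2), the integral is the cap cut off at height \<open>s\<close>. Note that
  \<open>d\<close> is the dimension of the slices, one less than that of the space.\<close>

definition cone_volume :: "nat \<Rightarrow> real \<Rightarrow> real" where
  "cone_volume d s = unit_ball_vol d *
     (s * sqrt (1 - s\<^sup>2) ^ d / (real d + 1) + integral {s..1} (\<lambda>x. sqrt (1 - x\<^sup>2) ^ d))"

lemma sqrt_pow_integrable: "(\<lambda>x::real. sqrt (1 - x\<^sup>2) ^ d) integrable_on {a..b}"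
  by (intro integrable_continuous_interval continuous_intros)

text \<open>With \<open>q\<close> the squared norm of the remaining coordinates, each slice is a
  ball: below height \<open>s\<close> the cone condition is the binding one, above \<open>s\<close>
  the unit ball. The excluded values of \<open>t\<close> form a null set.\<close>

lemma cone_slice:
  fixes t s :: real
  assumes s: "0 \<le> s" "s \<le> 1" and t: "t \<noteq> 0" "t \<noteq> 1" "t \<noteq> s" and q: "q \<ge> 0"
  shows "q + t\<^sup>2 \<le> 1 \<and> s * sqrt (q + t\<^sup>2) \<le> t \<longleftrightarrow>
    t \<in> {0<..<s} \<and> q \<le> (t * (sqrt (1 - s\<^sup>2) / s))\<^sup>2 \<or> t \<in> {s<..<1} \<and> q \<le> (sqrt (1 - t\<^sup>2))\<^sup>2"
proof -
  have s1: "s\<^sup>2 \<le> 1" using s by (simp add: power_le_one)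
  consider "t < 0" | "0 < t" "t < s" | "s < t" "t < 1" | "t > 1" using s t by linarith
  then show ?thesis
  proof cases
    case 1
    have "s * sqrt (q + t\<^sup>2) \<ge> 0" using s q by simp
    then show ?thesis using 1 s by auto
  next
    case 2
    have "s * sqrt (q + t\<^sup>2) \<le> t \<longleftrightarrow> sqrt (s\<^sup>2 * (q + t\<^sup>2)) \<le> t"
      using s by (simp add: real_sqrt_mult)
    also have "\<dots> \<longleftrightarrow> s\<^sup>2 * (q + t\<^sup>2) \<le> t\<^sup>2"
      using 2 q by (intro real_sqrt_le_iff') auto
    also have "\<dots> \<longleftrightarrow> q \<le> (t * (sqrt (1 - s\<^sup>2) / s))\<^sup>2"
      using 2 s1 by (simp add: power_mult_distrib power_divide field_simps)
    finally have eq: "s * sqrt (q + t\<^sup>2) \<le> t \<longleftrightarrow> q \<le> (t * (sqrt (1 - s\<^sup>2) / s))\<^sup>2"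
      and eq': "s * sqrt (q + t\<^sup>2) \<le> t \<longleftrightarrow> s\<^sup>2 * (q + t\<^sup>2) \<le> t\<^sup>2"
      using \<open>(s\<^sup>2 * (q + t\<^sup>2) \<le> t\<^sup>2) = (q \<le> (t * (sqrt (1 - s\<^sup>2) / s))\<^sup>2)\<close> by auto
    have "q + t\<^sup>2 \<le> 1" if "s\<^sup>2 * (q + t\<^sup>2) \<le> t\<^sup>2"
    proof (rule ccontr)
      assume "\<not> q + t\<^sup>2 \<le> 1"
      then have "s\<^sup>2 * 1 \<le> s\<^sup>2 * (q + t\<^sup>2)" by (intro mult_left_mono) auto
      moreover have "t\<^sup>2 < s\<^sup>2" using 2 by (intro power_strict_mono) auto
      ultimately show False using that by simp
    qed
    then show ?thesis using 2 eq eq' by auto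
  next
    case 3
    have "t\<^sup>2 \<le> 1" using 3 s by (simp add: power_le_one)
    moreover have "s * sqrt (q + t\<^sup>2) \<le> t" if "q + t\<^sup>2 \<le> 1"
    proof -
      have "sqrt (q + t\<^sup>2) \<le> 1" using that by simp
      then have "s * sqrt (q + t\<^sup>2) \<le> s * 1" using s by (intro mult_left_mono) auto
      then show ?thesis using 3 by simp
    qed
    ultimately show ?thesis using 3 by auto
  next
    case 4
    then have "t\<^sup>2 > 1" by (simp add: one_less_power)
    then have "\<not> q + t\<^sup>2 \<le> 1" using q by linarith
    then show ?thesis using 4 s by auto
  qed
qed

lemma power_primitive:
  "DERIV (\<lambda>t. K * m ^ d * t ^ Suc d / (real d + 1)) t :> K * (t * m) ^ d" for K m t :: real
proof -
  have "DERIV (\<lambda>t. K * m ^ d * t ^ Suc d / (real d + 1)) t :>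
      K * m ^ d * (real (Suc d) * t ^ (Suc d - Suc 0)) / (real d + 1)"
    by (intro DERIV_cdivide DERIV_cmult DERIV_pow)
  moreover have "K * m ^ d * (real (Suc d) * t ^ (Suc d - Suc 0)) / (real d + 1) = K * (t * m) ^ d"
  proof -
    have "K * m ^ d * (real (Suc d) * t ^ (Suc d - Suc 0)) = (real d + 1) * (K * (t * m) ^ d)"
      by (simp add: power_mult_distrib algebra_simps)
    moreover have "real d + 1 \<noteq> 0" by linarith
    ultimately show ?thesis by (metis nonzero_mult_div_cancel_left)
  qed
  ultimately show ?thesis by simp
qed

text \<open>Integration over the last coordinate, with the slices of \<open>cone_slice\<close>. The
  volumes of the slices of the cone are a power of \<open>t\<close> and are integrated explicitly;
  the integral over the cap is kept as it is.\<close>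

lemma cone_volume_eq_emeasure:
  assumes d: "d \<ge> 1" and s: "0 \<le> s" "s \<le> 1"
  shows "emeasure (lebesgue_upto (Suc d)) {y \<in> space (lebesgue_upto (Suc d)).
    inner_upto (Suc d) y y \<le> 1 \<and> s * sqrt (inner_upto (Suc d) y y) \<le> y d} = ennreal (cone_volume d s)"
    (is "emeasure ?M ?S = _")
proof -
  let ?\<kappa> = "unit_ball_vol (real d)" and ?m = "sqrt (1 - s\<^sup>2) / s"
  have s1: "s\<^sup>2 \<le> 1" using s by (simp add: power_le_one)
  have m: "?m \<ge> 0" using s s1 by simp
  have "(\<lambda>x. x d) \<in> borel_measurable ?M"
    using measurable_component_singleton[of d "{..<Suc d}" "\<lambda>_. lborel :: real measure"] by simp
  moreover have "(\<lambda>x. inner_upto (Suc d) x x) \<in> borel_measurable ?M" by measurable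
  ultimately have S: "?S \<in> sets ?M"
    by (intro sets.sets_Collect_conj borel_measurable_le borel_measurable_times
        measurable_compose[OF _ borel_measurable_sqrt]) auto
  have "emeasure ?M ?S = (\<integral>\<^sup>+x. indicator ?S x \<partial>?M)" using S by simp
  also have "\<dots> = (\<integral>\<^sup>+t. (\<integral>\<^sup>+x. indicator ?S (x(d := t)) \<partial>lebesgue_upto d) \<partial>lborel)"
  proof -
    have "indicator ?S \<in> borel_measurable (Pi\<^sub>M (insert d {..<d}) (\<lambda>_. lborel))"
      using S unfolding lessThan_Suc[symmetric] by (rule borel_measurable_indicator)
    then show ?thesis
      unfolding lessThan_Suc by (intro lebesgue_product.product_nn_integral_insert_rev) auto
  qed
  also have "\<dots> = (\<integral>\<^sup>+t. ennreal (?\<kappa> * (t * ?m) ^ d) * indicator {0..s} t +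
      ennreal (?\<kappa> * sqrt (1 - t\<^sup>2) ^ d) * indicator {s..1} t \<partial>lborel)"
  proof (intro nn_integral_cong_AE)
    have "AE t in lborel. t \<notin> {0, s, 1::real}"
      by (intro AE_not_in countable_imp_null_set_lborel) auto
    then show "AE t in lborel. (\<integral>\<^sup>+x. indicator ?S (x(d := t)) \<partial>lebesgue_upto d) =
      ennreal (?\<kappa> * (t * ?m) ^ d) * indicator {0..s} t +
      ennreal (?\<kappa> * sqrt (1 - t\<^sup>2) ^ d) * indicator {s..1} t"
    proof eventually_elim
      case (elim t)
      let ?A = "{x \<in> space (lebesgue_upto d). inner_upto d x x \<le> (t * ?m)\<^sup>2}"
      let ?B = "{x \<in> space (lebesgue_upto d). inner_upto d x x \<le> (sqrt (1 - t\<^sup>2))\<^sup>2}"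
      have AB: "?A \<in> sets (lebesgue_upto d)" "?B \<in> sets (lebesgue_upto d)" by measurable
      have "(\<integral>\<^sup>+x. indicator ?S (x(d := t)) \<partial>lebesgue_upto d) =
        (\<integral>\<^sup>+x. indicator {0<..<s} t * indicator ?A x + indicator {s<..<1} t * indicator ?B x
          \<partial>lebesgue_upto d)"
      proof (rule nn_integral_cong)
        fix x assume x: "x \<in> space (lebesgue_upto d)"
        have "x(d := t) \<in> space ?M"
          using x by (auto simp: space_PiM PiE_iff extensional_def)
        then have "x(d := t) \<in> ?S \<longleftrightarrow> inner_upto d x x + t\<^sup>2 \<le> 1 \<and> s * sqrt (inner_upto d x x + t\<^sup>2) \<le> t"
          by (simp add: inner_upto_Suc power2_eq_square)
        also have "\<dots> \<longleftrightarrow> t \<in> {0<..<s} \<and> x \<in> ?A \<or> t \<in> {s<..<1} \<and> x \<in> ?B"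
          using cone_slice[of s t "inner_upto d x x"] s elim x by simp
        finally show "indicator ?S (x(d := t)) =
          indicator {0<..<s} t * indicator ?A x + indicator {s<..<1} t * (indicator ?B x :: ennreal)"
          by (auto simp: indicator_def)
      qed
      also have "\<dots> = indicator {0<..<s} t * emeasure (lebesgue_upto d) ?A +
          indicator {s<..<1} t * emeasure (lebesgue_upto d) ?B"
        using AB by (simp add: nn_integral_add nn_integral_cmult)
      also have "indicator {0<..<s} t * emeasure (lebesgue_upto d) ?A =
          ennreal (?\<kappa> * (t * ?m) ^ d) * indicator {0..s} t"
      proof (cases "t \<in> {0<..<s}")
        case True
        then have "t * ?m \<ge> 0" using m by (intro mult_nonneg_nonneg) auto
        then show ?thesis using True d by (simp add: ball_volume)
      next
        case False
        then show ?thesis using elim by (auto simp: indicator_def)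
      qed
      also have "indicator {s<..<1} t * emeasure (lebesgue_upto d) ?B =
          ennreal (?\<kappa> * sqrt (1 - t\<^sup>2) ^ d) * indicator {s..1} t"
      proof (cases "t \<in> {s<..<1}")
        case True
        then have "t\<^sup>2 \<le> 1" using s by (simp add: power_le_one)
        then have "sqrt (1 - t\<^sup>2) \<ge> 0" by simp
        from ball_volume[OF this d] show ?thesis using True by simp
      next
        case False
        then show ?thesis using elim by (auto simp: indicator_def)
      qed
      finally show ?case .
    qed
  qed
  also have "\<dots> = (\<integral>\<^sup>+t. ennreal (?\<kappa> * (t * ?m) ^ d) * indicator {0..s} t \<partial>lborel) +
      (\<integral>\<^sup>+t. ennreal (?\<kappa> * sqrt (1 - t\<^sup>2) ^ d) * indicator {s..1} t \<partial>lborel)"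
    by (intro nn_integral_add) measurable
  also have "(\<integral>\<^sup>+t. ennreal (?\<kappa> * (t * ?m) ^ d) * indicator {0..s} t \<partial>lborel) =
      ennreal (?\<kappa> * ?m ^ d * s ^ Suc d / (real d + 1) - ?\<kappa> * ?m ^ d * 0 ^ Suc d / (real d + 1))"
  proof (rule nn_integral_FTC_Icc)
    show "DERIV (\<lambda>t. ?\<kappa> * ?m ^ d * t ^ Suc d / (real d + 1)) t :> ?\<kappa> * (t * ?m) ^ d" for t
      by (rule power_primitive)
    show "0 \<le> ?\<kappa> * (t * ?m) ^ d" if "t \<in> {0..s}" for t
      using that m by (intro mult_nonneg_nonneg zero_le_power) auto
  qed (use s in auto)
  also have "(\<integral>\<^sup>+t. ennreal (?\<kappa> * sqrt (1 - t\<^sup>2) ^ d) * indicator {s..1} t \<partial>lborel) =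
      ennreal (?\<kappa> * integral {s..1} (\<lambda>x. sqrt (1 - x\<^sup>2) ^ d))"
  proof -
    have "((\<lambda>x. ?\<kappa> * sqrt (1 - x\<^sup>2) ^ d) has_integral ?\<kappa> * integral {s..1} (\<lambda>x. sqrt (1 - x\<^sup>2) ^ d)) {s..1}"
      by (intro has_integral_mult_right integrable_integral sqrt_pow_integrable)
    then have "((\<lambda>x. if x \<in> {s..1} then ?\<kappa> * sqrt (1 - x\<^sup>2) ^ d else 0) has_integral
        ?\<kappa> * integral {s..1} (\<lambda>x. sqrt (1 - x\<^sup>2) ^ d)) UNIV"
      by (subst has_integral_restrict_UNIV)
    then have "(\<integral>\<^sup>+x. ennreal (if x \<in> {s..1} then ?\<kappa> * sqrt (1 - x\<^sup>2) ^ d else 0) \<partial>lborel) =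
        ennreal (?\<kappa> * integral {s..1} (\<lambda>x. sqrt (1 - x\<^sup>2) ^ d))"
      using s by (intro nn_integral_has_integral_lborel)
        (auto intro!: mult_nonneg_nonneg zero_le_power simp: power_le_one)
    moreover have "ennreal (if x \<in> {s..1} then ?\<kappa> * sqrt (1 - x\<^sup>2) ^ d else 0) =
        ennreal (?\<kappa> * sqrt (1 - x\<^sup>2) ^ d) * indicator {s..1} x" for x
      by simp
    ultimately show ?thesis by simp
  qed
  also have "ennreal (?\<kappa> * ?m ^ d * s ^ Suc d / (real d + 1) - ?\<kappa> * ?m ^ d * 0 ^ Suc d / (real d + 1)) +
      ennreal (?\<kappa> * integral {s..1} (\<lambda>x. sqrt (1 - x\<^sup>2) ^ d)) = ennreal (cone_volume d s)"
  proof -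
    have "?\<kappa> * ?m ^ d * s ^ Suc d = ?\<kappa> * (s * sqrt (1 - s\<^sup>2) ^ d)"
      by (cases "s = 0") (simp_all add: power_divide)
    moreover have "integral {s..1} (\<lambda>x. sqrt (1 - x\<^sup>2) ^ d) \<ge> 0"
      using s by (intro integral_nonneg sqrt_pow_integrable) (auto simp: power_le_one)
    ultimately show ?thesis
      using s s1 by (subst ennreal_plus[symmetric])
        (auto simp: cone_volume_def distrib_left)
  qed
  finally show ?thesis .
qed

section \<open>Continuity, derivative and estimates of the cone volume\<close>

lemma cone_volume_1: "cone_volume d 1 = 0" if "d \<ge> 1"
  using that by (simp add: cone_volume_def)

lemma cone_volume_continuous: "continuous_on {0..1} (cone_volume d)"
proof -
  have "continuous_on {0..1} (\<lambda>s. integral {s..1} (\<lambda>x. sqrt (1 - x\<^sup>2) ^ d))"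
    by (intro indefinite_integral_continuous_1' sqrt_pow_integrable)
  then show ?thesis unfolding cone_volume_def by (intro continuous_intros) auto
qed

text \<open>Up to sign and normalisation this is the density (1 - x^2)^((d-2)/2) of the height of a
  uniform point of the sphere in dimension d + 1. The contributions of the cone and of the cap
  combine because x^2 + r^2 = 1.\<close>

lemma cone_volume_derivative:
  assumes "0 < x" "x < 1" "d \<ge> 2"
  shows "(cone_volume d has_real_derivative
     - (unit_ball_vol d * (d / (real d + 1)) * sqrt (1 - x\<^sup>2) ^ (d - 2))) (at x)"
proof -
  define r where "r = sqrt (1 - x\<^sup>2)"
  have x2: "x\<^sup>2 < 1" using assms by (simp add: power_less_one_iff)
  then have r: "r > 0" "r\<^sup>2 = 1 - x\<^sup>2" by (auto simp: r_def)
  have "((\<lambda>s. integral {0..s} (\<lambda>x. sqrt (1 - x\<^sup>2) ^ d)) has_real_derivative r ^ d) (at x within {0..1})"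
    unfolding r_def using assms by (intro integral_has_real_derivative continuous_intros) auto
  then have D: "((\<lambda>s. integral {0..s} (\<lambda>x. sqrt (1 - x\<^sup>2) ^ d)) has_real_derivative r ^ d) (at x)"
    using assms by (subst (asm) at_within_interior) auto
  have eq: "cone_volume d s = unit_ball_vol d *
     (s * sqrt (1 - s\<^sup>2) ^ d / (real d + 1) + (integral {0..1} (\<lambda>x. sqrt (1 - x\<^sup>2) ^ d) -
        integral {0..s} (\<lambda>x. sqrt (1 - x\<^sup>2) ^ d)))" if "s \<in> {0<..<1}" for s
  proof -
    have "integral {0..s} (\<lambda>x. sqrt (1 - x\<^sup>2) ^ d) + integral {s..1} (\<lambda>x. sqrt (1 - x\<^sup>2) ^ d) =
        integral {0..1} (\<lambda>x. sqrt (1 - x\<^sup>2) ^ d)"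
      using that by (intro Henstock_Kurzweil_Integration.integral_combine sqrt_pow_integrable) auto
    then have "integral {s..1} (\<lambda>x. sqrt (1 - x\<^sup>2) ^ d) =
        integral {0..1} (\<lambda>x. sqrt (1 - x\<^sup>2) ^ d) - integral {0..s} (\<lambda>x. sqrt (1 - x\<^sup>2) ^ d)" by linarith
    then show ?thesis by (simp only: cone_volume_def)
  qed
  have S: "((\<lambda>s. sqrt (1 - s\<^sup>2)) has_real_derivative - x / r) (at x)"
    using x2 by (auto intro!: derivative_eq_intros simp: r_def divide_simps)
  have P: "((\<lambda>s. sqrt (1 - s\<^sup>2) ^ d) has_real_derivative d * (- x / r * r ^ (d - Suc 0))) (at x)"
    using DERIV_power[OF S, of d] by (simp add: r_def)
  have "((\<lambda>s. unit_ball_vol d *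
     (s * sqrt (1 - s\<^sup>2) ^ d / (real d + 1) + (integral {0..1} (\<lambda>x. sqrt (1 - x\<^sup>2) ^ d) -
        integral {0..s} (\<lambda>x. sqrt (1 - x\<^sup>2) ^ d)))) has_real_derivative
      unit_ball_vol d * ((1 * sqrt (1 - x\<^sup>2) ^ d + d * (- x / r * r ^ (d - Suc 0)) * x) / (real d + 1) + (0 - r ^ d))) (at x)"
    by (intro DERIV_cmult DERIV_add DERIV_cdivide DERIV_mult DERIV_diff DERIV_const DERIV_ident P D)
  moreover have "unit_ball_vol d * ((1 * sqrt (1 - x\<^sup>2) ^ d + d * (- x / r * r ^ (d - Suc 0)) * x) / (real d + 1) + (0 - r ^ d)) =
      - (unit_ball_vol d * (d / (real d + 1)) * r ^ (d - 2))"
  proof -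
    obtain k where k: "d = Suc (Suc k)" using assms by (metis add_2_eq_Suc le_Suc_ex)
    have "(1 * sqrt (1 - x\<^sup>2) ^ d + d * (- x / r * r ^ (d - Suc 0)) * x) / (real d + 1) + (0 - r ^ d) =
        - (d * r ^ k * (x\<^sup>2 + r\<^sup>2)) / (real d + 1)"
      unfolding r_def[symmetric] using r(1) by (simp add: k field_simps power2_eq_square)
    also have "\<dots> = - (d * r ^ k) / (real d + 1)" using r by simp
    finally show ?thesis by (simp only:) (simp add: k)
  qed
  ultimately have "((\<lambda>s. unit_ball_vol d *
     (s * sqrt (1 - s\<^sup>2) ^ d / (real d + 1) + (integral {0..1} (\<lambda>x. sqrt (1 - x\<^sup>2) ^ d) -
        integral {0..s} (\<lambda>x. sqrt (1 - x\<^sup>2) ^ d)))) has_real_derivative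
      - (unit_ball_vol d * (d / (real d + 1)) * r ^ (d - 2))) (at x)" by simp
  then show ?thesis
    unfolding r_def[symmetric]
    by (rule has_field_derivative_transform_within_open[of _ _ _ "{0<..<1}"]) (use assms eq in auto)
qed

text \<open>Mean value theorem: the density of the height decreases on [0, 1], so its value at the
  lower end \<open>s\<close> dominates, and d / (d + 1) is bounded by 1.\<close>

lemma cone_volume_diff_le:
  assumes "0 \<le> s" "s \<le> t" "t \<le> 1" "d \<ge> 2"
  shows "cone_volume d s - cone_volume d t \<le> (t - s) * (unit_ball_vol d * sqrt (1 - s\<^sup>2) ^ (d - 2))"
proof (cases "s = t")
  case False
  then have "s < t" using assms by simp
  have cont: "continuous_on {s..t} (cone_volume d)"
    using cone_volume_continuous by (rule continuous_on_subset) (use assms in auto)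
  have diff: "cone_volume d differentiable (at x)" if "s < x" "x < t" for x
    using cone_volume_derivative[of x d] that assms unfolding real_differentiable_def by fastforce
  obtain z l where z: "s < z" "z < t" and l: "(cone_volume d has_real_derivative l) (at z)"
    and eq: "cone_volume d t - cone_volume d s = (t - s) * l"
    using MVT[OF \<open>s < t\<close> cont diff] by blast
  have "l = - (unit_ball_vol d * (d / (real d + 1)) * sqrt (1 - z\<^sup>2) ^ (d - 2))"
    using DERIV_unique[OF l cone_volume_derivative] z assms by simp
  moreover have "unit_ball_vol d * (d / (real d + 1)) * sqrt (1 - z\<^sup>2) ^ (d - 2) \<le>
      unit_ball_vol d * 1 * sqrt (1 - s\<^sup>2) ^ (d - 2)"
    using z assms by (intro mult_mono power_mono) (auto simp: power_le_one power_mono)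
  ultimately show ?thesis
    using eq z mult_left_mono[of "-l" "unit_ball_vol d * sqrt (1 - s\<^sup>2) ^ (d - 2)" "t - s"] by simp
qed simp

text \<open>Only the cone is kept. This loses little when \<open>s\<close> is bounded away from 0;
  smaller heights are left to \<open>cone_volume_ge_diff\<close>.\<close>

lemma cone_volume_ge_linear:
  assumes "0 \<le> s" "s \<le> 1"
  shows "cone_volume d s \<ge> unit_ball_vol d * (s * sqrt (1 - s\<^sup>2) ^ d / (real d + 1))"
proof -
  have "integral {s..1} (\<lambda>x. sqrt (1 - x\<^sup>2) ^ d) \<ge> 0"
    using assms by (intro integral_nonneg sqrt_pow_integrable) (auto simp: power_le_one)
  then show ?thesis unfolding cone_volume_def by (intro mult_left_mono) auto
qed

text \<open>Only the part of the cap between heights s and 2s is kept. There x / (2s) is at most 1,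
  and inserting this factor gives the integrand an elementary primitive.\<close>

lemma cone_volume_ge_diff:
  assumes "0 < s" "2 * s \<le> 1"
  shows "cone_volume d s \<ge> unit_ball_vol d *
    ((sqrt (1 - s\<^sup>2) ^ (d + 2) - sqrt (1 - (2 * s)\<^sup>2) ^ (d + 2)) / (2 * s * (real d + 2)))"
proof -
  let ?F = "\<lambda>x. - (sqrt (1 - x\<^sup>2) ^ (d + 2)) / (2 * s * (real d + 2))"
  have "((\<lambda>x. x * sqrt (1 - x\<^sup>2) ^ d / (2 * s)) has_integral ?F (2 * s) - ?F s) {s..2 * s}"
  proof (rule fundamental_theorem_of_calculus_interior)
    show "continuous_on {s..2 * s} ?F" using assms by (intro continuous_intros) auto
    fix x assume x: "x \<in> {s<..<2 * s}"
    then have x2: "x\<^sup>2 < 1" using assms by (simp add: power_less_one_iff)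
    define r where "r = sqrt (1 - x\<^sup>2)"
    have r: "r > 0" using x2 by (simp add: r_def)
    have S: "((\<lambda>s. sqrt (1 - s\<^sup>2)) has_real_derivative - x / r) (at x)"
      using x2 by (auto intro!: derivative_eq_intros simp: r_def divide_simps)
    have "(?F has_real_derivative - (real (d + 2) * (- x / r * r ^ (d + 2 - Suc 0))) / (2 * s * (real d + 2))) (at x)"
      unfolding r_def using DERIV_cdivide[OF DERIV_minus[OF DERIV_power[OF S, of "d + 2"]]] by (simp add: r_def)
    moreover have "- (real (d + 2) * (- x / r * r ^ (d + 2 - Suc 0))) / (2 * s * (real d + 2)) = x * r ^ d / (2 * s)"
    proof -
      have "real (d + 2) * (x / r * r ^ (d + 2 - Suc 0)) = (real d + 2) * (x * r ^ d)"
        using r by simp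
      then show ?thesis using assms by simp
    qed
    ultimately show "(?F has_vector_derivative x * sqrt (1 - x\<^sup>2) ^ d / (2 * s)) (at x)"
      unfolding has_real_derivative_iff_has_vector_derivative[symmetric] r_def by simp
  qed (use assms in auto)
  note int = this
  have "?F (2 * s) - ?F s = integral {s..2 * s} (\<lambda>x. x * sqrt (1 - x\<^sup>2) ^ d / (2 * s))"
    using int by (rule integral_unique[symmetric])
  also have "integral {s..2 * s} (\<lambda>x. x * sqrt (1 - x\<^sup>2) ^ d / (2 * s)) \<le>
      integral {s..2 * s} (\<lambda>x. sqrt (1 - x\<^sup>2) ^ d)"
  proof (rule integral_le[OF has_integral_integrable[OF int] sqrt_pow_integrable])
    fix x assume x: "x \<in> {s..2 * s}"
    have "x / (2 * s) * sqrt (1 - x\<^sup>2) ^ d \<le> 1 * sqrt (1 - x\<^sup>2) ^ d"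
      using x assms by (intro mult_right_mono zero_le_power) (auto simp: power_le_one)
    then show "x * sqrt (1 - x\<^sup>2) ^ d / (2 * s) \<le> sqrt (1 - x\<^sup>2) ^ d" by simp
  qed
  also have "\<dots> \<le> integral {s..1} (\<lambda>x. sqrt (1 - x\<^sup>2) ^ d)"
    using assms by (intro integral_subset_le sqrt_pow_integrable) (auto simp: power_le_one)
  also have "\<dots> \<le> s * sqrt (1 - s\<^sup>2) ^ d / (real d + 1) + integral {s..1} (\<lambda>x. sqrt (1 - x\<^sup>2) ^ d)"
    using assms by (auto simp: power_le_one)
  finally have le: "?F (2 * s) - ?F s \<le> s * sqrt (1 - s\<^sup>2) ^ d / (real d + 1) + integral {s..1} (\<lambda>x. sqrt (1 - x\<^sup>2) ^ d)" .
  have "- B / c - - A / c = (A - B) / c" for A B c :: real by (simp add: diff_divide_distrib)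
  then show ?thesis using le unfolding cone_volume_def by (intro mult_left_mono) (simp_all only: unit_ball_vol_nonneg of_nat_0_le_iff)
qed

text \<open>Serves the plane, where the density of the height is unbounded and a bound by the square
  root takes the place of one linear in the width.\<close>

lemma cone_volume_le_dim1:
  assumes "0 \<le> s" "s \<le> 1"
  shows "cone_volume 1 s \<le> 3 * sqrt (1 - s\<^sup>2)"
proof -
  have "integral {s..1} (\<lambda>x. sqrt (1 - x\<^sup>2) ^ 1) \<le> integral {s..1} (\<lambda>x. sqrt (1 - s\<^sup>2))"
    using assms by (intro integral_le sqrt_pow_integrable) (auto simp: power_mono)
  also have "\<dots> = (1 - s) * sqrt (1 - s\<^sup>2)" using assms by simp
  finally have "cone_volume 1 s \<le> 2 * (s * sqrt (1 - s\<^sup>2) / 2 + (1 - s) * sqrt (1 - s\<^sup>2))"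
    by (simp add: cone_volume_def)
  also have "\<dots> = (2 - s) * sqrt (1 - s\<^sup>2)" by (simp add: algebra_simps)
  also have "\<dots> \<le> 3 * sqrt (1 - s\<^sup>2)"
    using assms by (intro mult_right_mono) (auto simp: power_le_one)
  finally show ?thesis .
qed

section \<open>The uniform distribution on the sphere\<close>

lemma cone_volume_nonneg: "0 \<le> s \<Longrightarrow> s \<le> 1 \<Longrightarrow> cone_volume d s \<ge> 0"
  by (rule order_trans[OF _ cone_volume_ge_linear]) (auto simp: power_le_one)

lemma coordinate_measurable: "i < d \<Longrightarrow> (\<lambda>x. x i) \<in> borel_measurable (lebesgue_upto d)"
  using measurable_component_singleton[of i "{..<d}" "\<lambda>_. lborel :: real measure"] by simp

lemma unit_ball_eq: "unit_ball d = {x \<in> space (lebesgue_upto d). inner_upto d x x \<le> 1}"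
  by (simp add: unit_ball_def inner_upto_def power2_eq_square)

lemma unit_ball_sets [measurable]: "unit_ball d \<in> sets (lebesgue_upto d)"
  unfolding unit_ball_eq by measurable

lemma emeasure_unit_ball: "d \<ge> 1 \<Longrightarrow> emeasure (lebesgue_upto d) (unit_ball d) = ennreal (unit_ball_vol d)"
  using ball_volume[of 1 d] by (simp add: unit_ball_eq)

lemma space_uniform_sphere [simp]: "space (uniform_sphere d) = topspace (Euclidean_space d)"
  by (simp add: uniform_sphere_def space_restrict_space)

lemma sets_uniform_sphere: "sets (uniform_sphere d) = sets (restrict_space borel (topspace (Euclidean_space d)))"
  by (simp add: uniform_sphere_def)

lemma uniform_sphere_coordinate_measurable:
  "(\<lambda>x. x i) \<in> borel_measurable (uniform_sphere d)"
  by (subst measurable_cong_sets[OF sets_uniform_sphere refl])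
    (rule measurable_restrict_space1, rule measurable_product_coordinates)

lemma sphere_inner_measurable: "(\<lambda>x. inner_upto d x u) \<in> borel_measurable (uniform_sphere d)"
  using uniform_sphere_coordinate_measurable by (intro inner_upto_measurable) auto

lemma radial_proj_measurable [measurable]:
  "radial_proj d \<in> measurable (lebesgue_upto d) (restrict_space borel (topspace (Euclidean_space d)))"
proof (rule measurable_restrict_space2)
  show "radial_proj d \<in> space (lebesgue_upto d) \<rightarrow> topspace (Euclidean_space d)"
    by (auto simp: radial_proj_def topspace_Euclidean_space)
  show "radial_proj d \<in> borel_measurable (lebesgue_upto d)"
  proof (rule measurable_coordinatewise_then_product)
    fix i
    have [measurable]: "(\<lambda>x. inner_upto d x x) \<in> borel_measurable (lebesgue_upto d)" by measurable
    have "(\<lambda>x. x i / sqrt (inner_upto d x x)) \<in> borel_measurable (lebesgue_upto d)" if "i < d"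
      using coordinate_measurable[OF that] by measurable
    then show "(\<lambda>x. radial_proj d x i) \<in> borel_measurable (lebesgue_upto d)"
      by (cases "i < d") (simp_all add: radial_proj_def inner_upto_def power2_eq_square)
  qed
qed

lemma prob_space_uniform_sphere:
  assumes "d \<ge> 1" shows "prob_space (uniform_sphere d)"
  unfolding uniform_sphere_def
proof (rule prob_space.prob_space_distr)
  show "prob_space (uniform_measure (lebesgue_upto d) (unit_ball d))"
    using unit_ball_vol_pos[of "real d"] by (intro prob_space_uniform_measure)
      (auto simp: emeasure_unit_ball[OF assms] simp del: unit_ball_vol_pos)
qed simp

lemma emeasure_uniform_sphere:
  assumes "A \<in> sets (uniform_sphere d)" "d \<ge> 1"
  shows "emeasure (uniform_sphere d) A =
    emeasure (lebesgue_upto d) {y \<in> unit_ball d. radial_proj d y \<in> A} / ennreal (unit_ball_vol d)"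
proof -
  have A: "A \<in> sets (restrict_space borel (topspace (Euclidean_space d)))"
    using assms by (simp add: uniform_sphere_def)
  have m: "radial_proj d -` A \<inter> space (lebesgue_upto d) \<in> sets (lebesgue_upto d)"
    using A by (rule measurable_sets[OF radial_proj_measurable])
  have "emeasure (uniform_sphere d) A = emeasure (uniform_measure (lebesgue_upto d) (unit_ball d))
      (radial_proj d -` A \<inter> space (lebesgue_upto d))"
    unfolding uniform_sphere_def using A by (subst emeasure_distr) auto
  also have "\<dots> = emeasure (lebesgue_upto d) (unit_ball d \<inter> (radial_proj d -` A \<inter> space (lebesgue_upto d)))
      / emeasure (lebesgue_upto d) (unit_ball d)"
    using m by (intro emeasure_uniform_measure) auto
  also have "unit_ball d \<inter> (radial_proj d -` A \<inter> space (lebesgue_upto d)) =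
      {y \<in> unit_ball d. radial_proj d y \<in> A}"
    by (auto simp: unit_ball_def)
  finally show ?thesis using assms by (simp add: emeasure_unit_ball)
qed

lemma AE_lebesgue_nonzero:
  assumes "d \<ge> 1" shows "AE y in lebesgue_upto d. inner_upto d y y > 0"
proof (rule AE_I)
  show "emeasure (lebesgue_upto d) {y \<in> space (lebesgue_upto d). inner_upto d y y \<le> 0} = 0"
    using ball_volume[of 0 d] assms by (simp add: power_0_left)
  show "{y \<in> space (lebesgue_upto d). inner_upto d y y \<le> 0} \<in> sets (lebesgue_upto d)" by measurable
qed (auto simp: not_less)

lemma inner_radial_proj:
  "inner_upto d (radial_proj d y) u = inner_upto d y u / sqrt (inner_upto d y y)"
  by (simp add: inner_upto_def radial_proj_def power2_eq_square sum_divide_distrib)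

lemma inner_radial_proj_self:
  assumes "inner_upto d y y > 0"
  shows "inner_upto d (radial_proj d y) (radial_proj d y) = 1"
proof -
  have "inner_upto d (radial_proj d y) (radial_proj d y) =
      inner_upto d y y / sqrt (inner_upto d y y) / sqrt (inner_upto d y y)"
    by (metis inner_radial_proj inner_upto_commute)
  then show ?thesis using assms by (simp add: real_div_sqrt)
qed

lemma AE_uniform_sphere_unit:
  assumes "d \<ge> 1" shows "AE x in uniform_sphere d. inner_upto d x x = 1"
proof -
  have "AE y in uniform_measure (lebesgue_upto d) (unit_ball d).
      inner_upto d (radial_proj d y) (radial_proj d y) = 1"
    using AE_lebesgue_nonzero[OF assms]
    by (intro AE_uniform_measureI unit_ball_sets) (auto elim!: eventually_mono simp: inner_radial_proj_self)
  moreover have "(\<lambda>x. inner_upto d x x) \<in> borel_measurable (uniform_sphere d)"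
    using uniform_sphere_coordinate_measurable by (intro inner_upto_measurable)
  then have "{x \<in> space (uniform_sphere d). inner_upto d x x = 1} \<in> sets (uniform_sphere d)"
    by measurable
  then have "{x \<in> space (restrict_space borel (topspace (Euclidean_space d))). inner_upto d x x = 1}
      \<in> sets (restrict_space borel (topspace (Euclidean_space d)))"
    by (simp add: sets_uniform_sphere space_restrict_space)
  ultimately show ?thesis
    unfolding uniform_sphere_def by (subst AE_distr_iff) auto
qed

text \<open>Rotate \<open>u\<close> to the last axis. Away from the origin, the radial projection of
  y lies in the cap exactly if s |y| is at most the last coordinate of T y, so the probability is
  the cone volume divided by the volume of the ball.\<close>

lemma cap_measure:
  assumes d: "d \<ge> 1" and u: "inner_upto (Suc d) u u = 1" and s: "0 \<le> s" "s \<le> 1"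
  shows "measure (uniform_sphere (Suc d)) {x \<in> space (uniform_sphere (Suc d)). s \<le> inner_upto (Suc d) x u} =
    cone_volume d s / unit_ball_vol (Suc d)"
proof -
  let ?D = "Suc d" and ?A = "{x \<in> space (uniform_sphere (Suc d)). s \<le> inner_upto (Suc d) x u}"
  obtain T where T: "isometry_upto ?D T" and T0: "\<And>i. i < d \<Longrightarrow> T u i = 0" and Td: "T u d = 1"
    using isometry_upto_to_axis[of d u] u by auto
  have inner_T: "inner_upto ?D (T a) (T b) = inner_upto ?D a b" for a b
    using T by (simp add: isometry_upto_def)
  have Tu: "inner_upto ?D y u = T y d" for y
  proof -
    have "inner_upto ?D y u = inner_upto ?D (T y) (T u)" by (simp add: inner_T)
    also have "\<dots> = T y d" using T0 Td by (simp add: inner_upto_def)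
    finally show ?thesis .
  qed
  have "?A \<in> sets (uniform_sphere ?D)" using sphere_inner_measurable by measurable
  then have "emeasure (uniform_sphere ?D) ?A =
    emeasure (lebesgue_upto ?D) {y \<in> unit_ball ?D. radial_proj ?D y \<in> ?A} / ennreal (unit_ball_vol ?D)"
    by (rule emeasure_uniform_sphere) simp
  also have "emeasure (lebesgue_upto ?D) {y \<in> unit_ball ?D. radial_proj ?D y \<in> ?A} =
    emeasure (lebesgue_upto ?D) {y \<in> space (lebesgue_upto ?D).
      inner_upto ?D (T y) (T y) \<le> 1 \<and> s * sqrt (inner_upto ?D (T y) (T y)) \<le> T y d}"
  proof (rule emeasure_eq_AE)
    have "AE y in lebesgue_upto ?D. inner_upto ?D y y > 0" by (rule AE_lebesgue_nonzero) simp
    then show "AE y in lebesgue_upto ?D. y \<in> {y \<in> unit_ball ?D. radial_proj ?D y \<in> ?A} \<longleftrightarrow>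
      y \<in> {y \<in> space (lebesgue_upto ?D).
      inner_upto ?D (T y) (T y) \<le> 1 \<and> s * sqrt (inner_upto ?D (T y) (T y)) \<le> T y d}"
    proof eventually_elim
      case (elim y)
      have "radial_proj ?D y \<in> topspace (Euclidean_space ?D)"
        by (simp add: radial_proj_def topspace_Euclidean_space)
      moreover have "inner_upto ?D (radial_proj ?D y) u = T y d / sqrt (inner_upto ?D y y)"
        by (simp only: inner_radial_proj Tu)
      ultimately show ?case using elim
        by (auto simp: unit_ball_eq inner_T pos_le_divide_eq)
    qed
    show "{y \<in> unit_ball ?D. radial_proj ?D y \<in> ?A} \<in> sets (lebesgue_upto ?D)"
    proof -
      have "radial_proj ?D -` ?A \<inter> space (lebesgue_upto ?D) \<in> sets (lebesgue_upto ?D)"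
        using \<open>?A \<in> sets (uniform_sphere ?D)\<close> sets_uniform_sphere
        by (intro measurable_sets[OF radial_proj_measurable]) auto
      then have "unit_ball ?D \<inter> (radial_proj ?D -` ?A \<inter> space (lebesgue_upto ?D)) \<in> sets (lebesgue_upto ?D)"
        by (rule sets.Int[OF unit_ball_sets])
      moreover have "unit_ball ?D \<inter> (radial_proj ?D -` ?A \<inter> space (lebesgue_upto ?D)) =
          {y \<in> unit_ball ?D. radial_proj ?D y \<in> ?A}" by (auto simp: unit_ball_def)
      ultimately show ?thesis by simp
    qed
    have "{y \<in> space (lebesgue_upto ?D). inner_upto ?D y y \<le> 1 \<and>
        s * sqrt (inner_upto ?D y y) \<le> inner_upto ?D y u} \<in> sets (lebesgue_upto ?D)"
      by (intro sets.sets_Collect_conj borel_measurable_le borel_measurable_times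
        measurable_compose[OF _ borel_measurable_sqrt]) (auto intro!: inner_upto_measurable coordinate_measurable)
    then show "{y \<in> space (lebesgue_upto ?D).
      inner_upto ?D (T y) (T y) \<le> 1 \<and> s * sqrt (inner_upto ?D (T y) (T y)) \<le> T y d} \<in> sets (lebesgue_upto ?D)"
      by (simp add: inner_T Tu)
  qed
  also have "\<dots> = emeasure (lebesgue_upto ?D) {y \<in> space (lebesgue_upto ?D).
      inner_upto ?D y y \<le> 1 \<and> s * sqrt (inner_upto ?D y y) \<le> y d}"
  proof (rule preserves_lebesgue_emeasure)
    have "(\<lambda>x. x d) \<in> borel_measurable (lebesgue_upto ?D)"
      using measurable_component_singleton[of d "{..<?D}" "\<lambda>_. lborel :: real measure"] by simp
    moreover have "(\<lambda>x. inner_upto ?D x x) \<in> borel_measurable (lebesgue_upto ?D)" by measurable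
    ultimately show "Measurable.pred (lebesgue_upto ?D)
        (\<lambda>y. inner_upto ?D y y \<le> 1 \<and> s * sqrt (inner_upto ?D y y) \<le> y d)"
      unfolding pred_def
      by (intro sets.sets_Collect_conj borel_measurable_le borel_measurable_times
        measurable_compose[OF _ borel_measurable_sqrt]) auto
  qed (use T in \<open>simp add: isometry_upto_def\<close>)
  also have "\<dots> = ennreal (cone_volume d s)"
    by (rule cone_volume_eq_emeasure[OF d s])
  finally have "emeasure (uniform_sphere ?D) ?A = ennreal (cone_volume d s) / ennreal (unit_ball_vol ?D)" .
  also have "\<dots> = ennreal (cone_volume d s / unit_ball_vol ?D)"
    using cone_volume_nonneg[OF s] by (intro divide_ennreal) auto
  finally show ?thesis using cone_volume_nonneg[OF s] by (simp add: measure_def)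
qed


lemma cap_between:
  assumes d: "d \<ge> 1" and u: "inner_upto (Suc d) u u = 1" and s: "0 \<le> s" "s \<le> t" "t \<le> 1"
  shows "measure (uniform_sphere (Suc d))
      {x \<in> space (uniform_sphere (Suc d)). s \<le> inner_upto (Suc d) x u \<and> inner_upto (Suc d) x u < t} =
    (cone_volume d s - cone_volume d t) / unit_ball_vol (Suc d)"
proof -
  interpret prob_space "uniform_sphere (Suc d)" by (rule prob_space_uniform_sphere) simp
  note sphere_inner_measurable[measurable]
  let ?S = "\<lambda>s. {x \<in> space (uniform_sphere (Suc d)). s \<le> inner_upto (Suc d) x u}"
  have "prob (?S s - ?S t) = prob (?S s) - prob (?S t)"
    using s by (intro finite_measure_Diff) (measurable, auto)
  moreover have "?S s - ?S t =
      {x \<in> space (uniform_sphere (Suc d)). s \<le> inner_upto (Suc d) x u \<and> inner_upto (Suc d) x u < t}"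
    by auto
  ultimately show ?thesis
    using cap_measure[OF d u, of s] cap_measure[OF d u, of t] s by (simp add: diff_divide_distrib)
qed

text \<open>For c < 1 the section lies between the heights c and t for every t > c, and the measure
  of that zone tends to 0 with t - c by continuity of the cone volume. For c \<ge> 1 it lies in the
  cap of height 1, which is null.\<close>

lemma sphere_hyperplane_null_unit:
  assumes d: "d \<ge> 1" and u: "inner_upto (Suc d) u u = 1" and "c \<ge> 0"
  shows "measure (uniform_sphere (Suc d)) {x \<in> space (uniform_sphere (Suc d)). inner_upto (Suc d) x u = c} = 0"
    (is "measure ?M ?A = 0")
proof -
  interpret prob_space "uniform_sphere (Suc d)" by (rule prob_space_uniform_sphere) simp
  note sphere_inner_measurable[measurable]
  show ?thesis
  proof (cases "c < 1")
    case False
    have "prob ?A \<le> prob {x \<in> space ?M. 1 \<le> inner_upto (Suc d) x u}"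
      using False by (intro finite_measure_mono, force, measurable)
    also have "\<dots> = 0" using cap_measure[OF d u, of 1] cone_volume_1[OF d] by simp
    finally show ?thesis by (simp add: measure_le_0_iff)
  next
    case True
    have bound: "prob ?A \<le> (cone_volume d c - cone_volume d t) / unit_ball_vol (Suc d)"
      if "t \<in> {c<..1}" for t
    proof -
      have "prob ?A \<le> prob {x \<in> space ?M. c \<le> inner_upto (Suc d) x u \<and> inner_upto (Suc d) x u < t}"
        using that by (intro finite_measure_mono, force, measurable)
      then show ?thesis using cap_between[OF d u, of c t] that assms by simp
    qed
    have "(cone_volume d \<longlongrightarrow> cone_volume d c) (at c within {0..1})"
      using cone_volume_continuous True assms by (auto simp: continuous_on_def)
    then have "(cone_volume d \<longlongrightarrow> cone_volume d c) (at c within {c<..1})"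
      by (rule tendsto_within_subset) (use assms in auto)
    then have "((\<lambda>t. (cone_volume d c - cone_volume d t) / unit_ball_vol (Suc d)) \<longlongrightarrow>
        (cone_volume d c - cone_volume d c) / unit_ball_vol (Suc d)) (at c within {c<..1})"
      using unit_ball_vol_pos[of "real (Suc d)"]
      by (intro tendsto_divide tendsto_diff tendsto_const) (auto simp del: unit_ball_vol_pos)
    then have lim: "((\<lambda>t. (cone_volume d c - cone_volume d t) / unit_ball_vol (Suc d)) \<longlongrightarrow> 0)
        (at c within {c<..1})" by simp
    have "at c within {c<..1} \<noteq> bot"
      using True by (simp add: at_within_eq_bot_iff closure_greaterThanAtMost)
    moreover have "\<forall>\<^sub>F t in at c within {c<..1}.
        prob ?A \<le> (cone_volume d c - cone_volume d t) / unit_ball_vol (Suc d)"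
      unfolding eventually_at_filter by (intro always_eventually allI impI bound)
    ultimately have "prob ?A \<le> 0"
      by (intro tendsto_lowerbound[OF lim])
    then show ?thesis by (simp add: measure_le_0_iff)
  qed
qed

lemma inner_upto_scale:
  "inner_upto d x (\<lambda>i. a * u i) = a * inner_upto d x u"
  "inner_upto d (\<lambda>i. a * u i) x = a * inner_upto d u x"
  by (simp_all add: inner_upto_def sum_distrib_left mult_ac)

lemma sphere_hyperplane_null:
  assumes d: "d \<ge> 2" and w: "inner_upto d w w > 0"
  shows "{x \<in> space (uniform_sphere d). inner_upto d x w = c} \<in> null_sets (uniform_sphere d)"
proof -
  obtain e where e: "d = Suc e" "e \<ge> 1" using d by (cases d) auto
  interpret prob_space "uniform_sphere d" using d by (intro prob_space_uniform_sphere) simp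
  note sphere_inner_measurable[measurable]
  define r where "r = sqrt (inner_upto d w w)"
  have r: "r > 0" "r * r = inner_upto d w w" using w by (auto simp: r_def)
  \<comment> \<open>Flipping \<open>w\<close> makes the height nonnegative, as
    \<open>sphere_hyperplane_null_unit\<close> demands.\<close>
  define \<sigma> :: real where "\<sigma> = (if c \<ge> 0 then 1 else -1)"
  define u where "u = (\<lambda>i. \<sigma> / r * w i)"
  have "\<sigma> * \<sigma> = 1" by (simp add: \<sigma>_def)
  then have u: "inner_upto (Suc e) u u = 1"
    unfolding u_def inner_upto_scale e(1)[symmetric] using r w by (simp add: field_simps)
  have "inner_upto d x w = c \<longleftrightarrow> inner_upto d x u = \<bar>c\<bar> / r" for x
  proof -
    have "inner_upto d x u = \<sigma> / r * inner_upto d x w" unfolding u_def inner_upto_scale ..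
    then show ?thesis using r by (auto simp: \<sigma>_def field_simps)
  qed
  then have "measure (uniform_sphere d) {x \<in> space (uniform_sphere d). inner_upto d x w = c} = 0"
    using sphere_hyperplane_null_unit[OF e(2) u, of "\<bar>c\<bar> / r"] r by (simp add: e)
  moreover have "{x \<in> space (uniform_sphere d). inner_upto d x w = c} \<in> sets (uniform_sphere d)"
    by measurable
  ultimately show ?thesis by (auto simp: null_sets_def emeasure_eq_measure)
qed

text \<open>The separate lower height \<open>a\<close> makes the last factor independent of the
  slab. Later the slab varies with the vector integrated over, while \<open>a\<close> stays
  fixed.\<close>

lemma sphere_slab_prob_le:
  assumes d: "d \<ge> 2" and u: "inner_upto (Suc d) u u = 1" and a: "0 \<le> a" "a \<le> s" "s \<le> t" "a \<le> 1"
  shows "measure (uniform_sphere (Suc d))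
      {x \<in> space (uniform_sphere (Suc d)). s \<le> inner_upto (Suc d) x u \<and> inner_upto (Suc d) x u \<le> t} \<le>
    (t - s) * (unit_ball_vol d / unit_ball_vol (Suc d)) * sqrt (1 - a\<^sup>2) ^ (d - 2)" (is "measure ?M ?A \<le> ?R")
proof -
  interpret prob_space "uniform_sphere (Suc d)" by (rule prob_space_uniform_sphere) simp
  note sphere_inner_measurable[measurable]
  have d1: "d \<ge> 1" using d by simp
  have eq0: "prob {x \<in> space ?M. inner_upto (Suc d) x u = t} = 0"
    using a by (intro sphere_hyperplane_null_unit d1 u) simp
  have a2: "a\<^sup>2 \<le> 1" using a by (simp add: power_le_one)
  show ?thesis
  proof (cases "s \<le> 1")
    case False
    have "prob ?A \<le> prob {x \<in> space ?M. 1 \<le> inner_upto (Suc d) x u}"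
      using False by (intro finite_measure_mono, force, measurable)
    also have "\<dots> = 0" using cap_measure[OF d1 u, of 1] cone_volume_1[OF d1] by simp
    also have "0 \<le> ?R" using a a2 by simp
    finally show ?thesis .
  next
    case True
    \<comment> \<open>The slab may reach above height 1, where the formula for zones does not apply.
      The truncated zone is half-open; what it omits of the slab lies in the hyperplane at height
      \<open>t\<close> or in the cap of height 1, both null.\<close>
    define t' where "t' = min t 1"
    have t': "s \<le> t'" "t' \<le> 1" "t' \<le> t" using a True by (auto simp: t'_def)
    have "prob ?A \<le> prob ({x \<in> space ?M. s \<le> inner_upto (Suc d) x u \<and> inner_upto (Suc d) x u < t'} \<union>
        ({x \<in> space ?M. inner_upto (Suc d) x u = t} \<union> {x \<in> space ?M. 1 \<le> inner_upto (Suc d) x u}))"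
      by (intro finite_measure_mono, (auto simp: t'_def)[1], measurable)
    also have "\<dots> \<le> prob {x \<in> space ?M. s \<le> inner_upto (Suc d) x u \<and> inner_upto (Suc d) x u < t'} +
        (prob {x \<in> space ?M. inner_upto (Suc d) x u = t} + prob {x \<in> space ?M. 1 \<le> inner_upto (Suc d) x u})"
      by (intro order_trans[OF measure_Un_le] add_left_mono measure_Un_le) measurable
    also have "\<dots> = (cone_volume d s - cone_volume d t') / unit_ball_vol (Suc d)"
      using cap_between[OF d1 u, of s t'] t' a eq0 cap_measure[OF d1 u, of 1] cone_volume_1[OF d1] by simp
    also have "\<dots> \<le> (t' - s) * (unit_ball_vol d * sqrt (1 - s\<^sup>2) ^ (d - 2)) / unit_ball_vol (Suc d)"
      using a t' d by (intro divide_right_mono cone_volume_diff_le) auto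
    also have "\<dots> \<le> (t - s) * (unit_ball_vol d * sqrt (1 - a\<^sup>2) ^ (d - 2)) / unit_ball_vol (Suc d)"
      using a t' True by (intro divide_right_mono mult_mono mult_left_mono power_mono)
        (auto simp: power_le_one power_mono)
    finally show ?thesis by simp
  qed
qed

section \<open>Linear independence of coordinate vectors\<close>

abbreviation Eucl :: "nat \<Rightarrow> (nat \<Rightarrow> real) set" where
  "Eucl d \<equiv> topspace (Euclidean_space d)"

lemma sum_fun_apply: "(\<Sum>i\<in>I. f i) x = (\<Sum>i\<in>I. (f i x :: real))"
  by (induction I rule: infinite_finite_induct) auto

lemma Eucl_iff: "x \<in> Eucl d \<longleftrightarrow> (\<forall>k\<ge>d. x k = 0)"
  by (simp add: topspace_Euclidean_space)

lemma inner_upto_add: "inner_upto d (x + y) u = inner_upto d x u + inner_upto d y u"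
  by (simp add: inner_upto_def distrib_right sum.distrib)

lemma inner_upto_scaleR: "inner_upto d (a *\<^sub>R x) u = a * inner_upto d x u"
  by (simp add: inner_upto_def sum_distrib_left mult.assoc)

lemma inner_upto_sum: "inner_upto d (\<Sum>i\<in>I. f i) u = (\<Sum>i\<in>I. inner_upto d (f i) u)"
  by (simp add: inner_upto_def sum_fun_apply sum_distrib_right sum.swap[of _ I])

lemma inner_upto_diff: "inner_upto d (x - y) u = inner_upto d x u - inner_upto d y u"
  by (simp add: inner_upto_def left_diff_distrib sum_subtractf)

lemma inner_upto_self_eq_0: "inner_upto d x x = 0 \<longleftrightarrow> (\<forall>k<d. x k = 0)"
proof -
  have "inner_upto d x x = 0 \<longleftrightarrow> (\<forall>k\<in>{..<d}. x k * x k = 0)"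
    unfolding inner_upto_def by (rule sum_nonneg_eq_0_iff) auto
  then show ?thesis by auto
qed

lemma inner_upto_cong:
  "(\<And>k. k < d \<Longrightarrow> x k = x' k) \<Longrightarrow> (\<And>k. k < d \<Longrightarrow> y k = y' k) \<Longrightarrow> inner_upto d x y = inner_upto d x' y'"
  by (auto simp: inner_upto_def)

definition axis_vec :: "nat \<Rightarrow> nat \<Rightarrow> real" where
  "axis_vec k = (\<lambda>j. if j = k then 1 else 0)"

lemma axis_vec_expand:
  assumes "x \<in> Eucl d" shows "x = (\<Sum>k<d. x k *\<^sub>R axis_vec k)"
proof
  fix j
  have "(\<Sum>k<d. x k *\<^sub>R axis_vec k) j = (\<Sum>k<d. if k = j then x k else 0)"
    unfolding sum_fun_apply by (intro sum.cong) (auto simp: axis_vec_def)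
  then show "x j = (\<Sum>k<d. x k *\<^sub>R axis_vec k) j"
    using assms by (simp add: Eucl_iff)
qed

lemma inj_axis_vec: "inj axis_vec"
proof
  fix i j assume "axis_vec i = axis_vec j"
  then have "axis_vec i i = axis_vec j i" by simp
  then show "i = j" by (auto simp: axis_vec_def split: if_splits)
qed

lemma Eucl_span: "Eucl d = span (axis_vec ` {..<d})"
proof
  show "Eucl d \<subseteq> span (axis_vec ` {..<d})"
  proof
    fix x assume "x \<in> Eucl d"
    moreover have "(\<Sum>k<d. x k *\<^sub>R axis_vec k) \<in> span (axis_vec ` {..<d})"
      by (intro span_sum span_scale span_base) auto
    ultimately show "x \<in> span (axis_vec ` {..<d})" using axis_vec_expand by metis
  qed
  have "subspace (Eucl d)" by (auto simp: subspace_def Eucl_iff)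
  then show "span (axis_vec ` {..<d}) \<subseteq> Eucl d"
    by (intro span_minimal) (auto simp: Eucl_iff axis_vec_def)
qed

lemma independent_axis_vec: "independent (axis_vec ` {..<d})"
proof
  assume "dependent (axis_vec ` {..<d})"
  then obtain u v where v: "v \<in> axis_vec ` {..<d}" "u v \<noteq> 0"
    and eq: "(\<Sum>v\<in>axis_vec ` {..<d}. u v *\<^sub>R v) = 0"
    using dependent_finite[of "axis_vec ` {..<d}"] by auto
  obtain k where k: "k < d" "v = axis_vec k" using v by auto
  have "0 = (\<Sum>v\<in>axis_vec ` {..<d}. u v *\<^sub>R v) k" using eq by simp
  also have "\<dots> = (\<Sum>j<d. u (axis_vec j) * axis_vec j k)"
    using inj_axis_vec by (simp add: sum_fun_apply sum.reindex inj_on_subset o_def)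
  also have "\<dots> = (\<Sum>j<d. if j = k then u (axis_vec j) else 0)"
    by (intro sum.cong) (auto simp: axis_vec_def)
  finally show False using k v by simp
qed

lemma card_axis_vec: "card (axis_vec ` {..<d}) = d"
  using inj_axis_vec by (simp add: card_image inj_on_subset)

lemma linear_eq_inner:
  assumes "linear g" "x \<in> Eucl d"
  shows "g x = inner_upto d x (\<lambda>k. g (axis_vec k))"
proof -
  have "g x = g (\<Sum>k<d. x k *\<^sub>R axis_vec k)" using axis_vec_expand[OF assms(2)] by simp
  then show ?thesis using assms(1) by (simp add: linear_sum linear_scale inner_upto_def)
qed

text \<open>Fewer than d vectors cannot span all axis vectors. A linear functional that vanishes on
  their span but not at a missed axis vector is represented by \<open>w\<close>.\<close>

lemma exists_orthogonal:
  assumes "finite I" "card I < d" "\<And>i. i \<in> I \<Longrightarrow> X i \<in> Eucl d"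
  shows "\<exists>w \<in> Eucl d. inner_upto d w w > 0 \<and> (\<forall>i\<in>I. inner_upto d (X i) w = 0)"
proof -
  obtain B where B: "B \<subseteq> X ` I" "independent B" "X ` I \<subseteq> span B"
    using maximal_independent_subset[of "X ` I"] by blast
  have "finite B" using B(1) assms(1) by (simp add: finite_subset)
  have "card B < d"
    using card_mono[OF _ B(1)] card_image_le[of I X] assms by simp
  have "\<not> axis_vec ` {..<d} \<subseteq> span B"
    using independent_span_bound[OF \<open>finite B\<close> independent_axis_vec, of d] \<open>card B < d\<close>
    by (auto simp: card_axis_vec)
  then obtain k where k: "k < d" "axis_vec k \<notin> span B" by auto
  then have "independent (insert (axis_vec k) B)" using B by (intro independent_insertI)
  then obtain g :: "(nat \<Rightarrow> real) \<Rightarrow> real" where g: "linear g"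
    "\<forall>x\<in>insert (axis_vec k) B. g x = (if x = axis_vec k then 1 else 0)"
    using linear_independent_extend[of "insert (axis_vec k) B" "\<lambda>x. if x = axis_vec k then 1 else 0"] by blast
  have g0: "g x = 0" if "x \<in> span B" for x
  proof (rule linear_eq_0_on_span[OF g(1) _ that])
    show "g b = 0" if "b \<in> B" for b using g(2) that k(2) span_base[of b B] by auto
  qed
  define w where "w = (\<lambda>j. if j < d then g (axis_vec j) else 0)"
  have inner_w: "g x = inner_upto d x w" if "x \<in> Eucl d" for x
    using linear_eq_inner[OF g(1) that] by (simp add: w_def cong: inner_upto_cong)
  have "inner_upto d (X i) w = 0" if "i \<in> I" for i
    using inner_w[of "X i"] g0[of "X i"] assms(3) B(3) that by auto
  moreover have "inner_upto d w w \<noteq> 0"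
    using k g(2) by (auto simp: inner_upto_self_eq_0 w_def)
  then have "inner_upto d w w > 0" by (simp add: order_less_le)
  moreover have "w \<in> Eucl d" by (simp add: w_def Eucl_iff)
  ultimately show ?thesis by blast
qed

text \<open>Independence of the family, not of its image: a repeated vector makes it dependent. Only
  finitely many coordinates occur, so the condition can be treated as a measurable function of the
  points.\<close>

definition lin_indep :: "nat \<Rightarrow> 'i set \<Rightarrow> ('i \<Rightarrow> nat \<Rightarrow> real) \<Rightarrow> bool" where
  "lin_indep d I X \<longleftrightarrow> (\<forall>c. (\<forall>k<d. (\<Sum>i\<in>I. c i * X i k) = 0) \<longrightarrow> (\<forall>i\<in>I. c i = 0))"

lemma lin_indep_iff:
  assumes I: "finite I" "\<And>i. i \<in> I \<Longrightarrow> X i \<in> Eucl d"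
  shows "lin_indep d I X \<longleftrightarrow> inj_on X I \<and> independent (X ` I)"
proof -
  have coord: "(\<forall>k<d. (\<Sum>i\<in>I. c i * X i k) = 0) \<longleftrightarrow> (\<Sum>i\<in>I. c i *\<^sub>R X i) = 0" for c
  proof -
    have "(\<Sum>i\<in>I. c i * X i k) = 0" if "k \<ge> d" for k
      using I that by (intro sum.neutral) (auto simp: Eucl_iff)
    then show ?thesis by (auto simp: fun_eq_iff sum_fun_apply) (metis linorder_not_less)
  qed
  show ?thesis
  proof
    assume L: "lin_indep d I X"
    have inj: "inj_on X I"
    proof
      fix i j assume ij: "i \<in> I" "j \<in> I" "X i = X j"
      show "i = j"
      proof (rule ccontr)
        assume "i \<noteq> j"
        let ?c = "\<lambda>k. if k = i then 1 else if k = j then -1 else (0::real)"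
        have "(\<Sum>k\<in>I. ?c k *\<^sub>R X k) = (\<Sum>k\<in>{i, j}. ?c k *\<^sub>R X k)"
          using I ij by (intro sum.mono_neutral_right) auto
        also have "\<dots> = 0" using \<open>i \<noteq> j\<close> ij(3) by simp
        finally have s: "(\<Sum>k\<in>I. ?c k *\<^sub>R X k) = 0" .
        have "\<forall>c. (\<Sum>i\<in>I. c i *\<^sub>R X i) = 0 \<longrightarrow> (\<forall>i\<in>I. c i = 0)"
          using L unfolding lin_indep_def coord .
        from mp[OF spec[OF this, of ?c] s] have "\<forall>k\<in>I. ?c k = 0" .
        then show False using ij by auto
      qed
    qed
    moreover have "independent (X ` I)"
    proof
      assume "dependent (X ` I)"
      then obtain u v where v: "v \<in> X ` I" "u v \<noteq> 0" and eq: "(\<Sum>v\<in>X ` I. u v *\<^sub>R v) = 0"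
        using dependent_finite[of "X ` I"] I by auto
      have s: "(\<Sum>i\<in>I. u (X i) *\<^sub>R X i) = 0"
        using eq inj by (simp add: sum.reindex o_def)
      have "\<forall>c. (\<Sum>i\<in>I. c i *\<^sub>R X i) = 0 \<longrightarrow> (\<forall>i\<in>I. c i = 0)"
        using L unfolding lin_indep_def coord .
      from mp[OF spec[OF this, of "\<lambda>i. u (X i)"] s] have "\<forall>i\<in>I. u (X i) = 0" .
      then show False using v by auto
    qed
    ultimately show "inj_on X I \<and> independent (X ` I)" ..
  next
    assume R: "inj_on X I \<and> independent (X ` I)"
    show "lin_indep d I X" unfolding lin_indep_def coord
    proof (intro allI impI ballI)
      fix c i assume c: "(\<Sum>i\<in>I. c i *\<^sub>R X i) = 0" and i: "i \<in> I"
      have "(\<Sum>v\<in>X ` I. c (the_inv_into I X v) *\<^sub>R v) = (\<Sum>i\<in>I. c i *\<^sub>R X i)"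
        using R by (simp add: sum.reindex o_def the_inv_into_f_f)
      then have "\<forall>v\<in>X ` I. c (the_inv_into I X v) = 0"
        using R c I dependent_finite[of "X ` I"] by auto
      then show "c i = 0" using R i by (auto simp: the_inv_into_f_f)
    qed
  qed
qed

lemma lin_indep_solvable:
  assumes I: "finite I" "\<And>i. i \<in> I \<Longrightarrow> X i \<in> Eucl d" and L: "lin_indep d I X"
  shows "solvable_upto d I X"
  unfolding solvable_upto_def
proof
  fix c
  have R: "inj_on X I" "independent (X ` I)" using lin_indep_iff[OF I] L by auto
  obtain g :: "(nat \<Rightarrow> real) \<Rightarrow> real" where g: "linear g" "\<forall>x\<in>X ` I. g x = c (the_inv_into I X x)"
    using linear_independent_extend[OF R(2), of "\<lambda>x. c (the_inv_into I X x)"] by blast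
  have "inner_upto d (X i) (\<lambda>k. g (axis_vec k)) = c i" if "i \<in> I" for i
    using linear_eq_inner[OF g(1) I(2)[OF that]] g(2) that R(1) by (simp add: the_inv_into_f_f)
  then show "\<exists>w. \<forall>i\<in>I. inner_upto d (X i) w = c i" by blast
qed

text \<open>A vector outside the span would enlarge the family to d + 1 independent vectors in the
  span of d axis vectors.\<close>

lemma lin_indep_spanning:
  assumes I: "finite I" "\<And>i. i \<in> I \<Longrightarrow> X i \<in> Eucl d" and L: "lin_indep d I X" and "card I = d"
    and x: "x \<in> Eucl d"
  shows "\<exists>c. x = (\<Sum>i\<in>I. c i *\<^sub>R X i)"
proof -
  have R: "inj_on X I" "independent (X ` I)" using lin_indep_iff[OF I] L by auto
  have "x \<in> span (X ` I)"
  proof (rule ccontr)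
    assume nx: "x \<notin> span (X ` I)"
    then have ind: "independent (insert x (X ` I))" using R by (intro independent_insertI)
    moreover have "insert x (X ` I) \<subseteq> span (axis_vec ` {..<d})" using x I Eucl_span by auto
    ultimately have "card (insert x (X ` I)) \<le> d"
      using independent_span_bound[of "axis_vec ` {..<d}" "insert x (X ` I)"] by (simp add: card_axis_vec)
    moreover have "x \<notin> X ` I" using nx span_base[of x "X ` I"] by auto
    then have "card (insert x (X ` I)) = Suc d" using I R assms(4) by (simp add: card_image)
    ultimately show False by simp
  qed
  then obtain u where "x = (\<Sum>v\<in>X ` I. u v *\<^sub>R v)"
    using span_finite[of "X ` I"] I by auto
  then have "x = (\<Sum>i\<in>I. u (X i) *\<^sub>R X i)" using R by (simp add: sum.reindex o_def)
  then show ?thesis by (rule exI[of _ "\<lambda>i. u (X i)"])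
qed

text \<open>Truncated to its first d coordinates, \<open>w\<close> is a combination of the X i,
  hence orthogonal to itself. This is the source of all uniqueness statements about normal
  vectors.\<close>

lemma lin_indep_orthogonal_0:
  assumes I: "finite I" "\<And>i. i \<in> I \<Longrightarrow> X i \<in> Eucl d" and L: "lin_indep d I X" and "card I = d"
    and w: "\<forall>i\<in>I. inner_upto d (X i) w = 0" and k: "k < d"
  shows "w k = 0"
proof -
  define w' where "w' = (\<lambda>k. if k < d then w k else 0)"
  have w': "inner_upto d x w' = inner_upto d x w" for x
    by (simp add: w'_def cong: inner_upto_cong)
  have "w' \<in> Eucl d" by (simp add: w'_def Eucl_iff)
  then obtain c where c: "w' = (\<Sum>i\<in>I. c i *\<^sub>R X i)" using lin_indep_spanning[OF I L assms(4)] by blast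
  have "inner_upto d w' w' = (\<Sum>i\<in>I. c i * inner_upto d (X i) w')"
    by (subst (1) c) (simp add: inner_upto_sum inner_upto_scaleR)
  also have "\<dots> = 0" using w by (simp add: w')
  finally show ?thesis using k by (simp add: inner_upto_self_eq_0 w'_def)
qed

lemma lin_indep_subset:
  assumes "lin_indep d I X" "J \<subseteq> I" "finite I"
  shows "lin_indep d J X"
  unfolding lin_indep_def
proof (intro allI impI ballI)
  fix c j assume c: "\<forall>k<d. (\<Sum>i\<in>J. c i * X i k) = 0" and j: "j \<in> J"
  have "(\<Sum>i\<in>I. (if i \<in> J then c i else 0) * X i k) = (\<Sum>i\<in>J. c i * X i k)" for k
    using assms by (intro sum.mono_neutral_cong_right) auto
  moreover have "(\<forall>k<d. (\<Sum>i\<in>I. (if i \<in> J then c i else 0) * X i k) = 0) \<longrightarrow>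
      (\<forall>i\<in>I. (if i \<in> J then c i else 0) = 0)"
    using assms(1) unfolding lin_indep_def by (rule spec)
  ultimately have "\<forall>i\<in>I. (if i \<in> J then c i else 0) = 0" using c by simp
  then show "c j = 0" using j assms by force
qed

section \<open>Facets of the convex hull of finitely many points\<close>

lemma nsphere_iff:
  assumes "d \<ge> 1"
  shows "u \<in> topspace (nsphere (d - 1)) \<longleftrightarrow> u \<in> Eucl d \<and> inner_upto d u u = 1"
proof -
  have "{..d - 1} = {..<d}" using assms by auto
  then show ?thesis using assms
    by (auto simp: nsphere_def inner_upto_def power2_eq_square)
qed

text \<open>Linear instead of affine independence keeps the hyperplane through d points away from
  the origin, so that it can be normalised to height 1 with a normal \<open>v\<close> of arbitrary
  length. The last condition then says that no further point lies on it.\<close>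

definition general_position :: "nat \<Rightarrow> nat \<Rightarrow> (nat \<Rightarrow> nat \<Rightarrow> real) \<Rightarrow> bool" where
  "general_position n d X \<longleftrightarrow> (\<forall>i<n. X i \<in> Eucl d) \<and>
     (\<forall>I \<subseteq> {..<n}. card I = d \<longrightarrow> lin_indep d I X \<and>
       (\<forall>j \<in> {..<n} - I. \<not> (\<exists>v. \<forall>i\<in>insert j I. inner_upto d (X i) v = 1)))"

text \<open>The event whose probability is estimated for a fixed set of d indices. All its
  conditions are closed and its parameters range over a compact set, which settles
  measurability.\<close>

definition supports_at :: "nat \<Rightarrow> nat \<Rightarrow> real \<Rightarrow> real \<Rightarrow> nat set \<Rightarrow> (nat \<Rightarrow> nat \<Rightarrow> real) \<Rightarrow> bool" where
  "supports_at n d a b I X \<longleftrightarrow> (\<exists>u h. u \<in> topspace (nsphere (d - 1)) \<and> h \<in> {a..b} \<and>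
     (\<forall>i\<in>I. inner_upto d (X i) u = h) \<and> (\<forall>j<n. inner_upto d (X j) u \<le> h))"

lemma affine_hull_combination:
  assumes "finite I" "inj_on X I" "sum c I = 1"
  shows "(\<Sum>i\<in>I. c i *\<^sub>R X i) \<in> affine hull (X ` I)"
proof -
  have "sum (\<lambda>x. c (the_inv_into I X x)) (X ` I) = 1"
    "(\<Sum>x\<in>X ` I. c (the_inv_into I X x) *\<^sub>R x) = (\<Sum>i\<in>I. c i *\<^sub>R X i)"
    using assms by (simp_all add: sum.reindex the_inv_into_f_f)
  then show ?thesis using assms(1) by (subst affine_hull_finite) (auto intro!: exI[of _ "\<lambda>x. c (the_inv_into I X x)"])
qed

lemma convex_inner_le: "convex {y. inner_upto d y u \<le> h}"
  unfolding convex_def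
proof (intro ballI allI impI)
  fix x y and s t :: real
  assume *: "x \<in> {y. inner_upto d y u \<le> h}" "y \<in> {y. inner_upto d y u \<le> h}" "0 \<le> s" "0 \<le> t" "s + t = 1"
  have "inner_upto d (s *\<^sub>R x + t *\<^sub>R y) u = s * inner_upto d x u + t * inner_upto d y u"
    by (simp add: inner_upto_add inner_upto_scaleR)
  also have "\<dots> \<le> s * h + t * h" using * by (intro add_mono mult_left_mono) auto
  also have "\<dots> = h" using * by (simp add: distrib_right[symmetric])
  finally show "s *\<^sub>R x + t *\<^sub>R y \<in> {y. inner_upto d y u \<le> h}" by simp
qed

lemma affine_inner_eq: "affine {y. inner_upto d y u = h}"
  unfolding affine_def
  by (auto simp: inner_upto_add inner_upto_scaleR simp flip: distrib_right)

lemma affine_Eucl: "affine (Eucl d)"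
  by (auto simp: affine_def Eucl_iff)

lemma inner_le_hull:
  assumes "\<And>i. i \<in> I \<Longrightarrow> inner_upto d (X i) u \<le> h" "y \<in> convex hull (X ` I)"
  shows "inner_upto d y u \<le> h"
proof -
  have "convex hull (X ` I) \<subseteq> {y. inner_upto d y u \<le> h}"
    using assms(1) by (intro hull_minimal convex_inner_le) auto
  then show ?thesis using assms(2) by auto
qed

lemma inner_eq_affine_hull:
  assumes "\<And>x. x \<in> A \<Longrightarrow> inner_upto d x u = h" "y \<in> affine hull A"
  shows "inner_upto d y u = h"
proof -
  have "affine hull A \<subseteq> {y. inner_upto d y u = h}"
    using assms(1) by (intro hull_minimal affine_inner_eq) auto
  then show ?thesis using assms(2) by auto
qed

text \<open>A weight on a point strictly below the supporting hyperplane would pull the combination below it.\<close>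

lemma supported_hull_Int:
  assumes fin: "finite K" and le: "\<And>j. j \<in> K \<Longrightarrow> inner_upto d (X j) u \<le> h"
    and y: "y \<in> convex hull (X ` K)" and eq: "inner_upto d y u = h"
  shows "y \<in> convex hull (X ` {j \<in> K. inner_upto d (X j) u = h})"
proof -
  obtain c where c: "\<And>x. x \<in> X ` K \<Longrightarrow> 0 \<le> c x" "sum c (X ` K) = 1" "(\<Sum>x\<in>X ` K. c x *\<^sub>R x) = y"
    using y convex_hull_finite[of "X ` K"] fin by auto
  have le': "inner_upto d x u \<le> h" if "x \<in> X ` K" for x using le that by auto
  let ?F = "{x \<in> X ` K. inner_upto d x u = h}"
  have "(\<Sum>x\<in>X ` K. c x * (h - inner_upto d x u)) = h * sum c (X ` K) - inner_upto d y u"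
    unfolding c(3)[symmetric]
    by (simp add: inner_upto_sum inner_upto_scaleR right_diff_distrib sum_subtractf sum_distrib_left mult.commute)
  also have "\<dots> = 0" using c eq by simp
  finally have "(\<Sum>x\<in>X ` K. c x * (h - inner_upto d x u)) = 0" .
  then have z: "\<forall>x\<in>X ` K. c x * (h - inner_upto d x u) = 0"
    using fin c(1) le' by (subst (asm) sum_nonneg_eq_0_iff) auto
  then have z': "c x = 0" if "x \<in> X ` K - ?F" for x using that by auto
  have "sum c ?F = 1" using c(2) z' fin by (subst sum.mono_neutral_left[of "X ` K"]) auto
  moreover have "(\<Sum>x\<in>?F. c x *\<^sub>R x) = y"
    unfolding c(3)[symmetric] using z' fin by (intro sum.mono_neutral_left) auto
  moreover have "finite ?F" using fin by simp
  ultimately have "y \<in> convex hull ?F"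
    using c(1) unfolding convex_hull_finite[OF \<open>finite ?F\<close>] by blast
  moreover have "?F = X ` {j \<in> K. inner_upto d (X j) u = h}" by auto
  ultimately show ?thesis by simp
qed

section \<open>Hyperplanes through points in general position\<close>

context
  fixes n d :: nat and X :: "nat \<Rightarrow> nat \<Rightarrow> real"
  assumes gp: "general_position n d X" and d1: "d \<ge> 1"
begin

lemma gp_Eucl: "i < n \<Longrightarrow> X i \<in> Eucl d"
  using gp by (simp add: general_position_def)

lemma gp_lin_indep: "I \<subseteq> {..<n} \<Longrightarrow> card I = d \<Longrightarrow> lin_indep d I X"
  using gp by (auto simp: general_position_def)

lemma gp_finite: "I \<subseteq> {..<n} \<Longrightarrow> finite I"
  using finite_subset by blast

lemma gp_height_nonzero:
  assumes I: "I \<subseteq> {..<n}" "card I = d" and u: "inner_upto d u u = 1"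
    and eq: "\<And>i. i \<in> I \<Longrightarrow> inner_upto d (X i) u = h"
  shows "h \<noteq> 0"
proof
  assume "h = 0"
  then have "u k = 0" if "k < d" for k
    using lin_indep_orthogonal_0[OF gp_finite[OF I(1)] _ gp_lin_indep[OF I] I(2), of u k] gp_Eucl I eq that
    by auto
  then show False using u by (simp add: inner_upto_def)
qed

text \<open>Division of the normal by the nonzero height brings the hyperplane into the normalised
  form of \<open>general_position\<close>, which then excludes a further point.\<close>

lemma gp_on_hyperplane:
  assumes I: "I \<subseteq> {..<n}" "card I = d" and u: "inner_upto d u u = 1"
    and eq: "\<And>i. i \<in> I \<Longrightarrow> inner_upto d (X i) u = h" and j: "j < n" "inner_upto d (X j) u = h"
  shows "j \<in> I"
proof (rule ccontr)
  assume "j \<notin> I"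
  have "h \<noteq> 0" using gp_height_nonzero[OF I u eq] .
  then have "\<forall>i\<in>insert j I. inner_upto d (X i) (\<lambda>k. 1 / h * u k) = 1"
    using eq j unfolding inner_upto_scale by simp
  then show False using gp I j \<open>j \<notin> I\<close> unfolding general_position_def by blast
qed

end

text \<open>Points of \<open>Eucl d\<close> have a free coordinate \<open>d\<close>; setting it to 1
  turns affine relations into linear ones. Measurability is thereby inherited from linear
  independence.\<close>

definition aff_indep :: "nat \<Rightarrow> 'i set \<Rightarrow> ('i \<Rightarrow> nat \<Rightarrow> real) \<Rightarrow> bool" where
  "aff_indep d I X \<longleftrightarrow> lin_indep (Suc d) I (\<lambda>i. (X i)(d := 1))"

lemma aff_indepD:
  assumes "aff_indep d I X" "\<And>i. i \<in> I \<Longrightarrow> X i \<in> Eucl d" "sum c I = 0" "(\<Sum>i\<in>I. c i *\<^sub>R X i) = 0" "i \<in> I"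
  shows "c i = 0"
proof -
  have "(\<Sum>i\<in>I. c i * ((X i)(d := 1)) k) = 0" if "k < Suc d" for k
  proof (cases "k = d")
    case True
    then show ?thesis using assms(3) by simp
  next
    case False
    have "(\<Sum>i\<in>I. c i *\<^sub>R X i) k = 0" using assms(4) by simp
    then show ?thesis using False by (simp add: sum_fun_apply)
  qed
  then show ?thesis using assms(1,5) unfolding aff_indep_def lin_indep_def by blast
qed

lemma not_aff_indepD:
  assumes "\<not> aff_indep d I X" "\<And>i. i \<in> I \<Longrightarrow> X i \<in> Eucl d"
  shows "\<exists>c i. sum c I = 0 \<and> (\<Sum>i\<in>I. c i *\<^sub>R X i) = 0 \<and> i \<in> I \<and> c i \<noteq> 0"
proof -
  obtain c i where c: "\<And>k. k < Suc d \<Longrightarrow> (\<Sum>i\<in>I. c i * ((X i)(d := 1)) k) = 0" and i: "i \<in> I" "c i \<noteq> 0"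
    using assms(1) unfolding aff_indep_def lin_indep_def by blast
  have "(\<Sum>i\<in>I. c i *\<^sub>R X i) k = 0" for k
  proof (cases "k < d")
    case True
    then show ?thesis using c[of k] by (simp add: sum_fun_apply)
  next
    case False
    then show ?thesis using assms(2) unfolding sum_fun_apply by (intro sum.neutral) (auto simp: Eucl_iff)
  qed
  then have "(\<Sum>i\<in>I. c i *\<^sub>R X i) = 0" by (simp add: fun_eq_iff)
  moreover have "sum c I = 0" using c[of d] by simp
  ultimately show ?thesis using i by blast
qed

lemma aff_indep_subset: "aff_indep d I X \<Longrightarrow> J \<subseteq> I \<Longrightarrow> finite I \<Longrightarrow> aff_indep d J X"
  unfolding aff_indep_def by (rule lin_indep_subset)

lemma aff_indep_lift: "lin_indep d I X \<Longrightarrow> aff_indep d I X"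
  unfolding aff_indep_def lin_indep_def
proof (intro allI impI)
  fix c assume L: "\<forall>c. (\<forall>k<d. (\<Sum>i\<in>I. c i * X i k) = 0) \<longrightarrow> (\<forall>i\<in>I. c i = 0)"
    and c: "\<forall>k<Suc d. (\<Sum>i\<in>I. c i * ((X i)(d := 1)) k) = 0"
  have "(\<Sum>i\<in>I. c i * X i k) = 0" if "k < d" for k
    using c[rule_format, of k] that by simp
  then show "\<forall>i\<in>I. c i = 0" using L by blast
qed

lemma aff_indep_inj:
  assumes "finite I" "\<And>i. i \<in> I \<Longrightarrow> X i \<in> Eucl d" "aff_indep d I X"
  shows "inj_on X I" "\<not> affine_dependent (X ` I)"
proof -
  have E: "(X i)(d := 1) \<in> Eucl (Suc d)" if "i \<in> I" for i
    using assms(2)[OF that] by (auto simp: Eucl_iff)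
  have "inj_on (\<lambda>i. (X i)(d := 1)) I"
    using lin_indep_iff[OF assms(1), of "\<lambda>i. (X i)(d := 1)" "Suc d"] E assms(3) unfolding aff_indep_def by blast
  then show inj: "inj_on X I" by (auto simp: inj_on_def)
  show "\<not> affine_dependent (X ` I)"
  proof
    assume "affine_dependent (X ` I)"
    then obtain U v where U: "sum U (X ` I) = 0" "v \<in> X ` I" "U v \<noteq> 0" "(\<Sum>v\<in>X ` I. U v *\<^sub>R v) = 0"
      using affine_dependent_explicit_finite[of "X ` I"] assms(1) by auto
    have s: "(\<Sum>i\<in>I. U (X i)) = 0" "(\<Sum>i\<in>I. U (X i) *\<^sub>R X i) = 0"
      using U inj by (simp_all add: sum.reindex)
    obtain i where i: "i \<in> I" "v = X i" using U(2) by auto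
    have "U (X i) = 0" by (rule aff_indepD[OF assms(3,2) s i(1)])
    then show False using U(3) i by simp
  qed
qed

text \<open>In a nontrivial affine relation of the enlarged family the coefficient of the new point
  cannot vanish, since the old family is independent. The relation is solved for
  \<open>X j\<close>.\<close>

lemma aff_indep_extend:
  assumes I: "finite I" "j \<notin> I" "aff_indep d I X" "\<not> aff_indep d (insert j I) X"
    and E: "\<And>i. i \<in> insert j I \<Longrightarrow> X i \<in> Eucl d"
  shows "X j \<in> affine hull (X ` I)"
proof -
  obtain c i where c: "sum c (insert j I) = 0" "(\<Sum>i\<in>insert j I. c i *\<^sub>R X i) = 0" "i \<in> insert j I" "c i \<noteq> 0"
    using not_aff_indepD[OF I(4) E] by blast
  have cj: "c j \<noteq> 0"
  proof
    assume "c j = 0"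
    then show False using aff_indepD[OF I(3), of c i] c I E by auto
  qed
  have s: "sum c I = - c j" using c(1) I by simp
  have eq: "c j *\<^sub>R X j = - (\<Sum>i\<in>I. c i *\<^sub>R X i)"
    using c(2) I by (simp add: eq_neg_iff_add_eq_0)
  have "X j = (1 / c j) *\<^sub>R (c j *\<^sub>R X j)" using cj by simp
  also have "\<dots> = (\<Sum>i\<in>I. (- c i / c j) *\<^sub>R X i)"
    unfolding eq by (simp add: scaleR_sum_right sum_negf)
  finally have "X j = (\<Sum>i\<in>I. (- c i / c j) *\<^sub>R X i)" .
  moreover have "(\<Sum>i\<in>I. - c i / c j) = 1"
    using s cj by (simp add: sum_negf flip: sum_divide_distrib)
  ultimately show ?thesis
    using affine_hull_combination[OF I(1) aff_indep_inj(1)[OF I(1) _ I(3)], of "\<lambda>i. - c i / c j"] E by auto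
qed

text \<open>Lift to \<open>d + 1\<close> dimensions: the lifted points together with the lifted normal form a basis.\<close>

lemma hyperplane_eq_hull:
  fixes X :: "nat \<Rightarrow> nat \<Rightarrow> real"
  assumes I: "finite I" "card I = d" "aff_indep d I X" and E: "\<And>i. i \<in> I \<Longrightarrow> X i \<in> Eucl d"
    and u: "inner_upto d u u = 1" and eq: "\<And>i. i \<in> I \<Longrightarrow> inner_upto d (X i) u = h"
  shows "affine hull (X ` I) = hyperplane d u h"
proof
  have "affine hull (X ` I) \<subseteq> Eucl d"
    using E by (intro hull_minimal affine_Eucl) auto
  then show "affine hull (X ` I) \<subseteq> hyperplane d u h"
    using inner_eq_affine_hull[of "X ` I" d u h] eq by (auto simp: hyperplane_def)
  show "hyperplane d u h \<subseteq> affine hull (X ` I)"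
  proof
    fix x assume "x \<in> hyperplane d u h"
    then have x: "x \<in> Eucl d" "inner_upto d x u = h" by (auto simp: hyperplane_def)
    obtain p where p: "p \<notin> I" using I(1) ex_new_if_finite infinite_UNIV_nat by blast
    \<comment> \<open>The lifted normal (u, -h): its inner product with the lift of y is <y, u> - h,
      so it is orthogonal to the lift exactly if y has height \<open>h\<close>. The fresh index
      \<open>p\<close> carries it in the family \<open>Z\<close>.\<close>
    define m where "m = (\<lambda>k. if k < d then u k else if k = d then - h else 0)"
    define Z where "Z = (\<lambda>i. if i = p then m else (X i)(d := 1))"
    have inner_m: "inner_upto (Suc d) (y(d := 1)) m = inner_upto d y u - h" for y
    proof -
      have "inner_upto d y m = inner_upto d y u" by (rule inner_upto_cong) (auto simp: m_def)
      then show ?thesis by (simp add: inner_upto_Suc m_def)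
    qed
    have mm: "inner_upto (Suc d) m m > 0"
    proof -
      have "inner_upto d m m = inner_upto d u u" by (rule inner_upto_cong) (auto simp: m_def)
      then show ?thesis using u by (simp add: inner_upto_Suc m_def add_pos_nonneg)
    qed
    have Zm: "inner_upto (Suc d) (Z i) m = 0" if "i \<in> I" for i
      using that p eq[OF that] inner_m[of "X i"] by (auto simp: Z_def)
    have ZE: "Z i \<in> Eucl (Suc d)" if "i \<in> insert p I" for i
      using that p E by (auto simp: Z_def m_def Eucl_iff)
    have L: "lin_indep (Suc d) (insert p I) Z"
      unfolding lin_indep_def
    proof (intro allI impI)
      fix c assume c: "\<forall>k<Suc d. (\<Sum>i\<in>insert p I. c i * Z i k) = 0"
      have "0 = inner_upto (Suc d) (\<Sum>i\<in>insert p I. c i *\<^sub>R Z i) m"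
        using c by (simp add: inner_upto_def sum_fun_apply)
      also have "\<dots> = c p * inner_upto (Suc d) m m + (\<Sum>i\<in>I. c i * inner_upto (Suc d) (Z i) m)"
        using p I(1) by (simp add: inner_upto_add inner_upto_sum inner_upto_scaleR Z_def)
      also have "\<dots> = c p * inner_upto (Suc d) m m" using Zm by simp
      finally have cp: "c p = 0" using mm by simp
      have "(\<Sum>i\<in>I. c i * ((X i)(d := 1)) k) = 0" if "k < Suc d" for k
      proof -
        have "(\<Sum>i\<in>I. c i * Z i k) = 0" using c that cp p I(1) by simp
        moreover have "(\<Sum>i\<in>I. c i * Z i k) = (\<Sum>i\<in>I. c i * ((X i)(d := 1)) k)"
          using p by (intro sum.cong) (auto simp: Z_def)
        ultimately show ?thesis by simp
      qed
      then have "\<forall>i\<in>I. c i = 0" using I(3) unfolding aff_indep_def lin_indep_def by blast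
      then show "\<forall>i\<in>insert p I. c i = 0" using cp by simp
    qed
    have "x(d := 1) \<in> Eucl (Suc d)" using x by (auto simp: Eucl_iff)
    then obtain c where c: "x(d := 1) = (\<Sum>i\<in>insert p I. c i *\<^sub>R Z i)"
      using lin_indep_spanning[OF _ ZE L] I p by auto
    have "inner_upto (Suc d) (x(d := 1)) m = c p * inner_upto (Suc d) m m + (\<Sum>i\<in>I. c i * inner_upto (Suc d) (Z i) m)"
      unfolding c using p I(1) by (simp add: inner_upto_add inner_upto_sum inner_upto_scaleR Z_def)
    then have cp: "c p = 0" using Zm mm inner_m[of x] x(2) by simp
    have eq': "x(d := 1) = (\<Sum>i\<in>I. c i *\<^sub>R (X i)(d := 1))"
    proof -
      have "(\<Sum>i\<in>insert p I. c i *\<^sub>R Z i) = (\<Sum>i\<in>I. c i *\<^sub>R Z i)" using p I(1) cp by simp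
      also have "\<dots> = (\<Sum>i\<in>I. c i *\<^sub>R (X i)(d := 1))"
        using p by (intro sum.cong) (auto simp: Z_def)
      finally show ?thesis using c by simp
    qed
    have "sum c I = 1" using fun_cong[OF eq', of d] by (simp add: sum_fun_apply)
    moreover have "x = (\<Sum>i\<in>I. c i *\<^sub>R X i)"
    proof
      fix k show "x k = (\<Sum>i\<in>I. c i *\<^sub>R X i) k"
      proof (cases "k = d")
        case True
        then show ?thesis using x E unfolding sum_fun_apply by (simp add: Eucl_iff)
      next
        case False
        then show ?thesis using fun_cong[OF eq', of k] by (simp add: sum_fun_apply)
      qed
    qed
    ultimately show "x \<in> affine hull (X ` I)"
      using affine_hull_combination[OF I(1) aff_indep_inj(1)[OF I(1) E I(3)]] by simp
  qed
qed

text \<open>With fewer than d points, the normal \<open>u\<close> and the differences of the points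
  from one of them are fewer than d vectors, so some \<open>w\<close> is orthogonal to all of them.
  Then <., w> is constant on the affine hull, although the hyperplane can be traversed in direction
  \<open>w\<close>.\<close>

lemma hyperplane_sub_hull_card:
  assumes I: "finite I" and E: "\<And>i. i \<in> I \<Longrightarrow> X i \<in> Eucl d"
    and u: "inner_upto d u u = 1" "u \<in> Eucl d" and sub: "hyperplane d u h \<subseteq> affine hull (X ` I)"
  shows "d \<le> card I"
proof (rule ccontr)
  assume "\<not> d \<le> card I"
  then have lt: "card I < d" by simp
  have hu: "h *\<^sub>R u \<in> hyperplane d u h"
    using u by (auto simp: hyperplane_def inner_upto_scaleR Eucl_iff)
  then obtain k where k: "k \<in> I" using sub by fastforce
  define Y where "Y = (\<lambda>i. if i = k then u else X i - X k)"
  have "Y i \<in> Eucl d" if "i \<in> I" for i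
    using E[OF that] E[OF k] u by (simp add: Y_def Eucl_iff)
  then obtain w where w: "w \<in> Eucl d" "inner_upto d w w > 0" "\<And>i. i \<in> I \<Longrightarrow> inner_upto d (Y i) w = 0"
    using exists_orthogonal[OF I lt, of Y] by blast
  have uw: "inner_upto d u w = 0" using w(3)[OF k] by (simp add: Y_def)
  have Xw: "inner_upto d (X i) w = inner_upto d (X k) w" if "i \<in> I" for i
    using w(3)[OF that] by (auto simp: Y_def inner_upto_diff split: if_splits)
  have const: "inner_upto d x w = inner_upto d (X k) w" if "x \<in> hyperplane d u h" for x
    using inner_eq_affine_hull[of "X ` I" d w _ x] Xw sub that by auto
  have "h *\<^sub>R u + w \<in> hyperplane d u h"
    using hu w uw by (auto simp: hyperplane_def inner_upto_add Eucl_iff inner_upto_commute[of d w u])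
  from const[OF this] const[OF hu] have "inner_upto d w w = 0" by (simp add: inner_upto_add)
  then show False using w by simp
qed

text \<open>
  The facets have to be described for all configurations, not only for those in general position:
  the product measure is not complete, and the Bochner integral of a function that agrees only
  almost everywhere with a measurable one is 0 unless the function is measurable itself.
\<close>

definition exposes :: "nat \<Rightarrow> nat \<Rightarrow> real \<Rightarrow> real \<Rightarrow> nat set \<Rightarrow> (nat \<Rightarrow> nat \<Rightarrow> real) \<Rightarrow> bool" where
  "exposes n d a b J X \<longleftrightarrow> (\<exists>u h. u \<in> topspace (nsphere (d - 1)) \<and> h \<in> {a..b} \<and>
     (\<forall>i\<in>J. inner_upto d (X i) u = h) \<and> (\<forall>j\<in>{..<n} - J. inner_upto d (X j) u < h))"

text \<open>\<open>J\<close> consists of all points on the facet and may have more than d elements.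
  The affinely independent d-subset expresses that the facet has full dimension d - 1.\<close>

definition facet_index_set :: "nat \<Rightarrow> nat \<Rightarrow> real \<Rightarrow> real \<Rightarrow> nat set \<Rightarrow> (nat \<Rightarrow> nat \<Rightarrow> real) \<Rightarrow> bool" where
  "facet_index_set n d a b J X \<longleftrightarrow> exposes n d a b J X \<and> (\<exists>I\<subseteq>J. card I = d \<and> aff_indep d I X)"

text \<open>If the weight of v lies strictly between 0 and 1, then y is on the open segment from v
  to the normalised combination of the other points, and the face property applies. The degenerate
  cases give y = v.\<close>

lemma face_weight_pos:
  assumes K: "finite K" and F: "F face_of convex hull K" and y: "y \<in> F"
    and c: "\<And>v. v \<in> K \<Longrightarrow> c v \<ge> 0" "sum c K = 1" "y = (\<Sum>v\<in>K. c v *\<^sub>R v)" and v: "v \<in> K" "c v > 0"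
  shows "v \<in> F"
proof (rule ccontr)
  assume nF: "v \<notin> F"
  have s1: "sum c (K - {v}) = 1 - c v" using c(2) v K by (simp add: sum_diff1)
  have y_eq: "y = c v *\<^sub>R v + (\<Sum>j\<in>K - {v}. c j *\<^sub>R j)"
    unfolding c(3) using v K by (simp add: sum.remove)
  have "c v \<noteq> 1"
  proof
    assume "c v = 1"
    then have "sum c (K - {v}) = 0" using s1 by simp
    then have "\<forall>j\<in>K - {v}. c j = 0" using c(1) K by (subst (asm) sum_nonneg_eq_0_iff) auto
    then have "y = v" using y_eq \<open>c v = 1\<close> by simp
    then show False using y nF by simp
  qed
  moreover have "c v \<le> 1" using s1 c(1) sum_nonneg[of "K - {v}" c] by auto
  ultimately have ci1: "c v < 1" by simp
  define q where "q = (\<Sum>j\<in>K - {v}. (c j / (1 - c v)) *\<^sub>R j)"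
  have "q \<in> convex hull K"
    unfolding q_def using c(1) ci1 s1 K
    by (intro convex_sum convex_convex_hull) (auto intro: hull_inc simp flip: sum_divide_distrib)
  moreover have y_eq': "y = c v *\<^sub>R v + (1 - c v) *\<^sub>R q"
    unfolding y_eq q_def scaleR_sum_right using ci1 by simp
  moreover have "v \<noteq> q"
  proof
    assume "v = q"
    then have "y = v" using y_eq' by (simp flip: scaleR_add_left)
    then show False using y nF by simp
  qed
  moreover from calculation have "y \<in> open_segment v q"
    unfolding in_segment using v(2) ci1 by (intro conjI exI[of _ "1 - c v"]) auto
  ultimately have "v \<in> F"
    using F v(1) y unfolding face_of_def by (blast intro: hull_inc)
  then show False using nF by simp
qed

lemma face_eq_hull:
  assumes K: "finite K" and F: "F face_of convex hull K"
  shows "F = convex hull (F \<inter> K)"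
proof
  show "convex hull (F \<inter> K) \<subseteq> F" using F by (intro hull_minimal) (auto simp: face_of_def)
  show "F \<subseteq> convex hull (F \<inter> K)"
  proof
    fix y assume y: "y \<in> F"
    then have "y \<in> convex hull K" using F by (auto simp: face_of_def)
    then obtain c where c: "\<And>v. v \<in> K \<Longrightarrow> c v \<ge> 0" "sum c K = 1" "(\<Sum>v\<in>K. c v *\<^sub>R v) = y"
      using convex_hull_finite[OF K] by auto
    have z: "c v = 0" if "v \<in> K - F \<inter> K" for v
      using face_weight_pos[OF K F y c(1,2) c(3)[symmetric], of v] c(1)[of v] that by fastforce
    have "sum c (F \<inter> K) = 1"
      using c(2) z K by (subst sum.mono_neutral_left[of K]) auto
    moreover have "(\<Sum>v\<in>F \<inter> K. c v *\<^sub>R v) = y"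
      unfolding c(3)[symmetric] using z K by (intro sum.mono_neutral_left) auto
    ultimately show "y \<in> convex hull (F \<inter> K)"
      using c(1) K convex_hull_finite[of "F \<inter> K"] by auto
  qed
qed

text \<open>The barycentre \<open>p\<close> of the vertices is relatively interior to the face: the segment from a point
  \<open>x\<close> through \<open>p\<close> can be prolonged inside the face.\<close>

lemma face_Int_affine_hull:
  assumes K: "finite K" and F: "F face_of convex hull K"
    and x: "x \<in> convex hull K" "x \<in> affine hull F"
  shows "x \<in> F"
proof -
  define V where "V = F \<inter> K"
  have V: "finite V" "F = convex hull V" using K face_eq_hull[OF K F] by (auto simp: V_def)
  have "x \<in> affine hull V" using x(2) unfolding V(2) by simp
  then obtain a where a: "sum a V = 1" "(\<Sum>v\<in>V. a v *\<^sub>R v) = x"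
    using affine_hull_finite[OF V(1)] by auto
  then have "V \<noteq> {}" by auto
  define m where "m = real (card V)"
  have m: "m > 0" using V(1) \<open>V \<noteq> {}\<close> by (simp add: m_def card_gt_0_iff)
  define p where "p = (\<Sum>v\<in>V. (1 / m) *\<^sub>R v)"
  define A where "A = 1 + (\<Sum>v\<in>V. \<bar>a v\<bar>)"
  have A: "A > 0" "\<And>v. v \<in> V \<Longrightarrow> a v \<le> A"
  proof -
    have n: "(\<Sum>v\<in>V. \<bar>a v\<bar>) \<ge> 0" by (intro sum_nonneg) auto
    then show "A > 0" unfolding A_def by linarith
    show "a v \<le> A" if "v \<in> V" for v
      using member_le_sum[of v V "\<lambda>v. \<bar>a v\<bar>"] that V(1) by (auto simp: A_def)
  qed
  \<comment> \<open>Small enough that \<epsilon> times any coefficient \<open>a v\<close> is at most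
    the weight 1/m of the barycentre; the coefficients of \<open>q\<close> are therefore
    nonnegative.\<close>
  define \<epsilon> where "\<epsilon> = 1 / (m * A)"
  have \<epsilon>: "\<epsilon> > 0" using m A by (simp add: \<epsilon>_def)
  define q where "q = (\<Sum>v\<in>V. ((1 + \<epsilon>) / m - \<epsilon> * a v) *\<^sub>R v)"
  have q_eq: "q = (1 + \<epsilon>) *\<^sub>R p - \<epsilon> *\<^sub>R x"
    unfolding q_def p_def a(2)[symmetric]
    by (simp add: scaleR_sum_right scaleR_diff_left sum_subtractf)
  have "q \<in> F"
  proof -
    have "(1 + \<epsilon>) / m - \<epsilon> * a v \<ge> 0" if "v \<in> V" for v
    proof -
      have "\<epsilon> * a v \<le> \<epsilon> * A" using A(2)[OF that] \<epsilon> by simp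
      also have "\<dots> = 1 / m" using A m by (simp add: \<epsilon>_def)
      also have "\<dots> \<le> (1 + \<epsilon>) / m" using m \<epsilon> by (simp add: divide_right_mono)
      finally show ?thesis by simp
    qed
    moreover have "(\<Sum>v\<in>V. (1 + \<epsilon>) / m - \<epsilon> * a v) = 1"
      using a(1) m by (simp add: sum_subtractf m_def flip: sum_distrib_left)
    ultimately show ?thesis
      unfolding q_def V(2) using V(1) by (intro convex_sum convex_convex_hull) (auto intro: hull_inc)
  qed
  have "p \<in> F"
    unfolding p_def V(2) using V(1) m
    by (intro convex_sum convex_convex_hull) (auto intro: hull_inc simp: m_def)
  show ?thesis
  proof (cases "x = p")
    case False
    \<comment> \<open>Solves q = (1 + \<epsilon>) p - \<epsilon> x for p as a point of the segment
      from x to q.\<close>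
    define t where "t = 1 / (1 + \<epsilon>)"
    have t: "0 < t" "t < 1" "t * (1 + \<epsilon>) = 1" using \<epsilon> by (auto simp: t_def)
    have t': "1 - t - t * \<epsilon> = 0" using t(3) by (simp add: algebra_simps)
    have "(1 - t) *\<^sub>R x + t *\<^sub>R q = (1 - t - t * \<epsilon>) *\<^sub>R x + (t * (1 + \<epsilon>)) *\<^sub>R p"
      unfolding q_eq by (simp add: algebra_simps)
    then have p_eq: "p = (1 - t) *\<^sub>R x + t *\<^sub>R q" using t(3) t' by simp
    moreover have "x \<noteq> q"
    proof
      assume "x = q"
      then have "p = x" using p_eq by (simp flip: scaleR_add_left)
      then show False using False by simp
    qed
    ultimately have "p \<in> open_segment x q" unfolding in_segment using t by blast
    moreover have "q \<in> convex hull K" using \<open>q \<in> F\<close> F by (auto simp: face_of_def)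
    ultimately show ?thesis using F x(1) \<open>p \<in> F\<close> unfolding face_of_def by blast
  qed (use \<open>p \<in> F\<close> in simp)
qed

section \<open>Facets and their index sets for arbitrary configurations\<close>

context
  fixes n d :: nat and X :: "nat \<Rightarrow> nat \<Rightarrow> real"
  assumes E: "\<And>i. i < n \<Longrightarrow> X i \<in> Eucl d" and d1: "d \<ge> 1"
begin

text \<open>By \<open>supported_hull_Int\<close> the hull of the exposed points is the whole
  intersection of the polytope with its supporting hyperplane, hence a face; the independent
  d-subset spans that hyperplane. The second claim recovers \<open>J\<close> from the hull and makes
  the correspondence injective.\<close>

lemma index_set_facet:
  assumes J: "J \<subseteq> {..<n}" and ex: "facet_index_set n d a b J X"
  shows "convex hull (X ` J) \<in> facets_with_height d (random_polytope n X) a b"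
    and "J = {j \<in> {..<n}. X j \<in> convex hull (X ` J)}"
proof -
  obtain u h where u: "u \<in> topspace (nsphere (d - 1))" "inner_upto d u u = 1" and h: "h \<in> {a..b}"
    and eq: "\<And>i. i \<in> J \<Longrightarrow> inner_upto d (X i) u = h" and lt: "\<And>j. j \<in> {..<n} - J \<Longrightarrow> inner_upto d (X j) u < h"
    using ex nsphere_iff[OF d1] unfolding facet_index_set_def exposes_def by blast
  obtain I where I: "I \<subseteq> J" "card I = d" "aff_indep d I X"
    using ex unfolding facet_index_set_def by blast
  have "finite J" using finite_subset[OF J] by simp
  then have fin: "finite J" "finite I" using finite_subset[OF I(1)] by simp_all
  have le: "inner_upto d (X j) u \<le> h" if "j < n" for j
    using eq[of j] lt[of j] that by (cases "j \<in> J") auto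
  have EI: "\<And>i. i \<in> I \<Longrightarrow> X i \<in> Eucl d" using E I J by auto
  let ?P = "random_polytope n X" and ?F = "convex hull (X ` J)"
  have hypI: "affine hull (X ` I) = hyperplane d u h"
    by (rule hyperplane_eq_hull[OF fin(2) I(2,3) EI u(2) eq]) (use I in auto)
  have aff: "affine hull ?F = hyperplane d u h"
  proof
    have "affine hull (X ` J) \<subseteq> Eucl d" using E J by (intro hull_minimal affine_Eucl) auto
    then show "affine hull ?F \<subseteq> hyperplane d u h"
      using inner_eq_affine_hull[of "X ` J" d u h] eq by (auto simp: hyperplane_def)
    show "hyperplane d u h \<subseteq> affine hull ?F"
      unfolding hypI[symmetric] affine_hull_convex_hull using I by (intro hull_mono) auto
  qed
  have P_le: "inner_upto d x u \<le> h" if "x \<in> ?P" for x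
    using inner_le_hull[of "{..<n}" d X u h x] le that by (auto simp: random_polytope_def)
  have F_eq: "inner_upto d x u = h" if "x \<in> ?F" for x
    using aff hull_subset[of ?F affine] that by (auto simp: hyperplane_def)
  have F_sub: "?F \<subseteq> ?P" unfolding random_polytope_def using J by (intro hull_mono) auto
  have J_eq: "{j \<in> {..<n}. inner_upto d (X j) u = h} = J"
    using eq lt J by force
  have F_mem: "x \<in> ?F" if "x \<in> ?P" "inner_upto d x u = h" for x
    using supported_hull_Int[of "{..<n}" d X u h x] le that unfolding J_eq by (auto simp: random_polytope_def)
  have "j \<in> J" if "j < n" "X j \<in> ?F" for j using F_eq[OF that(2)] J_eq that(1) by auto
  then show "J = {j \<in> {..<n}. X j \<in> ?F}" using J by (auto intro: hull_inc)
  have "?F face_of ?P"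
    unfolding face_of_def
  proof (intro conjI ballI impI F_sub convex_convex_hull)
    fix p q x assume pq: "p \<in> ?P" "q \<in> ?P" and x: "x \<in> ?F" "x \<in> open_segment p q"
    obtain t where t: "0 < t" "t < 1" "x = (1 - t) *\<^sub>R p + t *\<^sub>R q"
      using x(2) by (auto simp: in_segment)
    have "h = (1 - t) * inner_upto d p u + t * inner_upto d q u"
      using F_eq[OF x(1)] unfolding t(3) by (simp add: inner_upto_add inner_upto_scaleR)
    then have s: "(1 - t) * (h - inner_upto d p u) + t * (h - inner_upto d q u) = 0"
      by (simp add: algebra_simps)
    have n1: "(1 - t) * (h - inner_upto d p u) \<ge> 0" and n2: "t * (h - inner_upto d q u) \<ge> 0"
      using P_le pq t by (auto intro!: mult_nonneg_nonneg)
    have "(1 - t) * (h - inner_upto d p u) = 0" "t * (h - inner_upto d q u) = 0"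
      using s n1 n2 by linarith+
    then have "inner_upto d p u = h" "inner_upto d q u = h" using t by auto
    then show "p \<in> ?F" "q \<in> ?F" using F_mem pq by auto
  qed
  moreover have "has_aff_dim ?F (int d - 1)"
    unfolding has_aff_dim_def
  proof (intro exI conjI)
    show "affine hull (X ` I) = affine hull ?F" using hypI aff by simp
    show "\<not> affine_dependent (X ` I)" by (rule aff_indep_inj(2)[OF fin(2) EI I(3)])
    show "int (card (X ` I)) = int d - 1 + 1"
      using aff_indep_inj(1)[OF fin(2) EI I(3)] I by (simp add: card_image)
  qed (use fin in simp)
  moreover have "facet_has_height d ?P ?F h"
    unfolding facet_has_height_def using u aff P_le by blast
  ultimately show "?F \<in> facets_with_height d ?P a b" using h by (auto simp: facets_with_height_def is_facet_def)
qed

text \<open>\<open>J\<close> collects all points on the supporting hyperplane. They belong to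
  \<open>F\<close> because a face contains every point of the polytope in its affine hull. An
  affinely independent subset of \<open>J\<close> of largest size spans the hyperplane and so has at
  least d elements.\<close>

lemma facet_has_index_set:
  assumes "F \<in> facets_with_height d (random_polytope n X) a b"
  shows "\<exists>J\<subseteq>{..<n}. facet_index_set n d a b J X \<and> F = convex hull (X ` J)"
proof -
  let ?P = "random_polytope n X" and ?K = "X ` {..<n}"
  obtain h u where F: "F face_of convex hull ?K" and h: "h \<in> {a..b}"
    and u: "u \<in> topspace (nsphere (d - 1))" and aff: "affine hull F = hyperplane d u h"
    and le: "\<And>x. x \<in> ?P \<Longrightarrow> inner_upto d x u \<le> h"
    using assms unfolding facets_with_height_def is_facet_def facet_has_height_def random_polytope_def by blast
  have u': "inner_upto d u u = 1" "u \<in> Eucl d" using u nsphere_iff[OF d1] by auto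
  have X_P: "X j \<in> ?P" if "j < n" for j using that by (auto simp: random_polytope_def intro: hull_inc)
  have F_P: "F \<subseteq> ?P" using F by (simp add: face_of_def random_polytope_def)
  have F_eq: "inner_upto d x u = h" if "x \<in> F" for x
    using aff hull_subset[of F affine] that by (auto simp: hyperplane_def)
  define J where "J = {j \<in> {..<n}. inner_upto d (X j) u = h}"
  have J: "J \<subseteq> {..<n}" "finite J" by (auto simp: J_def)
  have EJ: "\<And>i. i \<in> J \<Longrightarrow> X i \<in> Eucl d" using E J by auto
  have "F \<subseteq> convex hull (X ` J)"
    using supported_hull_Int[of "{..<n}" d X u h] le[OF X_P] F_P F_eq
    unfolding J_def random_polytope_def by blast
  moreover have "X ` J \<subseteq> F"
  proof
    fix x assume "x \<in> X ` J"
    then obtain j where j: "j \<in> J" "x = X j" by auto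
    show "x \<in> F"
    proof (rule face_Int_affine_hull[OF _ F])
      show "x \<in> convex hull ?K" using j X_P by (auto simp: J_def random_polytope_def)
      show "x \<in> affine hull F" unfolding aff hyperplane_def using j EJ by (auto simp: J_def)
    qed simp
  qed
  then have "convex hull (X ` J) \<subseteq> F" using F by (intro hull_minimal) (auto simp: face_of_def)
  ultimately have FJ: "F = convex hull (X ` J)" by auto
  let ?Q = "\<lambda>I. I \<subseteq> J \<and> aff_indep d I X"
  have "?Q {}" by (simp add: aff_indep_def lin_indep_def)
  moreover have "\<forall>I. ?Q I \<longrightarrow> card I < Suc (card J)" using J by (simp add: card_mono less_Suc_eq_le)
  ultimately obtain I where I: "?Q I" "\<And>I'. ?Q I' \<Longrightarrow> card I' \<le> card I"
    using ex_has_greatest_nat[of ?Q "{}" card "Suc (card J)"] by blast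
  have fI: "finite I" by (rule finite_subset[OF conjunct1[OF I(1)] J(2)])
  have "X ` J \<subseteq> affine hull (X ` I)"
  proof
    fix x assume "x \<in> X ` J"
    then obtain j where j: "j \<in> J" "x = X j" by auto
    show "x \<in> affine hull (X ` I)"
    proof (cases "j \<in> I")
      case False
      have "\<not> aff_indep d (insert j I) X"
        using I(2)[of "insert j I"] I(1) j(1) False fI by auto
      then show ?thesis unfolding j(2)
        by (rule aff_indep_extend[OF fI False conjunct2[OF I(1)]]) (use EJ I j in auto)
    qed (use j in \<open>auto intro: hull_inc\<close>)
  qed
  then have "affine hull (X ` J) \<subseteq> affine hull (X ` I)" by (intro hull_minimal) auto
  then have "hyperplane d u h \<subseteq> affine hull (X ` I)" using aff FJ by simp
  then have "d \<le> card I"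
    using EJ I by (intro hyperplane_sub_hull_card[OF fI _ u']) auto
  then obtain I' where I': "I' \<subseteq> I" "card I' = d" by (metis obtain_subset_with_card_n)
  have "aff_indep d I' X" using aff_indep_subset[OF conjunct2[OF I(1)] I'(1) fI] .
  moreover have "exposes n d a b J X"
    unfolding exposes_def
  proof (intro exI conjI)
    show "\<forall>j\<in>{..<n} - J. inner_upto d (X j) u < h"
      using le[OF X_P] by (auto simp: J_def order_less_le)
  qed (use u h in \<open>auto simp: J_def\<close>)
  ultimately have "facet_index_set n d a b J X"
    unfolding facet_index_set_def using I I' by blast
  then show ?thesis using J FJ by blast
qed

text \<open>Replaces random sets of points by fixed index sets, of which there are finitely many,
  each with a measurable event.\<close>

lemma card_facets_eq:
  "card (facets_with_height d (random_polytope n X) a b) =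
   card {J. J \<subseteq> {..<n} \<and> facet_index_set n d a b J X}"
proof -
  let ?T = "{J. J \<subseteq> {..<n} \<and> facet_index_set n d a b J X}"
  have "bij_betw (\<lambda>J. convex hull (X ` J)) ?T (facets_with_height d (random_polytope n X) a b)"
  proof (rule bij_betw_imageI)
    show "inj_on (\<lambda>J. convex hull (X ` J)) ?T"
      by (rule inj_onI) (use index_set_facet(2) in blast)
    show "(\<lambda>J. convex hull (X ` J)) ` ?T = facets_with_height d (random_polytope n X) a b"
      using index_set_facet(1) facet_has_index_set by blast
  qed
  from bij_betw_same_card[OF this] show ?thesis by simp
qed

end

text \<open>In general position a hyperplane through d of the points contains no other one. This
  forces \<open>J\<close> to equal its d-subset, and conversely makes the weak inequalities strict
  off \<open>J\<close>.\<close>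

lemma facet_index_set_general_position:
  assumes gp: "general_position n d X" and d1: "d \<ge> 1" and J: "J \<subseteq> {..<n}"
  shows "facet_index_set n d a b J X \<longleftrightarrow> card J = d \<and> supports_at n d a b J X"
proof
  assume F: "facet_index_set n d a b J X"
  obtain u h where u: "u \<in> topspace (nsphere (d - 1))" "inner_upto d u u = 1" and h: "h \<in> {a..b}"
    and eq: "\<And>i. i \<in> J \<Longrightarrow> inner_upto d (X i) u = h" and lt: "\<And>j. j \<in> {..<n} - J \<Longrightarrow> inner_upto d (X j) u < h"
    using F nsphere_iff[OF d1] unfolding facet_index_set_def exposes_def by blast
  obtain I where I: "I \<subseteq> J" "card I = d" using F unfolding facet_index_set_def by blast
  have "J \<subseteq> I"
  proof
    fix j assume j: "j \<in> J"
    have eqI: "\<And>i. i \<in> I \<Longrightarrow> inner_upto d (X i) u = h" using eq I by auto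
    show "j \<in> I" using gp_on_hyperplane[OF gp d1 _ I(2) u(2) eqI, of j] eq[OF j] j J I by auto
  qed
  then have "J = I" using I by auto
  moreover have "inner_upto d (X j) u \<le> h" if "j < n" for j
    using eq[of j] lt[of j] that by (cases "j \<in> J") auto
  then have "supports_at n d a b J X" unfolding supports_at_def using u h eq by blast
  ultimately show "card J = d \<and> supports_at n d a b J X" using I by simp
next
  assume A: "card J = d \<and> supports_at n d a b J X"
  then obtain u h where u: "u \<in> topspace (nsphere (d - 1))" "inner_upto d u u = 1" and h: "h \<in> {a..b}"
    and eq: "\<And>i. i \<in> J \<Longrightarrow> inner_upto d (X i) u = h" and le: "\<And>j. j < n \<Longrightarrow> inner_upto d (X j) u \<le> h"
    using nsphere_iff[OF d1] unfolding supports_at_def by blast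
  have "inner_upto d (X j) u < h" if "j \<in> {..<n} - J" for j
    using gp_on_hyperplane[OF gp d1 J _ u(2) eq, of j] le[of j] A that by (auto simp: order_less_le)
  then have "exposes n d a b J X" unfolding exposes_def using u h eq by blast
  moreover have "aff_indep d J X" using gp_lin_indep[OF gp d1 J] A by (auto intro: aff_indep_lift)
  ultimately show "facet_index_set n d a b J X" unfolding facet_index_set_def using A by blast
qed

section \<open>Measurability and general position\<close>

text \<open>By compactness the existential quantifier can be restricted to a countable dense set.\<close>

lemma compact_exists_measurable:
  fixes g :: "'c::{metric_space, second_countable_topology} \<Rightarrow> 'a \<Rightarrow> real"
  assumes C: "compact C" and cont: "\<And>x. x \<in> space M \<Longrightarrow> continuous_on C (\<lambda>c. g c x)"
    and [measurable]: "\<And>c. g c \<in> borel_measurable M"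
  shows "{x \<in> space M. \<exists>c\<in>C. g c x \<le> 0} \<in> sets M"
proof -
  obtain D where D: "countable D" "D \<subseteq> C" "C \<subseteq> closure D" by (rule separable)
  have "(\<exists>c\<in>C. g c x \<le> 0) \<longleftrightarrow> (\<forall>k::nat. \<exists>c\<in>D. g c x < 1 / (real k + 1))" if x: "x \<in> space M" for x
  proof
    assume "\<exists>c\<in>C. g c x \<le> 0"
    then obtain c where c: "c \<in> C" "g c x \<le> 0" by blast
    show "\<forall>k::nat. \<exists>c\<in>D. g c x < 1 / (real k + 1)"
    proof
      fix k :: nat
      obtain A where A: "open A" "A \<inter> C = (\<lambda>c. g c x) -` {..<1 / (real k + 1)} \<inter> C"
        using cont[OF x] open_lessThan unfolding continuous_on_open_invariant by blast
      have "g c x < 1 / (real k + 1)"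
        using c(2) by (rule order_le_less_trans) simp
      then have "c \<in> A" using c A by auto
      then have "D \<inter> A \<noteq> {}"
        using D(3) c(1) A(1) closure_iff_nhds_not_empty[of c D] by blast
      then show "\<exists>c\<in>D. g c x < 1 / (real k + 1)" using A(2) D(2) by blast
    qed
  next
    assume R: "\<forall>k::nat. \<exists>c\<in>D. g c x < 1 / (real k + 1)"
    then have "C \<noteq> {}" using D(2) by blast
    then obtain c where c: "c \<in> C" "\<And>c'. c' \<in> C \<Longrightarrow> g c x \<le> g c' x"
      using continuous_attains_inf[OF C _ cont[OF x]] by blast
    have "g c x \<le> 0"
    proof (rule ccontr)
      assume "\<not> g c x \<le> 0"
      then obtain k :: nat where "1 / (real k + 1) < g c x"
        using reals_Archimedean[of "g c x"] by (auto simp: inverse_eq_divide add.commute)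
      moreover obtain c' where "c' \<in> D" "g c' x < 1 / (real k + 1)" using R by blast
      ultimately show False using c(2)[of c'] D(2) by auto
    qed
    then show "\<exists>c\<in>C. g c x \<le> 0" using c by blast
  qed
  then have "{x \<in> space M. \<exists>c\<in>C. g c x \<le> 0} =
      {x \<in> space M. \<forall>k::nat. \<exists>c\<in>D. g c x < 1 / (real k + 1)}" by auto
  also have "\<dots> \<in> sets M" using D(1) by measurable
  finally show ?thesis .
qed

text \<open>Tychonoff's theorem: sequences carry the product topology, and the box is a product of
  compact intervals that degenerate to 0 outside \<open>J\<close>.\<close>

lemma compact_box: "compact {u :: nat \<Rightarrow> real. (\<forall>i. i \<notin> J \<longrightarrow> u i = 0) \<and> (\<forall>i. \<bar>u i\<bar> \<le> r)}"
proof -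
  let ?S = "\<lambda>i. if i \<in> J then {-r..r} else {-r..r} \<inter> {0::real}"
  have "compactin (product_topology (\<lambda>_. euclidean) UNIV) (PiE UNIV ?S)"
    by (subst compactin_PiE) (auto intro!: disjI2 compact_Int_closed)
  then have "compact (PiE UNIV ?S)" by (simp add: euclidean_product_topology)
  moreover have "PiE UNIV ?S = {u. (\<forall>i. i \<notin> J \<longrightarrow> u i = 0) \<and> (\<forall>i. \<bar>u i\<bar> \<le> r)}"
    by (auto simp: PiE_iff abs_le_iff split: if_splits) (metis neg_le_iff_le minus_le_iff)+
  ultimately show ?thesis by simp
qed

lemma continuous_on_eval: "continuous_on A (\<lambda>u :: nat \<Rightarrow> real. u i)"
  by (rule continuous_on_subset[OF continuous_on_product_coordinates]) simp

lemma continuous_on_inner_upto [continuous_intros]: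
  assumes "continuous_on A f" "continuous_on A g"
  shows "continuous_on A (\<lambda>u. inner_upto d (f u) (g u))"
  unfolding inner_upto_def
  using assms by (intro continuous_on_sum continuous_on_mult) (auto intro: continuous_on_product_then_coordinatewise)

text \<open>Plays two roles: with \<open>J = {..<d}\<close> it is the set of unit normals, and with
  \<open>J\<close> a set of point indices it is the set of normalised coefficient vectors of linear
  relations.\<close>

definition sphere_on :: "nat set \<Rightarrow> (nat \<Rightarrow> real) set" where
  "sphere_on J = {u. (\<forall>i. i \<notin> J \<longrightarrow> u i = 0) \<and> (\<Sum>i\<in>J. (u i)\<^sup>2) = 1}"

lemma compact_sphere_on:
  assumes "finite J" shows "compact (sphere_on J)"
proof -
  have "closed {u :: nat \<Rightarrow> real. (\<Sum>i\<in>J. (u i)\<^sup>2) = 1}"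
    by (intro closed_Collect_eq continuous_intros continuous_on_eval)
  then have "compact ({u :: nat \<Rightarrow> real. (\<forall>i. i \<notin> J \<longrightarrow> u i = 0) \<and> (\<forall>i. \<bar>u i\<bar> \<le> 1)} \<inter>
      {u. (\<Sum>i\<in>J. (u i)\<^sup>2) = 1})"
    using compact_box by (intro compact_Int_closed)
  moreover have "\<bar>u i\<bar> \<le> 1" if u: "u \<in> sphere_on J" for u i
  proof (cases "i \<in> J")
    case True
    have "(u i)\<^sup>2 \<le> (\<Sum>i\<in>J. (u i)\<^sup>2)" using assms True by (intro member_le_sum) auto
    then show ?thesis using u by (simp add: sphere_on_def abs_square_le_1)
  next
    case False
    then show ?thesis using u by (simp add: sphere_on_def)
  qed
  then have "{u :: nat \<Rightarrow> real. (\<forall>i. i \<notin> J \<longrightarrow> u i = 0) \<and> (\<forall>i. \<bar>u i\<bar> \<le> 1)} \<inter>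
      {u. (\<Sum>i\<in>J. (u i)\<^sup>2) = 1} = sphere_on J"
    by (auto simp: sphere_on_def)
  ultimately show ?thesis by simp
qed

lemma nsphere_eq_sphere_on: "d \<ge> 1 \<Longrightarrow> topspace (nsphere (d - 1)) = sphere_on {..<d}"
  by (rule set_eqI, subst nsphere_iff)
    (auto simp: sphere_on_def Eucl_iff inner_upto_def power2_eq_square not_less)

section \<open>Measurability of the geometric events\<close>

abbreviation points :: "nat \<Rightarrow> nat set \<Rightarrow> (nat \<Rightarrow> nat \<Rightarrow> real) measure" where
  "points d A \<equiv> Pi\<^sub>M A (\<lambda>_. uniform_sphere d)"

lemma points_coordinate_measurable:
  assumes "i \<in> A" shows "(\<lambda>X. X i k) \<in> borel_measurable (points d A)"
  using measurable_compose[OF measurable_component_singleton[OF assms] uniform_sphere_coordinate_measurable] .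

lemma points_inner_measurable:
  assumes "i \<in> A" shows "(\<lambda>X. inner_upto d (X i) u) \<in> borel_measurable (points d A)"
  using points_coordinate_measurable[OF assms] by (intro inner_upto_measurable) auto

lemma points_Eucl: "X \<in> space (points d A) \<Longrightarrow> i \<in> A \<Longrightarrow> X i \<in> Eucl d"
  by (auto simp: space_PiM)

text \<open>A nontrivial relation can be scaled to have its coefficients on the unit sphere.
  Dependence then means that a nonnegative continuous function has a zero on a compact set. The
  family \<open>Y\<close> covers both the points and their lifts.\<close>

lemma lin_indep_measurable_general:
  fixes J :: "nat set"
  assumes "finite J" and meas: "\<And>i k. i \<in> J \<Longrightarrow> k < d \<Longrightarrow> (\<lambda>X. Y X i k) \<in> borel_measurable M"
  shows "{X \<in> space M. \<not> lin_indep d J (Y X)} \<in> sets M"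
proof -
  have eq: "\<not> lin_indep d J X \<longleftrightarrow> (\<exists>c\<in>sphere_on J. (\<Sum>k<d. \<bar>\<Sum>i\<in>J. c i * X i k\<bar>) \<le> 0)" (is "_ \<longleftrightarrow> ?R") for X
  proof -
    have z: "(\<Sum>k<d. \<bar>\<Sum>i\<in>J. c i * X i k\<bar>) \<le> 0 \<longleftrightarrow> (\<forall>k<d. (\<Sum>i\<in>J. c i * X i k) = 0)" for c
    proof -
      have "(\<Sum>k<d. \<bar>\<Sum>i\<in>J. c i * X i k\<bar>) \<ge> 0" by (intro sum_nonneg) auto
      then have "(\<Sum>k<d. \<bar>\<Sum>i\<in>J. c i * X i k\<bar>) \<le> 0 \<longleftrightarrow> (\<Sum>k<d. \<bar>\<Sum>i\<in>J. c i * X i k\<bar>) = 0" by linarith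
      also have "\<dots> \<longleftrightarrow> (\<forall>k<d. (\<Sum>i\<in>J. c i * X i k) = 0)" by (subst sum_nonneg_eq_0_iff) auto
      finally show ?thesis .
    qed
    show ?thesis
    proof
      assume "\<not> lin_indep d J X"
      then obtain c j where c: "\<And>k. k < d \<Longrightarrow> (\<Sum>i\<in>J. c i * X i k) = 0" and j: "j \<in> J" "c j \<noteq> 0"
        unfolding lin_indep_def by blast
      define r where "r = sqrt (\<Sum>i\<in>J. (c i)\<^sup>2)"
      have "(\<Sum>i\<in>J. (c i)\<^sup>2) > 0"
        using assms(1) j by (intro sum_pos2[of J j]) auto
      then have r: "r > 0" "r\<^sup>2 = (\<Sum>i\<in>J. (c i)\<^sup>2)" by (auto simp: r_def)
      let ?c = "\<lambda>i. if i \<in> J then c i / r else 0"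
      have "(\<Sum>i\<in>J. ?c i * X i k) = (\<Sum>i\<in>J. c i * X i k) / r" for k
        by (simp add: sum_divide_distrib)
      moreover have "?c \<in> sphere_on J"
      proof -
        have "(\<Sum>i\<in>J. (?c i)\<^sup>2) = (\<Sum>i\<in>J. (c i)\<^sup>2) / r\<^sup>2" by (simp add: power_divide sum_divide_distrib)
        also have "\<dots> = 1" unfolding r(2)[symmetric] using r(1) by simp
        finally show ?thesis by (simp add: sphere_on_def)
      qed
      ultimately show ?R using c z by (intro bexI[of _ ?c]) auto
    next
      assume ?R
      then obtain c where c: "c \<in> sphere_on J" "\<forall>k<d. (\<Sum>i\<in>J. c i * X i k) = 0" using z by blast
      have "\<not> (\<forall>i\<in>J. c i = 0)"
      proof
        assume "\<forall>i\<in>J. c i = 0"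
        then have "(\<Sum>i\<in>J. (c i)\<^sup>2) = 0" by simp
        then show False using c(1) by (simp add: sphere_on_def)
      qed
      then show "\<not> lin_indep d J X" using c(2) unfolding lin_indep_def by blast
    qed
  qed
  show ?thesis unfolding eq
  proof (rule compact_exists_measurable[OF compact_sphere_on[OF assms(1)]])
    show "continuous_on (sphere_on J) (\<lambda>c. \<Sum>k<d. \<bar>\<Sum>i\<in>J. c i * Y X i k\<bar>)" for X
      by (intro continuous_intros continuous_on_eval)
    show "(\<lambda>X. \<Sum>k<d. \<bar>\<Sum>i\<in>J. c i * Y X i k\<bar>) \<in> borel_measurable M" for c
      using meas by (intro borel_measurable_sum borel_measurable_abs borel_measurable_times
          borel_measurable_const) auto
  qed
qed

lemma lin_indep_measurable:
  assumes "finite J" "J \<subseteq> A"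
  shows "{X \<in> space (points d A). \<not> lin_indep d J X} \<in> sets (points d A)"
  using assms by (intro lin_indep_measurable_general points_coordinate_measurable) auto

lemma aff_indep_measurable:
  assumes "finite J" "J \<subseteq> A"
  shows "{X \<in> space (points d A). aff_indep d J X} \<in> sets (points d A)"
proof -
  have "{X \<in> space (points d A). \<not> aff_indep d J X} \<in> sets (points d A)"
    unfolding aff_indep_def
  proof (rule lin_indep_measurable_general[OF assms(1)])
    fix i k assume "i \<in> J"
    then show "(\<lambda>X. ((X i)(d := 1)) k) \<in> borel_measurable (points d A)"
      using assms(2) by (cases "k = d") (auto intro: points_coordinate_measurable)
  qed
  moreover have "{X \<in> space (points d A). aff_indep d J X} =
      space (points d A) - {X \<in> space (points d A). \<not> aff_indep d J X}" by auto
  ultimately show ?thesis by auto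
qed

text \<open>The length of the normal is not bounded in advance, so compactness is used in boxes of
  integer size and the events are united.\<close>

lemma coplanar_measurable:
  assumes "finite K" "K \<subseteq> A"
  shows "{X \<in> space (points d A). \<exists>v. \<forall>i\<in>K. inner_upto d (X i) v = 1} \<in> sets (points d A)"
proof -
  let ?B = "\<lambda>r::nat. {u :: nat \<Rightarrow> real. (\<forall>i. i \<notin> {..<d} \<longrightarrow> u i = 0) \<and> (\<forall>i. \<bar>u i\<bar> \<le> real r)}"
  let ?g = "\<lambda>v X. \<Sum>i\<in>K. \<bar>inner_upto d (X i) v - 1\<bar>"
  have eq: "(\<exists>v. \<forall>i\<in>K. inner_upto d (X i) v = 1) \<longleftrightarrow> (\<exists>r. \<exists>v\<in>?B r. ?g v X \<le> 0)" for X
  proof -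
    have z: "?g v X \<le> 0 \<longleftrightarrow> (\<forall>i\<in>K. inner_upto d (X i) v = 1)" for v
    proof -
      have "?g v X \<ge> 0" by (intro sum_nonneg) auto
      then have "?g v X \<le> 0 \<longleftrightarrow> ?g v X = 0" by linarith
      also have "\<dots> \<longleftrightarrow> (\<forall>i\<in>K. inner_upto d (X i) v = 1)"
        using assms(1) by (subst sum_nonneg_eq_0_iff) auto
      finally show ?thesis .
    qed
    have "\<exists>r. \<exists>v'\<in>?B r. \<forall>i\<in>K. inner_upto d (X i) v' = 1" if v: "\<forall>i\<in>K. inner_upto d (X i) v = 1" for v
    proof -
      let ?v = "\<lambda>i. if i < d then v i else 0"
      obtain r where r: "(\<Sum>i<d. \<bar>v i\<bar>) \<le> real r" using real_arch_simple by blast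
      have "\<bar>v i\<bar> \<le> real r" if "i < d" for i
        using r member_le_sum[of i "{..<d}" "\<lambda>i. \<bar>v i\<bar>"] that by simp
      then have "?v \<in> ?B r" by auto
      moreover have "\<forall>i\<in>K. inner_upto d (X i) ?v = 1" using v by (simp cong: inner_upto_cong)
      ultimately show ?thesis by blast
    qed
    then show ?thesis unfolding z by blast
  qed
  have "{X \<in> space (points d A). \<exists>v\<in>?B r. ?g v X \<le> 0} \<in> sets (points d A)" for r
  proof (rule compact_exists_measurable[OF compact_box])
    show "continuous_on (?B r) (\<lambda>v. ?g v X)" for X
      by (intro continuous_intros)
    show "?g v \<in> borel_measurable (points d A)" for v
      using assms(2) by (intro borel_measurable_sum borel_measurable_abs borel_measurable_diff
          borel_measurable_const points_inner_measurable) auto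
  qed
  then have "(\<Union>r. {X \<in> space (points d A). \<exists>v\<in>?B r. ?g v X \<le> 0}) \<in> sets (points d A)" by blast
  moreover have "{X \<in> space (points d A). \<exists>v. \<forall>i\<in>K. inner_upto d (X i) v = 1} =
      (\<Union>r. {X \<in> space (points d A). \<exists>v\<in>?B r. ?g v X \<le> 0})" unfolding eq by auto
  ultimately show ?thesis by (simp only:)
qed

text \<open>The margin \<open>t\<close> serves two events: t = 0 gives the weak inequalities of
  \<open>supports_at\<close>, positive margins exhaust the strict ones of
  \<open>exposes\<close>.\<close>

lemma support_measurable:
  assumes J: "J \<subseteq> {..<n}" and K: "K \<subseteq> {..<n}"
  shows "{X \<in> space (points d {..<n}). \<exists>u h. u \<in> sphere_on {..<d} \<and> h \<in> {a..b} \<and>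
    (\<forall>i\<in>J. inner_upto d (X i) u = h) \<and> (\<forall>j\<in>K. inner_upto d (X j) u \<le> h - t)} \<in> sets (points d {..<n})"
proof -
  have fin: "finite J" "finite K" using finite_subset[OF J] finite_subset[OF K] by simp_all
  let ?g = "\<lambda>(u, h) X. (\<Sum>i\<in>J. \<bar>inner_upto d (X i) u - h\<bar>) + (\<Sum>j\<in>K. max 0 (inner_upto d (X j) u - h + t))"
  have z: "?g (u, h) X \<le> 0 \<longleftrightarrow> (\<forall>i\<in>J. inner_upto d (X i) u = h) \<and> (\<forall>j\<in>K. inner_upto d (X j) u \<le> h - t)" for u h X
  proof -
    have "(\<Sum>i\<in>J. \<bar>inner_upto d (X i) u - h\<bar>) \<ge> 0" "(\<Sum>j\<in>K. max 0 (inner_upto d (X j) u - h + t)) \<ge> 0"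
      by (intro sum_nonneg; simp)+
    then have "?g (u, h) X \<le> 0 \<longleftrightarrow> (\<Sum>i\<in>J. \<bar>inner_upto d (X i) u - h\<bar>) = 0 \<and>
        (\<Sum>j\<in>K. max 0 (inner_upto d (X j) u - h + t)) = 0"
      unfolding prod.case by linarith
    also have "(\<Sum>i\<in>J. \<bar>inner_upto d (X i) u - h\<bar>) = 0 \<longleftrightarrow> (\<forall>i\<in>J. inner_upto d (X i) u = h)"
      using fin by (subst sum_nonneg_eq_0_iff) auto
    also have "(\<Sum>j\<in>K. max 0 (inner_upto d (X j) u - h + t)) = 0 \<longleftrightarrow> (\<forall>j\<in>K. inner_upto d (X j) u \<le> h - t)"
    proof -
      have "max 0 (y - h + t) = 0 \<longleftrightarrow> y \<le> h - t" for y :: real by (auto simp: max_def)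
      then show ?thesis using fin by (subst sum_nonneg_eq_0_iff) auto
    qed
    finally show ?thesis .
  qed
  have ex: "(\<exists>c\<in>A \<times> B. R c) \<longleftrightarrow> (\<exists>u h. u \<in> A \<and> h \<in> B \<and> R (u, h))"
    for A :: "(nat \<Rightarrow> real) set" and B :: "real set" and R by auto
  have "{X \<in> space (points d {..<n}). \<exists>c \<in> sphere_on {..<d} \<times> {a..b}. ?g c X \<le> 0} \<in> sets (points d {..<n})"
  proof (rule compact_exists_measurable)
    show "compact (sphere_on {..<d} \<times> {a..b})"
      by (intro compact_Times compact_sphere_on) auto
    show "continuous_on (sphere_on {..<d} \<times> {a..b}) (\<lambda>c. ?g c X)" for X
      unfolding split_beta by (intro continuous_intros)
    fix c :: "(nat \<Rightarrow> real) \<times> real"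
    show "?g c \<in> borel_measurable (points d {..<n})"
      unfolding split_beta
      using J K by (intro borel_measurable_sum borel_measurable_add borel_measurable_abs borel_measurable_diff
          borel_measurable_max borel_measurable_const points_inner_measurable) auto
  qed
  then show ?thesis unfolding ex[where R = "\<lambda>c. ?g c _ \<le> 0"] z .
qed

lemma supports_at_measurable:
  assumes I: "I \<subseteq> {..<n}" and d: "d \<ge> 1"
  shows "{X \<in> space (points d {..<n}). supports_at n d a b I X} \<in> sets (points d {..<n})"
  using support_measurable[OF I, of "{..<n}" d a b 0]
  by (simp add: supports_at_def nsphere_eq_sphere_on[OF d, simplified] Ball_def)

text \<open>Finitely many strict inequalities hold with a common margin 1/(m + 1), so the event is a
  countable union of events with weak inequalities.\<close>

lemma exposes_measurable:
  assumes J: "J \<subseteq> {..<n}" and d: "d \<ge> 1"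
  shows "{X \<in> space (points d {..<n}). exposes n d a b J X} \<in> sets (points d {..<n})"
proof -
  let ?E = "\<lambda>m::nat. {X \<in> space (points d {..<n}). \<exists>u h. u \<in> sphere_on {..<d} \<and> h \<in> {a..b} \<and>
    (\<forall>i\<in>J. inner_upto d (X i) u = h) \<and> (\<forall>j\<in>{..<n} - J. inner_upto d (X j) u \<le> h - 1 / (real m + 1))}"
  have "exposes n d a b J X \<longleftrightarrow> (\<exists>m::nat. \<exists>u h. u \<in> sphere_on {..<d} \<and> h \<in> {a..b} \<and>
    (\<forall>i\<in>J. inner_upto d (X i) u = h) \<and> (\<forall>j\<in>{..<n} - J. inner_upto d (X j) u \<le> h - 1 / (real m + 1)))"
    (is "_ \<longleftrightarrow> ?R") for X
  proof
    assume "exposes n d a b J X"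
    then obtain u h where u: "u \<in> sphere_on {..<d}" "h \<in> {a..b}" "\<forall>i\<in>J. inner_upto d (X i) u = h"
      and lt: "\<And>j. j \<in> {..<n} - J \<Longrightarrow> inner_upto d (X j) u < h"
      unfolding exposes_def nsphere_eq_sphere_on[OF d] by blast
    \<comment> \<open>The number 1 is inserted because there may be no point off the hyperplane, and
      the minimum needs a nonempty set.\<close>
    let ?D = "insert 1 ((\<lambda>j. h - inner_upto d (X j) u) ` ({..<n} - J))"
    have "Min ?D > 0" using lt by (subst Min_gr_iff) auto
    then obtain m :: nat where m: "1 / (real m + 1) < Min ?D"
      using reals_Archimedean[of "Min ?D"] by (auto simp: inverse_eq_divide add.commute)
    have "inner_upto d (X j) u \<le> h - 1 / (real m + 1)" if "j \<in> {..<n} - J" for j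
    proof -
      have "Min ?D \<le> h - inner_upto d (X j) u" using that by (intro Min_le) auto
      then show ?thesis using m by linarith
    qed
    then show ?R using u by blast
  next
    assume ?R
    then obtain m :: nat and u h where u: "u \<in> sphere_on {..<d}" "h \<in> {a..b}" "\<forall>i\<in>J. inner_upto d (X i) u = h"
      and le: "\<And>j. j \<in> {..<n} - J \<Longrightarrow> inner_upto d (X j) u \<le> h - 1 / (real m + 1)" by blast
    have "inner_upto d (X j) u < h" if "j \<in> {..<n} - J" for j
    proof -
      have "1 / (real m + 1) > 0" by simp
      then show ?thesis using le[OF that] by linarith
    qed
    then show "exposes n d a b J X" using u unfolding exposes_def nsphere_eq_sphere_on[OF d] by blast
  qed
  then have "{X \<in> space (points d {..<n}). exposes n d a b J X} = (\<Union>m. ?E m)" by auto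
  moreover have "(\<Union>m. ?E m) \<in> sets (points d {..<n})"
    using support_measurable[OF J, of "{..<n} - J"] by blast
  ultimately show ?thesis by (simp only:)
qed

lemma facet_index_set_measurable:
  assumes J: "J \<subseteq> {..<n}" and d: "d \<ge> 1"
  shows "{X \<in> space (points d {..<n}). facet_index_set n d a b J X} \<in> sets (points d {..<n})"
proof -
  have fin: "finite J" using finite_subset[OF J] by simp
  have "{X \<in> space (points d {..<n}). aff_indep d I X} \<in> sets (points d {..<n})" if "I \<subseteq> J" for I
    using that J finite_subset[OF that fin] by (intro aff_indep_measurable) auto
  then have "(\<Union>I\<in>{I. I \<subseteq> J \<and> card I = d}. {X \<in> space (points d {..<n}). aff_indep d I X}) \<in> sets (points d {..<n})"
    using fin by (intro sets.finite_UN) auto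
  then have "{X \<in> space (points d {..<n}). exposes n d a b J X} \<inter>
      (\<Union>I\<in>{I. I \<subseteq> J \<and> card I = d}. {X \<in> space (points d {..<n}). aff_indep d I X}) \<in> sets (points d {..<n})"
    by (rule sets.Int[OF exposes_measurable[OF J d]])
  moreover have "{X \<in> space (points d {..<n}). facet_index_set n d a b J X} =
      {X \<in> space (points d {..<n}). exposes n d a b J X} \<inter>
      (\<Union>I\<in>{I. I \<subseteq> J \<and> card I = d}. {X \<in> space (points d {..<n}). aff_indep d I X})"
    unfolding facet_index_set_def by auto
  ultimately show ?thesis by (simp only:)
qed

section \<open>Almost sure general position\<close>

lemma points_product_prob_space:
  assumes "d \<ge> 1" shows "product_prob_space (\<lambda>_ :: nat. uniform_sphere d)"
proof -
  interpret prob_space "uniform_sphere d" using prob_space_uniform_sphere[OF assms] .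
  show ?thesis by standard
qed

text \<open>Fubini's theorem with point \<open>j\<close> integrated first: \<open>P\<close> concerns
  the other points and holds almost surely, and for each such choice the values of point
  \<open>j\<close> that produce \<open>Q\<close> form a null set.\<close>

lemma AE_points_coordinate:
  assumes d: "d \<ge> 1" and A: "finite A" "j \<in> A"
    and P_AE: "AE X in points d A. P X" and P_sets: "{X \<in> space (points d A). P X} \<in> sets (points d A)"
    and P_indep: "\<And>X y. P (X(j := y)) \<longleftrightarrow> P X"
    and Q: "{X \<in> space (points d A). Q X} \<in> sets (points d A)"
    and null: "\<And>X. X \<in> space (points d A) \<Longrightarrow> P X \<Longrightarrow> AE y in uniform_sphere d. \<not> Q (X(j := y))"
  shows "AE X in points d A. \<not> Q X"
proof -
  interpret product_prob_space "\<lambda>_ :: nat. uniform_sphere d" using points_product_prob_space[OF d] .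
  let ?Q = "{X \<in> space (points d A). P X \<and> Q X}"
  have eqA: "insert j (A - {j}) = A" using A by auto
  have "?Q = {X \<in> space (points d A). P X} \<inter> {X \<in> space (points d A). Q X}" by auto
  then have Q': "?Q \<in> sets (points d A)" using sets.Int[OF P_sets Q] by (simp only:)
  \<comment> \<open>An arbitrary value at \<open>j\<close> completes a configuration of the other
    points, so that \<open>null\<close> can be applied; it is overwritten by the variable of
    integration.\<close>
  obtain y0 where y0: "y0 \<in> space (uniform_sphere d)" using prob_space.not_empty[OF prob_space_uniform_sphere[OF d]] by blast
  have "emeasure (points d A) ?Q = (\<integral>\<^sup>+X. indicator ?Q X \<partial>points d A)" using Q' by simp
  also have "\<dots> = (\<integral>\<^sup>+X. (\<integral>\<^sup>+y. indicator ?Q (X(j := y)) \<partial>uniform_sphere d) \<partial>points d (A - {j}))"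
    using product_nn_integral_insert[of "A - {j}" j "indicator ?Q"] A Q' unfolding eqA by simp
  also have "\<dots> = (\<integral>\<^sup>+X. 0 \<partial>points d (A - {j}))"
  proof (rule nn_integral_cong)
    fix X assume X: "X \<in> space (points d (A - {j}))"
    have upd: "X(j := y) \<in> space (points d A)" if "y \<in> space (uniform_sphere d)" for y
      using X that A by (auto simp: space_PiM PiE_iff extensional_def)
    have "AE y in uniform_sphere d. X(j := y) \<notin> ?Q"
    proof (cases "P X")
      case True
      then show ?thesis using null[OF upd[OF y0]] P_indep[of X y0] by auto
    next
      case False
      then show ?thesis using P_indep by auto
    qed
    then show "(\<integral>\<^sup>+y. indicator ?Q (X(j := y)) \<partial>uniform_sphere d) = 0"
      by (subst nn_integral_cong_AE[of _ "\<lambda>_. 0"]) (auto elim!: eventually_mono)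
  qed
  finally have "?Q \<in> null_sets (points d A)" using Q' by (auto simp: null_sets_def)
  then have "AE X in points d A. X \<notin> ?Q" by (rule AE_not_in)
  then show ?thesis using P_AE AE_space[of "points d A"] by eventually_elim auto
qed


text \<open>Points are added one at a time. Fewer than d points admit a nonzero \<open>w\<close>
  orthogonal to all of them, and the next point is almost surely not orthogonal to \<open>w\<close>.
  Pairing a relation with \<open>w\<close> then isolates the coefficient of the new point.\<close>

lemma AE_lin_indep:
  assumes d: "d \<ge> 2" and A: "finite A" and J: "J \<subseteq> A" "card J \<le> d"
  shows "AE X in points d A. lin_indep d J X"
proof -
  have "finite J" using A J finite_subset by blast
  then show ?thesis using J
  proof (induction J)
    case empty
    then show ?case by (simp add: lin_indep_def)
  next
    case (insert j J)
    have IH: "AE X in points d A. lin_indep d J X" using insert by simp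
    have "AE X in points d A. \<not> \<not> lin_indep d (insert j J) X"
    proof (rule AE_points_coordinate[OF _ A, where P = "lin_indep d J" and j = j])
      have "{X \<in> space (points d A). lin_indep d J X} =
          space (points d A) - {X \<in> space (points d A). \<not> lin_indep d J X}" by auto
      then show "{X \<in> space (points d A). lin_indep d J X} \<in> sets (points d A)"
        using lin_indep_measurable[of J A d] insert by auto
      show "lin_indep d J (X(j := y)) \<longleftrightarrow> lin_indep d J X" for X y
      proof -
        have "(\<Sum>i\<in>J. c i * (X(j := y)) i k) = (\<Sum>i\<in>J. c i * X i k)" for c k
          using insert.hyps by (intro sum.cong) auto
        then show ?thesis by (simp only: lin_indep_def)
      qed
      show "{X \<in> space (points d A). \<not> lin_indep d (insert j J) X} \<in> sets (points d A)"
        using insert by (intro lin_indep_measurable) auto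
      fix X assume X: "X \<in> space (points d A)" "lin_indep d J X"
      have "card J < d" using insert by simp
      then obtain w where w: "inner_upto d w w > 0" "\<And>i. i \<in> J \<Longrightarrow> inner_upto d (X i) w = 0"
        using exists_orthogonal[OF insert.hyps(1), of d X] points_Eucl[OF X(1)] insert.prems by blast
      have "AE y in uniform_sphere d. y \<notin> {y \<in> space (uniform_sphere d). inner_upto d y w = 0}"
        by (intro AE_not_in sphere_hyperplane_null d w)
      then show "AE y in uniform_sphere d. \<not> \<not> lin_indep d (insert j J) (X(j := y))"
      proof (rule AE_mp, intro AE_I2 impI)
        fix y assume y: "y \<in> space (uniform_sphere d)"
          "y \<notin> {y \<in> space (uniform_sphere d). inner_upto d y w = 0}"
        show "\<not> \<not> lin_indep d (insert j J) (X(j := y))"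
          unfolding not_not lin_indep_def
        proof (intro allI impI)
          fix c assume c: "\<forall>k<d. (\<Sum>i\<in>insert j J. c i * (X(j := y)) i k) = 0"
          have eq: "(\<Sum>i\<in>insert j J. c i * (X(j := y)) i k) = c j * y k + (\<Sum>i\<in>J. c i * X i k)" for k
            using insert.hyps by (subst sum.insert) (auto intro!: sum.cong)
          have "0 = (\<Sum>k<d. (c j * y k + (\<Sum>i\<in>J. c i * X i k)) * w k)"
            using c unfolding eq by simp
          also have "\<dots> = c j * inner_upto d y w + (\<Sum>i\<in>J. c i * inner_upto d (X i) w)"
            by (simp add: inner_upto_def distrib_right sum.distrib sum_distrib_left sum_distrib_right
                mult.assoc sum.swap[of _ J])
          also have "\<dots> = c j * inner_upto d y w" using w by simp
          finally have cj: "c j = 0" using y by auto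
          then have "\<forall>k<d. (\<Sum>i\<in>J. c i * X i k) = 0" using c unfolding eq by simp
          then have "\<forall>i\<in>J. c i = 0" using X(2) unfolding lin_indep_def by blast
          then show "\<forall>i\<in>insert j J. c i = 0" using cj by simp
        qed
      qed
    qed (use d insert IH in auto)
    then show ?case by simp
  qed
qed

text \<open>The d independent points determine the normal with inner products 1 on the first d
  coordinates, and the further point almost surely misses this one hyperplane.\<close>

lemma AE_not_coplanar:
  assumes d: "d \<ge> 2" and A: "finite A" and I: "I \<subseteq> A" "card I = d" and j: "j \<in> A" "j \<notin> I"
  shows "AE X in points d A. \<not> (\<exists>v. \<forall>i\<in>insert j I. inner_upto d (X i) v = 1)"
proof -
  have fI: "finite I" using A I finite_subset by blast
  show ?thesis
  proof (rule AE_points_coordinate[OF _ A, where P = "lin_indep d I" and j = j])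
    have "{X \<in> space (points d A). lin_indep d I X} =
        space (points d A) - {X \<in> space (points d A). \<not> lin_indep d I X}" by auto
    then show "{X \<in> space (points d A). lin_indep d I X} \<in> sets (points d A)"
      using lin_indep_measurable[of I A d] fI I by auto
    show "AE X in points d A. lin_indep d I X" using I by (intro AE_lin_indep d A) auto
    show "lin_indep d I (X(j := y)) \<longleftrightarrow> lin_indep d I X" for X y
    proof -
      have "(\<Sum>i\<in>I. c i * (X(j := y)) i k) = (\<Sum>i\<in>I. c i * X i k)" for c k
        using j by (intro sum.cong) auto
      then show ?thesis by (simp only: lin_indep_def)
    qed
    show "{X \<in> space (points d A). \<exists>v. \<forall>i\<in>insert j I. inner_upto d (X i) v = 1} \<in> sets (points d A)"
      using fI I j by (intro coplanar_measurable) auto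
    fix X assume X: "X \<in> space (points d A)" "lin_indep d I X"
    have E: "\<And>i. i \<in> I \<Longrightarrow> X i \<in> Eucl d" using points_Eucl[OF X(1)] I by auto
    have "solvable_upto d I X" using E by (intro lin_indep_solvable[OF fI _ X(2)])
    then have "\<exists>w. \<forall>i\<in>I. inner_upto d (X i) w = 1" unfolding solvable_upto_def by (rule spec)
    then obtain v0 where v0: "\<And>i. i \<in> I \<Longrightarrow> inner_upto d (X i) v0 = 1" by blast
    obtain i0 where "i0 \<in> I" using I d by fastforce
    have "inner_upto d v0 v0 \<noteq> 0"
    proof
      assume "inner_upto d v0 v0 = 0"
      then have "\<forall>k<d. v0 k = 0" by (simp only: inner_upto_self_eq_0)
      then have "inner_upto d (X i0) v0 = 0" by (simp add: inner_upto_def)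
      then show False using v0[OF \<open>i0 \<in> I\<close>] by simp
    qed
    then have pos: "inner_upto d v0 v0 > 0" by (simp add: order_less_le)
    have "AE y in uniform_sphere d. y \<notin> {y \<in> space (uniform_sphere d). inner_upto d y v0 = 1}"
      by (intro AE_not_in sphere_hyperplane_null d pos)
    then show "AE y in uniform_sphere d. \<not> (\<exists>v. \<forall>i\<in>insert j I. inner_upto d ((X(j := y)) i) v = 1)"
    proof (rule AE_mp, intro AE_I2 impI notI)
      fix y assume y: "y \<in> space (uniform_sphere d)"
        "y \<notin> {y \<in> space (uniform_sphere d). inner_upto d y v0 = 1}"
      assume "\<exists>v. \<forall>i\<in>insert j I. inner_upto d ((X(j := y)) i) v = 1"
      then obtain v where v: "\<And>i. i \<in> insert j I \<Longrightarrow> inner_upto d ((X(j := y)) i) v = 1" by blast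
      have vX: "inner_upto d (X i) v = 1" if "i \<in> I" for i using v[of i] that j by (auto split: if_splits)
      have "\<forall>i\<in>I. inner_upto d (X i) (\<lambda>k. v k - v0 k) = 0"
        using vX v0 by (simp add: inner_upto_def right_diff_distrib sum_subtractf)
      then have "v k - v0 k = 0" if "k < d" for k
        using lin_indep_orthogonal_0[OF fI E X(2) I(2) _ that] by blast
      then have "inner_upto d y v = inner_upto d y v0" by (simp add: inner_upto_def)
      moreover have "inner_upto d y v = 1" using v[of j] by simp
      ultimately show False using y by simp
    qed
  qed (use d j in auto)
qed

lemma AE_general_position:
  assumes d: "d \<ge> 2"
  shows "AE X in points d {..<n}. general_position n d X"
proof -
  have fin: "finite {I. I \<subseteq> {..<n} \<and> card I = d}" by (rule finite_subset[of _ "Pow {..<n}"]) auto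
  have "AE X in points d {..<n}. \<forall>I\<in>{I. I \<subseteq> {..<n} \<and> card I = d}. lin_indep d I X \<and>
      (\<forall>j\<in>{..<n} - I. \<not> (\<exists>v. \<forall>i\<in>insert j I. inner_upto d (X i) v = 1))"
    by (intro AE_finite_allI[OF fin] AE_conjI AE_lin_indep AE_not_coplanar AE_finite_allI d) auto
  then show ?thesis
    by (rule AE_mp) (auto intro!: AE_I2 simp: general_position_def points_Eucl)
qed

lemma prob_space_points: "d \<ge> 1 \<Longrightarrow> prob_space (points d A)"
  by (intro prob_space_PiM prob_space_uniform_sphere)

text \<open>Linearity of expectation is applied to the index sets of all sizes, whose events
  describe the facets of every configuration. Only then does almost sure general position discard
  the sizes other than d and simplify the events.\<close>

lemma expected_facets_eq_sum:
  assumes d: "d \<ge> 2"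
  shows "expected_facets n d a b = (\<Sum>I | I \<subseteq> {..<n} \<and> card I = d.
     measure (points d {..<n}) {X \<in> space (points d {..<n}). supports_at n d a b I X})"
proof -
  let ?T = "{I. I \<subseteq> {..<n} \<and> card I = d}" and ?M = "points d {..<n}"
  let ?S = "\<lambda>I. {X \<in> space ?M. supports_at n d a b I X}"
  let ?F = "\<lambda>J. {X \<in> space ?M. facet_index_set n d a b J X}"
  have d1: "d \<ge> 1" using d by simp
  interpret prob_space ?M using prob_space_points[OF d1] .
  have "expected_facets n d a b = (\<integral>X. (\<Sum>J\<in>Pow {..<n}. indicator (?F J) X) \<partial>?M)"
    unfolding expected_facets_def
  proof (rule Bochner_Integration.integral_cong[OF refl])
    fix X assume X: "X \<in> space ?M"
    have "(\<Sum>J\<in>Pow {..<n}. indicator (?F J) X :: real) =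
        (\<Sum>J\<in>{J \<in> Pow {..<n}. facet_index_set n d a b J X}. 1)"
      using X by (intro sum.mono_neutral_cong_right) (auto simp: indicator_def)
    also have "\<dots> = real (card {J. J \<subseteq> {..<n} \<and> facet_index_set n d a b J X})"
      by (simp add: Pow_def)
    finally show "real (card (facets_with_height d (random_polytope n X) a b)) =
        (\<Sum>J\<in>Pow {..<n}. indicator (?F J) X)"
      using card_facets_eq[of n X d a b] points_Eucl[OF X] d1 by simp
  qed
  also have "\<dots> = (\<Sum>J\<in>Pow {..<n}. \<integral>X. indicator (?F J) X \<partial>?M)"
    using facet_index_set_measurable d1
    by (intro Bochner_Integration.integral_sum) (auto simp: emeasure_eq_measure)
  also have "\<dots> = (\<Sum>J\<in>Pow {..<n}. prob (?F J))"
    using facet_index_set_measurable d1 by (intro sum.cong refl) simp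
  also have "\<dots> = (\<Sum>J\<in>Pow {..<n}. if card J = d then prob (?S J) else 0)"
  proof (rule sum.cong[OF refl])
    fix J assume "J \<in> Pow {..<n}"
    then have J: "J \<subseteq> {..<n}" by simp
    have "AE X in ?M. X \<in> ?F J \<longleftrightarrow> X \<in> (if card J = d then ?S J else {})"
      using AE_general_position[OF d]
      by (rule AE_mp) (auto intro!: AE_I2 simp: facet_index_set_general_position[OF _ d1 J])
    then have "prob (?F J) = prob (if card J = d then ?S J else {})"
      using facet_index_set_measurable[OF J d1] supports_at_measurable[OF J d1]
      by (intro finite_measure_eq_AE) auto
    then show "prob (?F J) = (if card J = d then prob (?S J) else 0)" by simp
  qed
  also have "\<dots> = (\<Sum>J\<in>?T. prob (?S J))"
    by (rule sum.mono_neutral_cong_right) auto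
  finally show ?thesis .
qed

section \<open>Facets of small height\<close>

lemma sphere_le_prob:
  assumes d: "d \<ge> 1" and u: "inner_upto (Suc d) u u = 1" and s: "0 \<le> s" "s \<le> 1"
  shows "measure (uniform_sphere (Suc d)) {x \<in> space (uniform_sphere (Suc d)). inner_upto (Suc d) x u \<le> s} =
    1 - cone_volume d s / unit_ball_vol (Suc d)" (is "measure ?M ?A = _")
proof -
  interpret prob_space "uniform_sphere (Suc d)" by (rule prob_space_uniform_sphere) simp
  note sphere_inner_measurable[measurable]
  let ?B = "{x \<in> space ?M. s \<le> inner_upto (Suc d) x u}" and ?C = "{x \<in> space ?M. inner_upto (Suc d) x u = s}"
  have A: "?A \<in> events" and B: "?B \<in> events" and C: "?C \<in> events" by measurable
  have "prob ?C = 0" by (rule sphere_hyperplane_null_unit[OF d u s(1)])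
  have "space ?M = (?A - ?C) \<union> ?B" by auto
  moreover have "prob ((?A - ?C) \<union> ?B) = prob (?A - ?C) + prob ?B"
    using A B C by (intro finite_measure_Union) auto
  moreover have "prob (?A - ?C) = prob ?A - prob ?C"
    using A C by (intro finite_measure_Diff) auto
  ultimately show ?thesis using cap_measure[OF d u s] \<open>prob ?C = 0\<close> prob_space by simp
qed

text \<open>Read off from a probability: one minus the quotient is the measure of the points of
  height at most \<open>s\<close> along an axis.\<close>

lemma cone_volume_le_ball:
  assumes d: "d \<ge> 1" and s: "0 \<le> s" "s \<le> 1"
  shows "cone_volume d s \<le> unit_ball_vol (Suc d)"
proof -
  let ?u = "\<lambda>k::nat. if k = 0 then 1 else (0::real)"
  have "(\<Sum>k<Suc d. ?u k * ?u k) = (\<Sum>k<Suc d. if k = 0 then 1 else 0)"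
    by (intro sum.cong) auto
  then have "inner_upto (Suc d) ?u ?u = 1" by (simp add: inner_upto_def)
  note eq = sphere_le_prob[OF d this s]
  have "0 \<le> 1 - cone_volume d s / unit_ball_vol (Suc d)"
    unfolding eq[symmetric] by (rule measure_nonneg)
  then show ?thesis
    using unit_ball_vol_pos[of "real (Suc d)"] by (simp add: divide_le_eq del: unit_ball_vol_pos of_nat_Suc)
qed

text \<open>If <x i, v> = 1 for all i, then a unit normal u of common height h satisfies u = h v on
  the first d coordinates, since u - h v is orthogonal to d independent vectors. Unit length leaves
  two values of h.\<close>

lemma supporting_normals:
  assumes I: "finite I" "card I = d" "lin_indep d I x" and E: "\<And>i. i \<in> I \<Longrightarrow> x i \<in> Eucl d" and d: "d \<ge> 1"
  shows "\<exists>u0. inner_upto d u0 u0 = 1 \<and> (\<forall>u h. inner_upto d u u = 1 \<longrightarrow> (\<forall>i\<in>I. inner_upto d (x i) u = h) \<longrightarrow>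
    (\<forall>k<d. u k = u0 k) \<or> (\<forall>k<d. u k = - u0 k))"
proof -
  have "solvable_upto d I x" using E by (intro lin_indep_solvable[OF I(1) _ I(3)])
  then have "\<exists>w. \<forall>i\<in>I. inner_upto d (x i) w = 1" unfolding solvable_upto_def by (rule spec)
  then obtain v where v: "\<And>i. i \<in> I \<Longrightarrow> inner_upto d (x i) v = 1" by blast
  obtain i0 where i0: "i0 \<in> I" using I d by fastforce
  have "inner_upto d v v \<noteq> 0"
  proof
    assume "inner_upto d v v = 0"
    then have "\<forall>k<d. v k = 0" by (simp only: inner_upto_self_eq_0)
    then have "inner_upto d (x i0) v = 0" by (simp add: inner_upto_def)
    then show False using v[OF i0] by simp
  qed
  then have vv: "inner_upto d v v > 0" by (simp add: order_less_le)
  define r where "r = sqrt (inner_upto d v v)"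
  have r: "r > 0" "r\<^sup>2 = inner_upto d v v" using vv by (auto simp: r_def)
  define u0 where "u0 = (\<lambda>k. 1 / r * v k)"
  have "inner_upto d u0 u0 = 1"
    unfolding u0_def inner_upto_scale using r vv by (simp add: power2_eq_square[symmetric])
  moreover have "(\<forall>k<d. u k = u0 k) \<or> (\<forall>k<d. u k = - u0 k)"
    if u: "inner_upto d u u = 1" "\<forall>i\<in>I. inner_upto d (x i) u = h" for u h
  proof -
    have "\<forall>i\<in>I. inner_upto d (x i) (\<lambda>k. u k - h * v k) = 0"
    proof
      fix i assume i: "i \<in> I"
      have "inner_upto d (x i) (\<lambda>k. u k - h * v k) = inner_upto d (x i) u - h * inner_upto d (x i) v"
        by (simp add: inner_upto_def right_diff_distrib sum_subtractf sum_distrib_left mult_ac)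
      then show "inner_upto d (x i) (\<lambda>k. u k - h * v k) = 0" using u v i by simp
    qed
    then have "u k - h * v k = 0" if "k < d" for k
      using lin_indep_orthogonal_0[OF I(1) E I(3,2) _ that] by blast
    then have uk: "u k = h * r * u0 k" if "k < d" for k
      using that r by (simp add: u0_def)
    have "1 = (h * r) * (h * r) * inner_upto d u0 u0"
    proof -
      have "inner_upto d u u = inner_upto d (\<lambda>k. h * r * u0 k) (\<lambda>k. h * r * u0 k)"
        using uk by (intro inner_upto_cong) auto
      then show ?thesis using u(1) unfolding inner_upto_scale by simp
    qed
    then have "(h * r)\<^sup>2 = 1" using \<open>inner_upto d u0 u0 = 1\<close> by (simp add: power2_eq_square)
    then have "h * r = 1 \<or> h * r = -1" by (simp add: power2_eq_1_iff)
    then show ?thesis using uk by auto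
  qed
  ultimately show ?thesis by blast
qed

text \<open>Given the d points, the remaining n - d points all have height at most \<open>s\<close>
  along one of the two unit normals; hence the factor 2 and the power of a half-space probability.
  Negative heights are covered, since only their bound by \<open>s\<close> enters.\<close>

lemma low_facet_prob_le:
  assumes d: "d \<ge> 2" and I: "I \<subseteq> {..<n}" "card I = d" and s: "0 \<le> s" "s \<le> 1"
  shows "measure (points d {..<n}) {X \<in> space (points d {..<n}). supports_at n d a s I X} \<le>
    2 * (1 - cone_volume (d - 1) s / unit_ball_vol d) ^ (n - d)"
proof -
  have d1: "d \<ge> 1" using d by simp
  have fI: "finite I" using finite_subset[OF I(1)] by simp
  let ?J = "{..<n} - I"
  interpret product_prob_space "\<lambda>_ :: nat. uniform_sphere d" using points_product_prob_space[OF d1] .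
  have fM: "finite_measure (points d {..<n})"
    using prob_space_points[OF d1] by (rule prob_space.finite_measure)
  note sphere_inner_measurable[measurable]
  define p where "p = 1 - cone_volume (d - 1) s / unit_ball_vol d"
  have half: "emeasure (uniform_sphere d) {x \<in> space (uniform_sphere d). inner_upto d x u \<le> s} = ennreal p"
    if "inner_upto d u u = 1" for u
    using sphere_le_prob[of "d - 1" u s] that s d by (simp add: p_def M.emeasure_eq_measure)
  have p0: "p \<ge> 0"
    using cone_volume_le_ball[of "d - 1" s] s d by (simp add: p_def)
  let ?Q = "{X \<in> space (points d {..<n}). supports_at n d a s I X}"
  let ?L = "{X \<in> space (points d {..<n}). \<not> lin_indep d I X}"
  have Q: "?Q \<in> sets (points d {..<n})" by (rule supports_at_measurable[OF I(1) d1])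
  have L: "?L \<in> sets (points d {..<n})" by (rule lin_indep_measurable[OF fI I(1)])
  have "AE X in points d {..<n}. lin_indep d I X" using I by (intro AE_lin_indep d) auto
  then have "emeasure (points d {..<n}) ?Q = emeasure (points d {..<n}) (?Q - ?L)"
    using Q L AE_space[of "points d {..<n}"] by (intro emeasure_eq_AE) (auto elim: eventually_elim2)
  also have "\<dots> = (\<integral>\<^sup>+X. indicator (?Q - ?L) X \<partial>points d {..<n})" using Q L by simp
  also have "\<dots> = (\<integral>\<^sup>+x. (\<integral>\<^sup>+y. indicator (?Q - ?L) (merge I ?J (x, y)) \<partial>points d ?J) \<partial>points d I)"
  proof -
    have "I \<union> ?J = {..<n}" using I by auto
    then show ?thesis
      using product_nn_integral_fold[of I ?J "indicator (?Q - ?L)"] fI Q L by simp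
  qed
  also have "\<dots> \<le> (\<integral>\<^sup>+x. 2 * ennreal p ^ (n - d) \<partial>points d I)"
  proof (rule nn_integral_mono)
    fix x assume x: "x \<in> space (points d I)"
    show "(\<integral>\<^sup>+y. indicator (?Q - ?L) (merge I ?J (x, y)) \<partial>points d ?J) \<le> 2 * ennreal p ^ (n - d)"
    proof (cases "lin_indep d I x")
      case False
      have "lin_indep d I (merge I ?J (x, y)) \<longleftrightarrow> lin_indep d I x" for y
        unfolding lin_indep_def by (simp add: merge_def)
      then have "(\<integral>\<^sup>+y. indicator (?Q - ?L) (merge I ?J (x, y)) \<partial>points d ?J) = (\<integral>\<^sup>+y. 0 \<partial>points d ?J)"
        using False by (intro nn_integral_cong) (auto simp: indicator_def)
      then show ?thesis by simp
    next
      case True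
      obtain u0 where u0: "inner_upto d u0 u0 = 1" and uniq: "\<And>u h. inner_upto d u u = 1 \<Longrightarrow>
          \<forall>i\<in>I. inner_upto d (x i) u = h \<Longrightarrow> (\<forall>k<d. u k = u0 k) \<or> (\<forall>k<d. u k = - u0 k)"
        using supporting_normals[OF fI I(2) True points_Eucl[OF x] d1] by blast
      let ?H = "\<lambda>u. Pi\<^sub>E ?J (\<lambda>_. {x \<in> space (uniform_sphere d). inner_upto d x u \<le> s})"
      have H: "emeasure (points d ?J) (?H u) = ennreal p ^ (n - d)" "?H u \<in> sets (points d ?J)"
        if "inner_upto d u u = 1" for u
      proof -
        have m: "{x \<in> space (uniform_sphere d). inner_upto d x u \<le> s} \<in> sets (uniform_sphere d)" by measurable
        have "card ?J = n - d" using I fI by (simp add: card_Diff_subset)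
        then show "emeasure (points d ?J) (?H u) = ennreal p ^ (n - d)"
          using m half[OF that] by (subst emeasure_PiM) auto
        show "?H u \<in> sets (points d ?J)" using m by (intro sets_PiM_I_finite) auto
      qed
      have u0': "inner_upto d (\<lambda>k. - u0 k) (\<lambda>k. - u0 k) = 1" using u0 by (simp add: inner_upto_def)
      have mem: "y \<in> ?H u0 \<union> ?H (\<lambda>k. - u0 k)"
        if y: "y \<in> space (points d ?J)" and Qy: "merge I ?J (x, y) \<in> ?Q" for y
      proof -
        obtain u h where u: "u \<in> topspace (nsphere (d - 1))" "h \<le> s"
          "\<forall>i\<in>I. inner_upto d (merge I ?J (x, y) i) u = h" "\<forall>j<n. inner_upto d (merge I ?J (x, y) j) u \<le> h"
          using Qy unfolding supports_at_def by auto
        have uu: "inner_upto d u u = 1" using u(1) nsphere_iff[OF d1] by blast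
        have ux: "\<forall>i\<in>I. inner_upto d (x i) u = h" using u(3) by (simp add: merge_def)
        have uy: "inner_upto d (y j) u \<le> s" if "j \<in> ?J" for j
          using u(2) u(4)[rule_format, of j] that by (simp add: merge_def)
        have "y \<in> ?H u" using y uy by (auto simp: space_PiM PiE_iff)
        moreover have "?H u = ?H u0 \<or> ?H u = ?H (\<lambda>k. - u0 k)"
        proof -
          have "(\<forall>z. inner_upto d z u = inner_upto d z u0) \<or> (\<forall>z. inner_upto d z u = inner_upto d z (\<lambda>k. - u0 k))"
            using uniq[OF uu ux] by (auto simp: inner_upto_def)
          then show ?thesis by auto
        qed
        ultimately show ?thesis by blast
      qed
      have "(\<integral>\<^sup>+y. indicator (?Q - ?L) (merge I ?J (x, y)) \<partial>points d ?J) \<le>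
          (\<integral>\<^sup>+y. indicator (?H u0 \<union> ?H (\<lambda>k. - u0 k)) y \<partial>points d ?J)"
        by (intro nn_integral_mono) (use mem in \<open>auto simp: indicator_def\<close>)
      also have "\<dots> = emeasure (points d ?J) (?H u0 \<union> ?H (\<lambda>k. - u0 k))"
        using H(2)[OF u0] H(2)[OF u0'] by simp
      also have "\<dots> \<le> emeasure (points d ?J) (?H u0) + emeasure (points d ?J) (?H (\<lambda>k. - u0 k))"
        using H(2)[OF u0] H(2)[OF u0'] by (intro emeasure_subadditive)
      also have "\<dots> = 2 * ennreal p ^ (n - d)"
        using H(1)[OF u0] H(1)[OF u0'] by (simp add: mult_2)
      finally show ?thesis .
    qed
  qed
  also have "\<dots> = 2 * ennreal p ^ (n - d)" by (simp add: prob_space.emeasure_space_1[OF prob_space_points[OF d1]])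
  also have "\<dots> = ennreal (2 * p ^ (n - d))" using p0 by (simp add: ennreal_mult ennreal_power)
  finally show ?thesis
    using p0 by (simp add: finite_measure.emeasure_eq_measure[OF fM] p_def ennreal_le_iff)
qed

section \<open>Radial integrals over shells\<close>

lemma shell_volume:
  assumes d: "d \<ge> 1" and "0 \<le> a" "a \<le> r"
  shows "emeasure (lebesgue_upto d) {v \<in> space (lebesgue_upto d). a\<^sup>2 < inner_upto d v v \<and> inner_upto d v v \<le> r\<^sup>2} =
    ennreal (unit_ball_vol d * (r ^ d - a ^ d))"
proof -
  let ?B = "\<lambda>r. {v \<in> space (lebesgue_upto d). inner_upto d v v \<le> r\<^sup>2}"
  have "emeasure (lebesgue_upto d) (?B r - ?B a) = emeasure (lebesgue_upto d) (?B r) - emeasure (lebesgue_upto d) (?B a)"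
  proof (rule emeasure_Diff)
    have "a\<^sup>2 \<le> r\<^sup>2" using assms by (intro power_mono) auto
    then show "?B a \<subseteq> ?B r" by auto
    show "emeasure (lebesgue_upto d) (?B a) \<noteq> \<infinity>" using ball_volume[of a d] assms by simp
  qed measurable
  also have "\<dots> = ennreal (unit_ball_vol d * r ^ d) - ennreal (unit_ball_vol d * a ^ d)"
    using ball_volume[of a d] ball_volume[of r d] assms by simp
  also have "\<dots> = ennreal (unit_ball_vol d * (r ^ d - a ^ d))"
    using assms by (simp add: ennreal_minus right_diff_distrib)
  also have "?B r - ?B a = {v \<in> space (lebesgue_upto d). a\<^sup>2 < inner_upto d v v \<and> inner_upto d v v \<le> r\<^sup>2}"
    by auto
  finally show ?thesis .
qed

definition shell :: "nat \<Rightarrow> real \<Rightarrow> real \<Rightarrow> (nat \<Rightarrow> real) set" where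
  "shell d a R = {v \<in> space (lebesgue_upto d). a\<^sup>2 < inner_upto d v v \<and> inner_upto d v v < R\<^sup>2}"

lemma shell_sets: "shell d a R \<in> sets (lebesgue_upto d)"
  unfolding shell_def by measurable

text \<open>Writes an inverse power of the radius as a superposition of the conditions r \<le> s, so
  that a radial integral reduces to volumes of balls and polar coordinates are avoided.\<close>

lemma power_layer_cake:
  fixes r R :: real
  assumes "0 < r" "r \<le> R"
  shows "(\<integral>\<^sup>+s. ennreal (real d / s ^ Suc d) * indicator {r..R} s \<partial>lborel) = ennreal (1 / r ^ d - 1 / R ^ d)"
proof -
  have "(\<integral>\<^sup>+s. ennreal (real d / s ^ Suc d) * indicator {r..R} s \<partial>lborel) = ennreal (- (1 / R ^ d) - - (1 / r ^ d))"
  proof (rule nn_integral_FTC_Icc)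
    fix x :: real assume x: "x \<in> {r..R}"
    then have x0: "x > 0" using assms by simp
    have "DERIV (\<lambda>x. - (1 / x ^ d)) x :> - (0 * x ^ d - 1 * (real d * x ^ (d - Suc 0))) / (x ^ d * x ^ d)"
      using x0 by (auto intro!: derivative_eq_intros simp: field_simps)
    moreover have "- (0 * x ^ d - 1 * (real d * x ^ (d - Suc 0))) / (x ^ d * x ^ d) = real d / x ^ Suc d"
      using x0 by (cases d) (simp_all add: field_simps)
    ultimately show "DERIV (\<lambda>x. - (1 / x ^ d)) x :> real d / x ^ Suc d" by simp
    show "0 \<le> real d / x ^ Suc d" using x0 by simp
  qed (use assms in auto)
  then show ?thesis by simp
qed

text \<open>In polar coordinates the value would be half of this bound. In the layer-cake form the
  constant part R^(-d) and the layered part are each at most d times the volume of the unit ball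
  times ln (R/a); the former because 1 - y \<le> - ln y for y = (a/R)^d.\<close>

lemma radial_integral_le:
  assumes d: "d \<ge> 1" and a: "0 < a" "a \<le> R"
  shows "(\<integral>\<^sup>+v. indicator (shell d a R) v * ennreal (1 / sqrt (inner_upto d v v) ^ d) \<partial>lebesgue_upto d) \<le>
    ennreal (2 * real d * unit_ball_vol d * ln (R / a))"
proof -
  let ?L = "lebesgue_upto d" and ?\<kappa> = "unit_ball_vol (real d)"
  have sf: "sigma_finite_measure ?L" by (rule lebesgue_product.sigma_finite) simp
  interpret pair_sigma_finite ?L "lborel :: real measure"
    unfolding pair_sigma_finite_def using sf sigma_finite_lborel by blast
  have [measurable]: "shell d a R \<in> sets ?L" by (rule shell_sets)
  have R: "R > 0" using a by simp
  have "(\<integral>\<^sup>+v. indicator (shell d a R) v * ennreal (1 / sqrt (inner_upto d v v) ^ d) \<partial>?L) \<le>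
    (\<integral>\<^sup>+v. ennreal (1 / R ^ d) * indicator (shell d a R) v +
      (\<integral>\<^sup>+s. ennreal (real d / s ^ Suc d) * indicator {a..R} s *
         indicator (shell d a R) v * (if sqrt (inner_upto d v v) \<le> s then 1 else 0) \<partial>lborel) \<partial>?L)"
  proof (rule nn_integral_mono)
    fix v
    show "indicator (shell d a R) v * ennreal (1 / sqrt (inner_upto d v v) ^ d) \<le>
      ennreal (1 / R ^ d) * indicator (shell d a R) v +
      (\<integral>\<^sup>+s. ennreal (real d / s ^ Suc d) * indicator {a..R} s *
         indicator (shell d a R) v * (if sqrt (inner_upto d v v) \<le> s then 1 else 0) \<partial>lborel)"
    proof (cases "v \<in> shell d a R")
      case True
      define r where "r = sqrt (inner_upto d v v)"
      have r: "a \<le> r" "r \<le> R"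
        using True a unfolding shell_def r_def
        by (auto intro!: real_le_rsqrt real_le_lsqrt)
      have "(\<integral>\<^sup>+s. ennreal (real d / s ^ Suc d) * indicator {a..R} s *
         indicator (shell d a R) v * (if sqrt (inner_upto d v v) \<le> s then 1 else 0) \<partial>lborel) =
        (\<integral>\<^sup>+s. ennreal (real d / s ^ Suc d) * indicator {r..R} s \<partial>lborel)"
        using True r by (intro nn_integral_cong) (auto simp: indicator_def r_def)
      also have "\<dots> = ennreal (1 / r ^ d - 1 / R ^ d)"
        using a r by (intro power_layer_cake) auto
      finally have eq: "(\<integral>\<^sup>+s. ennreal (real d / s ^ Suc d) * indicator {a..R} s *
         indicator (shell d a R) v * (if sqrt (inner_upto d v v) \<le> s then 1 else 0) \<partial>lborel) =
         ennreal (1 / r ^ d - 1 / R ^ d)" .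
      have "1 / R ^ d \<le> 1 / r ^ d"
        using a r R by (intro divide_left_mono power_mono mult_pos_pos) auto
      then have "ennreal (1 / R ^ d) + ennreal (1 / r ^ d - 1 / R ^ d) = ennreal (1 / r ^ d)"
        using R by (subst ennreal_plus[symmetric]) auto
      then show ?thesis unfolding eq using True by (simp add: r_def)
    qed simp
  qed
  also have "\<dots> = ennreal (1 / R ^ d) * emeasure ?L (shell d a R) +
      (\<integral>\<^sup>+v. (\<integral>\<^sup>+s. ennreal (real d / s ^ Suc d) * indicator {a..R} s *
         indicator (shell d a R) v * (if sqrt (inner_upto d v v) \<le> s then 1 else 0) \<partial>lborel) \<partial>?L)"
    by (subst nn_integral_add, measurable, subst nn_integral_cmult_indicator, measurable)
  also have "(\<integral>\<^sup>+v. (\<integral>\<^sup>+s. ennreal (real d / s ^ Suc d) * indicator {a..R} s *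
         indicator (shell d a R) v * (if sqrt (inner_upto d v v) \<le> s then 1 else 0) \<partial>lborel) \<partial>?L) =
      (\<integral>\<^sup>+s. (\<integral>\<^sup>+v. ennreal (real d / s ^ Suc d) * indicator {a..R} s *
         indicator (shell d a R) v * (if sqrt (inner_upto d v v) \<le> s then 1 else 0) \<partial>?L) \<partial>lborel)"
    by (rule Fubini'[symmetric]) measurable
  also have "\<dots> \<le> (\<integral>\<^sup>+s. ennreal (real d * ?\<kappa> * (1 / s)) * indicator {a..R} s \<partial>lborel)"
  proof (rule nn_integral_mono)
    fix s :: real
    show "(\<integral>\<^sup>+v. ennreal (real d / s ^ Suc d) * indicator {a..R} s *
         indicator (shell d a R) v * (if sqrt (inner_upto d v v) \<le> s then 1 else 0) \<partial>?L) \<le>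
      ennreal (real d * ?\<kappa> * (1 / s)) * indicator {a..R} s"
    proof (cases "s \<in> {a..R}")
      case True
      then have s: "s > 0" using a by simp
      let ?B = "{v \<in> space ?L. inner_upto d v v \<le> s\<^sup>2}"
      have "(\<integral>\<^sup>+v. ennreal (real d / s ^ Suc d) * indicator {a..R} s *
         indicator (shell d a R) v * (if sqrt (inner_upto d v v) \<le> s then 1 else 0) \<partial>?L) \<le>
        (\<integral>\<^sup>+v. ennreal (real d / s ^ Suc d) * indicator ?B v \<partial>?L)"
      proof (rule nn_integral_mono)
        fix v assume "v \<in> space ?L"
        then have "(if sqrt (inner_upto d v v) \<le> s then 1 else 0) = (indicator ?B v :: ennreal)"
          using real_sqrt_le_iff'[of "inner_upto d v v" s] s by (simp add: indicator_def)
        then show "ennreal (real d / s ^ Suc d) * indicator {a..R} s *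
            indicator (shell d a R) v * (if sqrt (inner_upto d v v) \<le> s then 1 else 0) \<le>
            ennreal (real d / s ^ Suc d) * indicator ?B v"
          by (auto simp: indicator_def)
      qed
      also have "\<dots> = ennreal (real d / s ^ Suc d) * emeasure ?L ?B"
        by (rule nn_integral_cmult_indicator) measurable
      also have "emeasure ?L ?B = ennreal (?\<kappa> * s ^ d)" using ball_volume[of s d] s d by simp
      also have "ennreal (real d / s ^ Suc d) * ennreal (?\<kappa> * s ^ d) = ennreal (real d / s ^ Suc d * (?\<kappa> * s ^ d))"
        using s by (intro ennreal_mult[symmetric]) auto
      also have "real d / s ^ Suc d * (?\<kappa> * s ^ d) = real d * ?\<kappa> * (1 / s)"
        using s by (simp add: field_simps)
      finally show ?thesis using True by simp
    qed simp
  qed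
  also have "(\<integral>\<^sup>+s. ennreal (real d * ?\<kappa> * (1 / s)) * indicator {a..R} s \<partial>lborel) =
      ennreal (real d * ?\<kappa> * ln R - real d * ?\<kappa> * ln a)"
  proof (rule nn_integral_FTC_Icc)
    fix x :: real assume "x \<in> {a..R}"
    then have "x > 0" using a by simp
    then show "DERIV (\<lambda>x. real d * ?\<kappa> * ln x) x :> real d * ?\<kappa> * (1 / x)" "0 \<le> real d * ?\<kappa> * (1 / x)"
      by (auto intro!: derivative_eq_intros)
  qed (use a in auto)
  also have "real d * ?\<kappa> * ln R - real d * ?\<kappa> * ln a = real d * ?\<kappa> * ln (R / a)"
    using a R by (simp add: ln_div algebra_simps)
  also have "ennreal (1 / R ^ d) * emeasure ?L (shell d a R) \<le> ennreal (real d * ?\<kappa> * ln (R / a))"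
  proof -
    have "emeasure ?L (shell d a R) \<le> emeasure ?L {v \<in> space ?L. a\<^sup>2 < inner_upto d v v \<and> inner_upto d v v \<le> R\<^sup>2}"
      by (rule emeasure_mono) (auto simp: shell_def)
    also have "\<dots> = ennreal (?\<kappa> * (R ^ d - a ^ d))" using d a by (intro shell_volume) auto
    finally have "ennreal (1 / R ^ d) * emeasure ?L (shell d a R) \<le>
        ennreal (1 / R ^ d) * ennreal (?\<kappa> * (R ^ d - a ^ d))" by (intro mult_left_mono) auto
    also have "\<dots> = ennreal (1 / R ^ d * (?\<kappa> * (R ^ d - a ^ d)))"
      using R by (intro ennreal_mult[symmetric]) (use a in \<open>auto simp: power_mono\<close>)
    also have "1 / R ^ d * (?\<kappa> * (R ^ d - a ^ d)) = ?\<kappa> * (1 - (a / R) ^ d)"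
      using R by (simp add: power_divide field_simps)
    also have "?\<kappa> * (1 - (a / R) ^ d) \<le> ?\<kappa> * (real d * ln (R / a))"
    proof (rule mult_left_mono)
      have "ln ((a / R) ^ d) \<le> (a / R) ^ d - 1" using a R by (intro ln_le_minus_one) auto
      moreover have "ln ((a / R) ^ d) = - (real d * ln (R / a))"
        using a R by (simp add: ln_realpow ln_div algebra_simps)
      ultimately show "1 - (a / R) ^ d \<le> real d * ln (R / a)" by linarith
    qed simp
    finally show ?thesis by (simp add: mult_ac ennreal_leI)
  qed
  finally have "(\<integral>\<^sup>+v. indicator (shell d a R) v * ennreal (1 / sqrt (inner_upto d v v) ^ d) \<partial>?L) \<le>
      ennreal (real d * ?\<kappa> * ln (R / a)) + ennreal (real d * ?\<kappa> * ln (R / a))"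
    by (simp add: add_mono)
  also have "\<dots> = ennreal (2 * real d * ?\<kappa> * ln (R / a))"
    using a by (subst ennreal_plus[symmetric]) (auto simp: ln_ge_zero)
  finally show ?thesis .
qed

section \<open>Facets of large height\<close>

lemma sqrt_inner_upto: "sqrt (inner_upto d v v) = L2_set v {..<d}"
  by (simp add: inner_upto_def L2_set_def power2_eq_square)

lemma inner_upto_Cauchy_Schwarz:
  "inner_upto d x y \<le> sqrt (inner_upto d x x) * sqrt (inner_upto d y y)"
proof -
  have "inner_upto d x y \<le> (\<Sum>i<d. \<bar>x i\<bar> * \<bar>y i\<bar>)"
    unfolding inner_upto_def by (intro sum_mono) (simp add: abs_mult[symmetric])
  also have "\<dots> \<le> L2_set x {..<d} * L2_set y {..<d}" by (rule L2_set_mult_ineq)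
  finally show ?thesis by (simp add: sqrt_inner_upto)
qed

lemma L2_set_sum_le:
  assumes "finite I"
  shows "L2_set (\<lambda>k. v k + (\<Sum>i\<in>I. c i * b i k)) A \<le> L2_set v A + (\<Sum>i\<in>I. \<bar>c i\<bar> * L2_set (b i) A)"
  using assms
proof (induction I)
  case (insert j I)
  have "L2_set (\<lambda>k. v k + (\<Sum>i\<in>insert j I. c i * b i k)) A =
      L2_set (\<lambda>k. c j * b j k + (v k + (\<Sum>i\<in>I. c i * b i k))) A"
    using insert by (simp add: algebra_simps)
  also have "\<dots> \<le> L2_set (\<lambda>k. c j * b j k) A + L2_set (\<lambda>k. v k + (\<Sum>i\<in>I. c i * b i k)) A"
    by (rule L2_set_triangle_ineq)
  also have "L2_set (\<lambda>k. c j * b j k) A = \<bar>c j\<bar> * L2_set (b j) A"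
    by (simp add: L2_set_def power_mult_distrib real_sqrt_mult flip: sum_distrib_left)
  finally show ?case using insert by simp
qed simp

lemma inner_upto_combination:
  "inner_upto d x (\<lambda>k. v k + (\<Sum>i\<in>I. c i * b i k)) = inner_upto d x v + (\<Sum>i\<in>I. c i * inner_upto d x (b i))"
proof -
  have "(\<Sum>k<d. x k * (\<Sum>i\<in>I. c i * b i k)) = (\<Sum>k<d. \<Sum>i\<in>I. c i * (x k * b i k))"
    by (simp add: sum_distrib_left mult_ac)
  also have "\<dots> = (\<Sum>i\<in>I. \<Sum>k<d. c i * (x k * b i k))" by (rule sum.swap)
  finally show ?thesis by (simp add: inner_upto_def distrib_left sum.distrib sum_distrib_left)
qed

text \<open>The parallelepiped shrinks to \<open>v0\<close>: expanded in the dual basis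
  \<open>b\<close>, its points have distance at most \<epsilon> B from \<open>v0\<close> in the
  first d coordinates. The inner radius comes from Cauchy-Schwarz with one unit vector X i. The
  threshold depends on X through \<open>b\<close> and \<open>v0\<close>.\<close>

lemma slab_subset_shell:
  assumes I: "finite I" "card I = d" "lin_indep d I X" and E: "\<And>i. i \<in> I \<Longrightarrow> X i \<in> Eucl d"
    and unit: "\<And>i. i \<in> I \<Longrightarrow> inner_upto d (X i) (X i) = 1" and d: "d \<ge> 1"
    and v0: "\<And>i. i \<in> I \<Longrightarrow> inner_upto d (X i) v0 = 1" "inner_upto d v0 v0 < R\<^sup>2" and R: "R > 0"
  shows "\<exists>\<delta>>0. \<forall>\<epsilon>. 0 < \<epsilon> \<and> \<epsilon> \<le> \<delta> \<longrightarrow> slab d I X (\<lambda>_. 1) \<epsilon> \<subseteq> shell d (1 - 2 * \<epsilon>) R"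
proof -
  have sol: "solvable_upto d I X" using E by (intro lin_indep_solvable[OF I(1) _ I(3)])
  have "\<exists>b. \<forall>j\<in>I. inner_upto d (X j) b = (if j = i then 1 else 0)" for i
    using sol unfolding solvable_upto_def by (rule spec)
  then obtain b where b: "\<And>i j. j \<in> I \<Longrightarrow> inner_upto d (X j) (b i) = (if j = i then 1 else 0)" by metis
  define r0 B where "r0 = L2_set v0 {..<d}" and "B = (\<Sum>i\<in>I. L2_set (b i) {..<d})"
  have B: "B \<ge> 0" by (simp add: B_def sum_nonneg)
  have "sqrt (inner_upto d v0 v0) < R" using v0(2) R by (intro real_less_lsqrt) auto
  then have r0: "r0 < R" by (simp add: r0_def sqrt_inner_upto)
  \<comment> \<open>The bound 1/4 keeps 1 - 2 \<epsilon> positive, so that squaring preserves order;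
    the other bound keeps \<epsilon> B below the gap R - r0, with B + 1 in place of B to avoid
    division by 0.\<close>
  define \<delta> where "\<delta> = min (1 / 4) ((R - r0) / (2 * (B + 1)))"
  have \<delta>: "\<delta> > 0" using r0 B by (simp add: \<delta>_def)
  have \<delta>4: "\<delta> \<le> 1 / 4" unfolding \<delta>_def by (rule min.cobounded1)
  obtain i0 where i0: "i0 \<in> I" using I d by fastforce
  have "v \<in> shell d (1 - 2 * \<epsilon>) R" if \<epsilon>: "0 < \<epsilon>" "\<epsilon> \<le> \<delta>" and v: "v \<in> slab d I X (\<lambda>_. 1) \<epsilon>" for \<epsilon> v
  proof -
    have dist: "\<bar>inner_upto d (X i) v - 1\<bar> \<le> \<epsilon>" if "i \<in> I" for i using v that by (auto simp: slab_def)
    define w where "w = (\<lambda>k. v0 k + (\<Sum>i\<in>I. (inner_upto d (X i) v - 1) * b i k))"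
    have "inner_upto d (X j) w = inner_upto d (X j) v" if "j \<in> I" for j
    proof -
      have "inner_upto d (X j) w = inner_upto d (X j) v0 + (\<Sum>i\<in>I. (inner_upto d (X i) v - 1) * inner_upto d (X j) (b i))"
        unfolding w_def by (rule inner_upto_combination)
      also have "(\<Sum>i\<in>I. (inner_upto d (X i) v - 1) * inner_upto d (X j) (b i)) =
          (\<Sum>i\<in>I. if i = j then inner_upto d (X i) v - 1 else 0)"
        using that by (intro sum.cong) (auto simp: b)
      also have "\<dots> = inner_upto d (X j) v - 1" using that I by simp
      finally show ?thesis using v0 that by simp
    qed
    then have "\<forall>j\<in>I. inner_upto d (X j) (\<lambda>k. v k - w k) = 0"
      by (simp add: inner_upto_def right_diff_distrib sum_subtractf)
    then have "v k - w k = 0" if "k < d" for k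
      using lin_indep_orthogonal_0[OF I(1) E I(3,2) _ that] by blast
    then have "L2_set v {..<d} = L2_set w {..<d}" by (intro L2_set_cong) auto
    also have "\<dots> \<le> r0 + (\<Sum>i\<in>I. \<bar>inner_upto d (X i) v - 1\<bar> * L2_set (b i) {..<d})"
      unfolding w_def r0_def using I by (intro L2_set_sum_le)
    also have "\<dots> \<le> r0 + (\<Sum>i\<in>I. \<epsilon> * L2_set (b i) {..<d})"
      using dist by (intro add_left_mono sum_mono mult_right_mono) auto
    also have "\<dots> = r0 + \<epsilon> * B" by (simp add: B_def sum_distrib_left)
    also have "\<dots> \<le> r0 + (R - r0) / (2 * (B + 1)) * B"
      using \<epsilon> B by (intro add_left_mono mult_right_mono) (auto simp: \<delta>_def)
    also have "\<dots> < r0 + (R - r0)"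
    proof -
      have "(R - r0) / (2 * (B + 1)) * B = (R - r0) * (B / (2 * (B + 1)))" by simp
      also have "\<dots> < (R - r0) * 1" using r0 B by (intro mult_strict_left_mono) auto
      finally show ?thesis by simp
    qed
    finally have up: "sqrt (inner_upto d v v) < R" by (simp add: sqrt_inner_upto)
    have "1 - \<epsilon> \<le> inner_upto d (X i0) v" using dist[OF i0] by linarith
    also have "\<dots> \<le> sqrt (inner_upto d v v)"
      using inner_upto_Cauchy_Schwarz[of d "X i0" v] unit[OF i0] by simp
    finally have "1 - 2 * \<epsilon> < sqrt (inner_upto d v v)" using \<epsilon> by linarith
    then have "(1 - 2 * \<epsilon>)\<^sup>2 < (sqrt (inner_upto d v v))\<^sup>2"
      using \<epsilon> \<delta>4 by (intro power_strict_mono) auto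
    moreover have "(sqrt (inner_upto d v v))\<^sup>2 < R\<^sup>2" using up by (intro power_strict_mono) auto
    ultimately show ?thesis using v by (simp add: shell_def slab_def)
  qed
  then show ?thesis using \<delta> by blast
qed

text \<open>The point s v with s = 1/|v|^2 is the foot of the perpendicular from the origin to the
  common hyperplane, at squared distance s > h^2. The inner product is smallest for points opposite
  each other across the foot, and |x + y - 2 s v|^2 \<ge> 0 says precisely that it is at least 2 s -
  1.\<close>

lemma inner_ge_of_common_height:
  assumes x: "inner_upto d x x = 1" "inner_upto d x v = 1" and y: "inner_upto d y y = 1" "inner_upto d y v = 1"
    and v: "inner_upto d v v < (1 / h)\<^sup>2" and h: "h > 0"
  shows "inner_upto d x y \<ge> 2 * h\<^sup>2 - 1"
proof -
  have "inner_upto d v v \<noteq> 0"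
  proof
    assume "inner_upto d v v = 0"
    then have "\<forall>k<d. v k = 0" by (simp only: inner_upto_self_eq_0)
    then have "inner_upto d x v = 0" by (simp add: inner_upto_def)
    then show False using x by simp
  qed
  then have vv: "inner_upto d v v > 0" by (simp add: order_less_le)
  define s where "s = 1 / inner_upto d v v"
  have s: "s > h\<^sup>2"
  proof -
    have "inner_upto d v v * h\<^sup>2 < 1" using v h by (simp add: power_divide field_simps)
    then show ?thesis using vv by (simp add: s_def field_simps)
  qed
  have "0 \<le> inner_upto d (\<lambda>k. x k + y k - 2 * s * v k) (\<lambda>k. x k + y k - 2 * s * v k)" by simp
  also have "\<dots> = inner_upto d x x + inner_upto d y y + 2 * inner_upto d x y
      - 4 * s * inner_upto d x v - 4 * s * inner_upto d y v + 4 * s * s * inner_upto d v v"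
    by (simp add: inner_upto_def algebra_simps sum.distrib sum_subtractf sum_distrib_left)
  also have "\<dots> = 2 + 2 * inner_upto d x y - 4 * s"
    using x y vv by (simp add: s_def)
  finally show ?thesis using s by linarith
qed

text \<open>For fixed v the events at different indices are independent. Each confines a point to a
  slab with normal v/|v| and width 2 \<epsilon>/|v|, whose height is at least (1 - \<epsilon>) h
  because |v| < 1/h. The inverse power of |v| is the weight handled by
  \<open>radial_integral_le\<close>.\<close>

lemma slab_event_prob_le:
  assumes e: "e \<ge> 2" and I: "I \<subseteq> {..<n}" "card I = Suc e" and h: "0 < h" "h < 1" and \<epsilon>: "0 < \<epsilon>" "\<epsilon> \<le> 1 / 4"
    and v: "v \<in> shell (Suc e) (1 - 2 * \<epsilon>) (1 / h)"
  shows "emeasure (points (Suc e) {..<n}) {X \<in> space (points (Suc e) {..<n}). \<forall>i\<in>I. \<bar>inner_upto (Suc e) (X i) v - 1\<bar> \<le> \<epsilon>} \<le>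
    ennreal ((2 * \<epsilon> * (unit_ball_vol e / unit_ball_vol (Suc e)) * sqrt (1 - ((1 - \<epsilon>) * h)\<^sup>2) ^ (e - 2)) ^ Suc e *
      (1 / sqrt (inner_upto (Suc e) v v) ^ Suc e))"
proof -
  let ?D = "Suc e" and ?S = "uniform_sphere (Suc e)"
  interpret product_prob_space "\<lambda>_ :: nat. ?S" by (rule points_product_prob_space) simp
  note sphere_inner_measurable[measurable]
  have fI: "finite I" using finite_subset[OF I(1)] by simp
  define r where "r = sqrt (inner_upto ?D v v)"
  have vv: "inner_upto ?D v v > 0" using v \<epsilon> unfolding shell_def by (auto intro: le_less_trans[OF zero_le_power2])
  have r: "r > 0" "r * r = inner_upto ?D v v" using vv by (auto simp: r_def)
  have "sqrt (inner_upto ?D v v) < 1 / h" using v h unfolding shell_def by (intro real_less_lsqrt) auto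
  then have rh: "h < 1 / r" using r h by (simp add: r_def field_simps)
  define u where "u = (\<lambda>k. 1 / r * v k)"
  have u: "inner_upto ?D u u = 1" unfolding u_def inner_upto_scale using r vv by (simp add: field_simps)
  let ?A = "{x \<in> space ?S. (1 - \<epsilon>) / r \<le> inner_upto ?D x u \<and> inner_upto ?D x u \<le> (1 + \<epsilon>) / r}"
  have A: "?A \<in> sets ?S" by measurable
  have Aiff: "(1 - \<epsilon>) / r \<le> inner_upto ?D x u \<and> inner_upto ?D x u \<le> (1 + \<epsilon>) / r \<longleftrightarrow> \<bar>inner_upto ?D x v - 1\<bar> \<le> \<epsilon>" for x
  proof -
    have "inner_upto ?D x u = inner_upto ?D x v / r" unfolding u_def inner_upto_scale by simp
    then show ?thesis using r(1) by (auto simp: abs_le_iff divide_le_cancel)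
  qed
  have eq: "{X \<in> space (points ?D {..<n}). \<forall>i\<in>I. \<bar>inner_upto ?D (X i) v - 1\<bar> \<le> \<epsilon>} =
      Pi\<^sub>E {..<n} (\<lambda>i. if i \<in> I then ?A else space ?S)"
    using I by (auto simp: space_PiM PiE_iff Aiff extensional_def split: if_splits)
  let ?q = "unit_ball_vol e / unit_ball_vol ?D" and ?\<rho> = "sqrt (1 - ((1 - \<epsilon>) * h)\<^sup>2)"
  have le1: "(1 - \<epsilon>) * h \<le> 1" using \<epsilon> h by (intro mult_le_one) auto
  have "measure ?S ?A \<le> ((1 + \<epsilon>) / r - (1 - \<epsilon>) / r) * ?q * ?\<rho> ^ (e - 2)"
  proof (rule sphere_slab_prob_le[OF e u])
    show "(1 - \<epsilon>) * h \<le> (1 - \<epsilon>) / r" using rh \<epsilon> mult_left_mono[of h "1 / r" "1 - \<epsilon>"] by simp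
    show "(1 - \<epsilon>) / r \<le> (1 + \<epsilon>) / r" using \<epsilon> r by (intro divide_right_mono) auto
  qed (use \<epsilon> h le1 in auto)
  also have "(1 + \<epsilon>) / r - (1 - \<epsilon>) / r = 2 * \<epsilon> / r" using r by (simp add: field_simps)
  also have "2 * \<epsilon> / r * ?q * ?\<rho> ^ (e - 2) = (2 * \<epsilon> * ?q * ?\<rho> ^ (e - 2)) * (1 / r)" by (simp add: mult_ac)
  finally have mA: "measure ?S ?A \<le> (2 * \<epsilon> * ?q * ?\<rho> ^ (e - 2)) * (1 / r)" .
  have "emeasure (points ?D {..<n}) {X \<in> space (points ?D {..<n}). \<forall>i\<in>I. \<bar>inner_upto ?D (X i) v - 1\<bar> \<le> \<epsilon>} =
      (\<Prod>i<n. emeasure ?S (if i \<in> I then ?A else space ?S))"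
    unfolding eq using A sets.top[of ?S] by (intro emeasure_PiM) (auto simp del: space_uniform_sphere)
  also have "\<dots> = (\<Prod>i<n. if i \<in> I then emeasure ?S ?A else 1)"
    by (intro prod.cong refl) (simp add: M.emeasure_space_1 del: space_uniform_sphere)
  also have "\<dots> = (\<Prod>i\<in>I. emeasure ?S ?A)"
    using I by (intro prod.mono_neutral_cong_right) auto
  also have "\<dots> = ennreal (measure ?S ?A ^ ?D)"
    using I by (simp add: M.emeasure_eq_measure ennreal_power del: power_Suc)
  also have "\<dots> \<le> ennreal (((2 * \<epsilon> * ?q * ?\<rho> ^ (e - 2)) * (1 / r)) ^ ?D)"
    using mA by (intro ennreal_leI power_mono) auto
  also have "((2 * \<epsilon> * ?q * ?\<rho> ^ (e - 2)) * (1 / r)) ^ ?D = (2 * \<epsilon> * ?q * ?\<rho> ^ (e - 2)) ^ ?D * (1 / r ^ ?D)"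
    by (simp only: power_mult_distrib power_one_over)
  finally show ?thesis by (simp only: r_def)
qed


lemma high_facet_prob_le:
  assumes e: "e \<ge> 2" and I: "I \<subseteq> {..<n}" "card I = Suc e" and h: "0 < h" "h < 1"
    and Q: "Q \<in> sets (points (Suc e) {..<n})"
    and sub: "\<And>X. X \<in> Q \<Longrightarrow> \<exists>v. inner_upto (Suc e) v v < (1 / h)\<^sup>2 \<and> (\<forall>i\<in>I. inner_upto (Suc e) (X i) v = 1)"
  shows "measure (points (Suc e) {..<n}) Q \<le> 2 ^ e * sqrt (1 - h\<^sup>2) ^ e *
    ((unit_ball_vol e / unit_ball_vol (Suc e)) * sqrt (1 - h\<^sup>2) ^ (e - 2)) ^ Suc e *
    (2 * real (Suc e) * unit_ball_vol (Suc e) * ln (1 / h))"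
proof -
  let ?D = "Suc e"
  let ?M = "points ?D {..<n}" and ?L = "lebesgue_upto ?D"
  have fI: "finite I" using finite_subset[OF I(1)] by simp
  have "I \<noteq> {}" using I by auto
  have PM: "prob_space ?M" by (rule prob_space_points) simp
  have sM: "sigma_finite_measure ?M" using PM by (simp add: prob_space_imp_sigma_finite)
  have sL: "sigma_finite_measure ?L" by (rule lebesgue_product.sigma_finite) simp
  interpret pair_sigma_finite ?M ?L unfolding pair_sigma_finite_def using sM sL by blast
  define q \<rho> where "q = unit_ball_vol e / unit_ball_vol ?D" and "\<rho> = sqrt (1 - h\<^sup>2)"
  have "h\<^sup>2 < 1" using h by (simp add: power_less_one_iff)
  then have \<rho>: "\<rho> > 0" "\<rho>\<^sup>2 = 1 - h\<^sup>2" by (auto simp: \<rho>_def)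
  \<comment> \<open>The offset 4 gives the bound 1/4 that \<open>slab_event_prob_le\<close>
    requires, for every k.\<close>
  define \<epsilon> where "\<epsilon> k = 1 / (real k + 4)" for k
  have \<epsilon>: "0 < \<epsilon> k" "\<epsilon> k \<le> 1 / 4" for k by (auto simp: \<epsilon>_def)
  \<comment> \<open>The reciprocal of the volume bound in \<open>slab_volume_clustered\<close>. With
    this weight the integral of \<open>g k X\<close> over v is eventually at least 1 for almost
    every X in \<open>Q\<close>.\<close>
  define C where "C k = 1 / (2 * \<epsilon> k) * (\<rho> / \<epsilon> k) ^ e" for k
  have C: "C k \<ge> 0" for k using \<epsilon>[of k] \<rho> by (simp add: C_def)
  define g where "g k X v = ennreal (C k) * indicator (shell ?D (1 - 2 * \<epsilon> k) (1 / h)) v *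
      (if \<forall>i\<in>I. \<bar>inner_upto ?D (X i) v - 1\<bar> \<le> \<epsilon> k then 1 else 0)" for k :: nat and X v
  have meas_X: "(\<lambda>p. fst p i j) \<in> borel_measurable (?M \<Otimes>\<^sub>M ?L)" if "i \<in> I" for i j
    using I that by (intro measurable_compose[OF measurable_fst points_coordinate_measurable]) auto
  have meas_v: "(\<lambda>p. snd p j) \<in> borel_measurable (?M \<Otimes>\<^sub>M ?L)" if "j < ?D" for j
    using that by (intro measurable_compose[OF measurable_snd coordinate_measurable])
  have meas_inner: "(\<lambda>p. inner_upto ?D (fst p i) (snd p)) \<in> borel_measurable (?M \<Otimes>\<^sub>M ?L)" if "i \<in> I" for i
    using meas_X[OF that] meas_v by (intro inner_upto_measurable)
  have [measurable]: "shell ?D a R \<in> sets ?L" for a R by (rule shell_sets)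
  have meas_g: "(\<lambda>p. g k (fst p) (snd p)) \<in> borel_measurable (?M \<Otimes>\<^sub>M ?L)" for k
  proof -
    have "Measurable.pred (?M \<Otimes>\<^sub>M ?L) (\<lambda>p. \<forall>i\<in>I. \<bar>inner_upto ?D (fst p i) (snd p) - 1\<bar> \<le> \<epsilon> k)"
    proof -
      have "{p \<in> space (?M \<Otimes>\<^sub>M ?L). \<bar>inner_upto ?D (fst p i) (snd p) - 1\<bar> \<le> \<epsilon> k} \<in> sets (?M \<Otimes>\<^sub>M ?L)"
        if "i \<in> I" for i
        using meas_inner[OF that] by measurable
      then show ?thesis unfolding pred_def using fI \<open>I \<noteq> {}\<close> by (intro sets.sets_Collect_finite_All') auto
    qed
    then show ?thesis unfolding g_def by measurable
  qed
  have meas_g': "(\<lambda>X. \<integral>\<^sup>+v. g k X v \<partial>?L) \<in> borel_measurable ?M" for k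
    using M2.borel_measurable_nn_integral_fst[OF meas_g[of k]] by simp
  \<comment> \<open>The index k from which the parallelepiped lies in the shell depends on X. A
    limit inferior records this without any uniformity, and Fatou's lemma moves it out of the
    integral.\<close>
  have AE_ge: "AE X in ?M. indicator Q X \<le> liminf (\<lambda>k. \<integral>\<^sup>+v. g k X v \<partial>?L)"
  proof -
    have "AE X in ?M. lin_indep ?D I X" using e I by (intro AE_lin_indep) auto
    moreover have "AE X in ?M. \<forall>i\<in>I. inner_upto ?D (X i) (X i) = 1"
    proof (intro AE_finite_allI fI)
      fix i assume "i \<in> I"
      then show "AE X in ?M. inner_upto ?D (X i) (X i) = 1"
        using I by (intro AE_PiM_component prob_space_uniform_sphere AE_uniform_sphere_unit) auto
    qed
    ultimately show ?thesis using AE_space[of ?M]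
    proof eventually_elim
      case (elim X)
      show ?case
      proof (cases "X \<in> Q")
        case True
        obtain v0 where v0: "inner_upto ?D v0 v0 < (1 / h)\<^sup>2" "\<And>i. i \<in> I \<Longrightarrow> inner_upto ?D (X i) v0 = 1"
          using sub[OF True] by blast
        have E: "\<And>i. i \<in> I \<Longrightarrow> X i \<in> Eucl ?D" using points_Eucl[OF elim(3)] I by auto
        have unit: "\<And>i. i \<in> I \<Longrightarrow> inner_upto ?D (X i) (X i) = 1" using elim by blast
        have "1 / h > 0" using h by simp
        from slab_subset_shell[OF fI I(2) elim(1) E unit _ v0(2,1) this]
        obtain \<delta> where \<delta>: "\<delta> > 0"
          "\<And>\<epsilon>. 0 < \<epsilon> \<Longrightarrow> \<epsilon> \<le> \<delta> \<Longrightarrow> slab ?D I X (\<lambda>_. 1) \<epsilon> \<subseteq> shell ?D (1 - 2 * \<epsilon>) (1 / h)"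
          by auto
        have solv: "solvable_upto ?D I X" using E by (intro lin_indep_solvable[OF fI _ elim(1)])
        have close: "inner_upto ?D (X i) (X j) \<ge> 1 - 2 * \<rho>\<^sup>2" if "i \<in> I" "j \<in> I" for i j
          using inner_ge_of_common_height[OF unit[OF that(1)] v0(2)[OF that(1)] unit[OF that(2)] v0(2)[OF that(2)] v0(1) h(1)]
          by (simp add: \<rho>(2))
        have ge1: "1 \<le> (\<integral>\<^sup>+v. g k X v \<partial>?L)" if k: "\<epsilon> k \<le> \<delta>" for k
        proof -
          have "ennreal (2 * \<epsilon> k * (\<epsilon> k / \<rho>) ^ e) \<le> emeasure ?L (slab ?D I X (\<lambda>_. 1) (\<epsilon> k))"
            by (rule slab_volume_clustered[OF fI I(2) solv \<rho>(1) \<epsilon>(1) unit close])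
          then have "ennreal (C k) * ennreal (2 * \<epsilon> k * (\<epsilon> k / \<rho>) ^ e) \<le>
              ennreal (C k) * emeasure ?L (slab ?D I X (\<lambda>_. 1) (\<epsilon> k))" by (rule mult_left_mono) simp
          also have "ennreal (C k) * ennreal (2 * \<epsilon> k * (\<epsilon> k / \<rho>) ^ e) = ennreal (C k * (2 * \<epsilon> k * (\<epsilon> k / \<rho>) ^ e))"
            using C \<epsilon>[of k] \<rho> by (intro ennreal_mult[symmetric]) auto
          also have "C k * (2 * \<epsilon> k * (\<epsilon> k / \<rho>) ^ e) = 1"
          proof -
            have "(\<rho> / \<epsilon> k) ^ e * (\<epsilon> k / \<rho>) ^ e = 1"
              using \<epsilon>(1)[of k] \<rho>(1) by (simp flip: power_mult_distrib)
            moreover have "C k * (2 * \<epsilon> k * (\<epsilon> k / \<rho>) ^ e) =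
                (1 / (2 * \<epsilon> k) * (2 * \<epsilon> k)) * ((\<rho> / \<epsilon> k) ^ e * (\<epsilon> k / \<rho>) ^ e)" by (simp only: C_def mult_ac)
            ultimately show ?thesis using \<epsilon>(1)[of k] by simp
          qed
          also have "ennreal (C k) * emeasure ?L (slab ?D I X (\<lambda>_. 1) (\<epsilon> k)) =
              (\<integral>\<^sup>+v. ennreal (C k) * indicator (slab ?D I X (\<lambda>_. 1) (\<epsilon> k)) v \<partial>?L)"
            using slab_measurable[OF fI] by (intro nn_integral_cmult_indicator[symmetric])
          also have "\<dots> \<le> (\<integral>\<^sup>+v. g k X v \<partial>?L)"
          proof (intro nn_integral_mono)
            fix v
            show "ennreal (C k) * indicator (slab ?D I X (\<lambda>_. 1) (\<epsilon> k)) v \<le> g k X v"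
              using \<delta>(2)[OF \<epsilon>(1) k] by (auto simp: g_def indicator_def slab_def)
          qed
          finally show ?thesis by simp
        qed
        have "\<epsilon> \<longlonglongrightarrow> 0" unfolding \<epsilon>_def by real_asymp
        then have "eventually (\<lambda>k. \<epsilon> k < \<delta>) sequentially" using \<delta>(1) by (rule order_tendstoD)
        then have "eventually (\<lambda>k. 1 \<le> (\<integral>\<^sup>+v. g k X v \<partial>?L)) sequentially"
          by eventually_elim (auto intro: ge1)
        then have "1 \<le> liminf (\<lambda>k. \<integral>\<^sup>+v. g k X v \<partial>?L)" by (rule Liminf_bounded)
        then show ?thesis using True by simp
      qed simp
    qed
  qed
  define G where "G k = 2 ^ e * \<rho> ^ e * (q * sqrt (1 - ((1 - \<epsilon> k) * h)\<^sup>2) ^ (e - 2)) ^ ?D *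
      (2 * real ?D * unit_ball_vol ?D * ln (1 / h / (1 - 2 * \<epsilon> k)))" for k
  have int_le: "(\<integral>\<^sup>+X. (\<integral>\<^sup>+v. g k X v \<partial>?L) \<partial>?M) \<le> ennreal (G k)" for k
  proof -
    let ?\<rho>' = "sqrt (1 - ((1 - \<epsilon> k) * h)\<^sup>2)" and ?S = "shell ?D (1 - 2 * \<epsilon> k) (1 / h)"
    have le1: "((1 - \<epsilon> k) * h)\<^sup>2 \<le> 1" using \<epsilon>[of k] h by (simp add: power_le_one mult_le_one)
    have q: "q \<ge> 0" by (simp add: q_def)
    define K where "K = C k * (2 * \<epsilon> k * q * ?\<rho>' ^ (e - 2)) ^ ?D"
    have K: "K \<ge> 0" using C q \<epsilon>[of k] le1 by (simp add: K_def)
    have ev: "{X \<in> space ?M. \<forall>i\<in>I. \<bar>inner_upto ?D (X i) v - 1\<bar> \<le> \<epsilon> k} \<in> sets ?M" for v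
    proof -
      have "{X \<in> space ?M. \<bar>inner_upto ?D (X i) v - 1\<bar> \<le> \<epsilon> k} \<in> sets ?M" if "i \<in> I" for i
      proof -
        have [measurable]: "(\<lambda>X. inner_upto ?D (X i) v) \<in> borel_measurable ?M"
          using I that by (intro points_inner_measurable) auto
        show ?thesis by measurable
      qed
      then show ?thesis using fI \<open>I \<noteq> {}\<close> by (intro sets.sets_Collect_finite_All') auto
    qed
    have "(\<integral>\<^sup>+X. (\<integral>\<^sup>+v. g k X v \<partial>?L) \<partial>?M) = (\<integral>\<^sup>+v. (\<integral>\<^sup>+X. g k X v \<partial>?M) \<partial>?L)"
      by (rule Fubini'[symmetric]) (use meas_g[of k] in \<open>simp add: split_beta'\<close>)
    also have "\<dots> \<le> (\<integral>\<^sup>+v. ennreal K * (indicator ?S v * ennreal (1 / sqrt (inner_upto ?D v v) ^ ?D)) \<partial>?L)"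
    proof (rule nn_integral_mono)
      fix v
      show "(\<integral>\<^sup>+X. g k X v \<partial>?M) \<le> ennreal K * (indicator ?S v * ennreal (1 / sqrt (inner_upto ?D v v) ^ ?D))"
      proof (cases "v \<in> ?S")
        case True
        let ?E = "{X \<in> space ?M. \<forall>i\<in>I. \<bar>inner_upto ?D (X i) v - 1\<bar> \<le> \<epsilon> k}"
        have "(\<integral>\<^sup>+X. g k X v \<partial>?M) = (\<integral>\<^sup>+X. ennreal (C k) * indicator ?E X \<partial>?M)"
          using True by (intro nn_integral_cong) (auto simp: g_def indicator_def)
        also have "\<dots> = ennreal (C k) * emeasure ?M ?E"
          using ev by (intro nn_integral_cmult_indicator)
        also have "\<dots> \<le> ennreal (C k) * ennreal ((2 * \<epsilon> k * q * ?\<rho>' ^ (e - 2)) ^ ?D * (1 / sqrt (inner_upto ?D v v) ^ ?D))"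
          unfolding q_def by (intro mult_left_mono slab_event_prob_le e I h \<epsilon> True) simp
        also have "\<dots> = ennreal (C k * ((2 * \<epsilon> k * q * ?\<rho>' ^ (e - 2)) ^ ?D * (1 / sqrt (inner_upto ?D v v) ^ ?D)))"
          using C q \<epsilon>[of k] le1 by (intro ennreal_mult[symmetric]) auto
        also have "\<dots> = ennreal (K * (1 / sqrt (inner_upto ?D v v) ^ ?D))" by (simp only: K_def mult.assoc)
        also have "\<dots> = ennreal K * ennreal (1 / sqrt (inner_upto ?D v v) ^ ?D)"
          using K by (intro ennreal_mult) auto
        finally show ?thesis using True by simp
      next
        case False
        then show ?thesis by (simp add: g_def)
      qed
    qed
    also have "\<dots> = ennreal K * (\<integral>\<^sup>+v. indicator ?S v * ennreal (1 / sqrt (inner_upto ?D v v) ^ ?D) \<partial>?L)"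
      by (rule nn_integral_cmult) measurable
    also have "\<dots> \<le> ennreal K * ennreal (2 * real ?D * unit_ball_vol ?D * ln (1 / h / (1 - 2 * \<epsilon> k)))"
    proof (intro mult_left_mono radial_integral_le)
      have "1 - 2 * \<epsilon> k \<le> 1" using \<epsilon>[of k] by simp
      also have "1 \<le> 1 / h" using h by simp
      finally show "1 - 2 * \<epsilon> k \<le> 1 / h" .
      show "0 < 1 - 2 * \<epsilon> k" using \<epsilon>[of k] by simp
    qed auto
    also have "\<dots> = ennreal (K * (2 * real ?D * unit_ball_vol ?D * ln (1 / h / (1 - 2 * \<epsilon> k))))"
    proof (rule ennreal_mult[symmetric, OF K])
      have "h * (1 - 2 * \<epsilon> k) \<le> 1" using h \<epsilon>[of k] by (intro mult_le_one) auto
      moreover have "h * (1 - 2 * \<epsilon> k) > 0" using h \<epsilon>[of k] by (intro mult_pos_pos) auto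
      ultimately have "1 \<le> 1 / h / (1 - 2 * \<epsilon> k)" by simp
      then show "0 \<le> 2 * real ?D * unit_ball_vol ?D * ln (1 / h / (1 - 2 * \<epsilon> k))"
        by (intro mult_nonneg_nonneg ln_ge_zero) auto
    qed
    \<comment> \<open>All powers of \<open>\<epsilon> k\<close> cancel: e + 1 of them stand in the
      denominator of \<open>C k\<close>, and e + 1 come from the independent slab events.\<close>
    also have "K = 2 ^ e * \<rho> ^ e * (q * ?\<rho>' ^ (e - 2)) ^ ?D"
    proof -
      have "K = 1 / (2 * \<epsilon> k) * (\<rho> / \<epsilon> k) ^ e * ((2 * \<epsilon> k) ^ ?D * (q * ?\<rho>' ^ (e - 2)) ^ ?D)"
        by (simp only: K_def C_def mult.assoc power_mult_distrib[symmetric])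
      also have "\<dots> = (1 / (2 * \<epsilon> k) * (2 * \<epsilon> k)) * (\<rho> / \<epsilon> k * (2 * \<epsilon> k)) ^ e * (q * ?\<rho>' ^ (e - 2)) ^ ?D"
        by (simp only: power_mult_distrib power_Suc mult_ac)
      also have "\<rho> / \<epsilon> k * (2 * \<epsilon> k) = 2 * \<rho>" using \<epsilon>(1)[of k] by simp
      also have "1 / (2 * \<epsilon> k) * (2 * \<epsilon> k) = 1" using \<epsilon>(1)[of k] by simp
      finally show ?thesis by (simp only: mult_1 power_mult_distrib)
    qed
    finally show ?thesis by (simp only: G_def)
  qed
  have "\<epsilon> \<longlonglongrightarrow> 0" unfolding \<epsilon>_def by real_asymp
  then have "G \<longlonglongrightarrow> 2 ^ e * \<rho> ^ e * (q * sqrt (1 - ((1 - 0) * h)\<^sup>2) ^ (e - 2)) ^ ?D *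
      (2 * real ?D * unit_ball_vol ?D * ln (1 / h / (1 - 2 * 0)))"
    unfolding G_def using h by (intro tendsto_intros) auto
  then have "(\<lambda>k. ennreal (G k)) \<longlonglongrightarrow> ennreal (2 ^ e * \<rho> ^ e * (q * \<rho> ^ (e - 2)) ^ ?D *
      (2 * real ?D * unit_ball_vol ?D * ln (1 / h)))"
    by (intro tendsto_ennrealI) (simp add: \<rho>_def)
  then have lim: "liminf (\<lambda>k. ennreal (G k)) = ennreal (2 ^ e * \<rho> ^ e * (q * \<rho> ^ (e - 2)) ^ ?D *
      (2 * real ?D * unit_ball_vol ?D * ln (1 / h)))"
    by (intro lim_imp_Liminf) auto
  have "emeasure ?M Q = (\<integral>\<^sup>+X. indicator Q X \<partial>?M)" using Q by simp
  also have "\<dots> \<le> (\<integral>\<^sup>+X. liminf (\<lambda>k. \<integral>\<^sup>+v. g k X v \<partial>?L) \<partial>?M)"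
    using AE_ge by (rule nn_integral_mono_AE)
  also have "\<dots> \<le> liminf (\<lambda>k. \<integral>\<^sup>+X. (\<integral>\<^sup>+v. g k X v \<partial>?L) \<partial>?M)"
    by (rule nn_integral_liminf[OF meas_g'])
  also have "\<dots> \<le> liminf (\<lambda>k. ennreal (G k))"
    using int_le by (intro Liminf_mono always_eventually allI)
  finally have "emeasure ?M Q \<le> ennreal (2 ^ e * \<rho> ^ e * (q * \<rho> ^ (e - 2)) ^ ?D *
      (2 * real ?D * unit_ball_vol ?D * ln (1 / h)))" unfolding lim .
  moreover have "0 \<le> 2 ^ e * \<rho> ^ e * (q * \<rho> ^ (e - 2)) ^ ?D * (2 * real ?D * unit_ball_vol ?D * ln (1 / h))"
    using h \<rho> by (intro mult_nonneg_nonneg ln_ge_zero) (auto simp: q_def)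
  ultimately show ?thesis
    using finite_measure.emeasure_eq_measure[OF prob_space.finite_measure[OF PM], of Q]
    by (simp only: q_def[symmetric] \<rho>_def[symmetric] ennreal_le_iff)
qed

text \<open>Two points on a line of height above h have inner product at least s = 2 h^2 - 1, so one
  of them lies in a cap around the other, whose measure is known. If s < 0 then 1 - h^2 > 1/2 and
  the claimed bound exceeds 1.\<close>

lemma high_facet_prob_le_dim2:
  assumes I: "I \<subseteq> {..<n}" "card I = 2" and h: "0 < h" "h < 1"
    and Q: "Q \<in> sets (points 2 {..<n})"
    and sub: "\<And>X. X \<in> Q \<Longrightarrow> \<exists>v. inner_upto 2 v v < (1 / h)\<^sup>2 \<and> (\<forall>i\<in>I. inner_upto 2 (X i) v = 1)"
  shows "measure (points 2 {..<n}) Q \<le> 2 * sqrt (1 - h\<^sup>2)"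
proof -
  let ?M = "points 2 {..<n}" and ?S = "uniform_sphere 2"
  have PM: "prob_space ?M" by (rule prob_space_points) simp
  interpret product_prob_space "\<lambda>_ :: nat. ?S" by (rule points_product_prob_space) simp
  obtain i j where ij: "I = {i, j}" "i \<noteq> j" using I(2) by (auto simp: card_2_iff)
  have h2: "h\<^sup>2 < 1" using h by (simp add: power_less_one_iff)
  define s where "s = 2 * h\<^sup>2 - 1"
  show ?thesis
  proof (cases "s \<ge> 0")
    case False
    then have "1 \<le> 2 * (1 - h\<^sup>2)" by (simp add: s_def)
    then have "1 \<le> 4 * (1 - h\<^sup>2)" using h2 by linarith
    then have "sqrt 1 \<le> sqrt (4 * (1 - h\<^sup>2))" by (rule real_sqrt_le_mono)
    also have "sqrt (4 * (1 - h\<^sup>2)) = 2 * sqrt (1 - h\<^sup>2)" unfolding real_sqrt_mult by simp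
    finally have "1 \<le> 2 * sqrt (1 - h\<^sup>2)" by simp
    then show ?thesis using prob_space.prob_le_1[OF PM, of Q] by linarith
  next
    case True
    have s1: "s \<le> 1" using h2 by (simp add: s_def)
    let ?Q = "{X \<in> space ?M. inner_upto 2 (X i) (X i) = 1 \<and> s \<le> inner_upto 2 (X j) (X i)}"
    have m: "(\<lambda>X. inner_upto 2 (X a) (X b)) \<in> borel_measurable ?M" if "a \<in> I" "b \<in> I" for a b
      using I that by (intro inner_upto_measurable points_coordinate_measurable) auto
    have [measurable]: "(\<lambda>X. inner_upto 2 (X i) (X i)) \<in> borel_measurable ?M"
      "(\<lambda>X. inner_upto 2 (X j) (X i)) \<in> borel_measurable ?M" using m ij by auto
    have Q': "?Q \<in> sets ?M" by measurable
    have "AE X in ?M. \<forall>i\<in>I. inner_upto 2 (X i) (X i) = 1"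
    proof (intro AE_finite_allI)
      show "finite I" using finite_subset[OF I(1)] by simp
      fix i assume "i \<in> I"
      then show "AE X in ?M. inner_upto 2 (X i) (X i) = 1"
        using I by (intro AE_PiM_component prob_space_uniform_sphere AE_uniform_sphere_unit) auto
    qed
    then have "AE X in ?M. X \<in> Q \<longrightarrow> X \<in> ?Q"
      using AE_space[of ?M]
    proof eventually_elim
      case (elim X)
      show ?case
      proof
        assume "X \<in> Q"
        then obtain v where v: "inner_upto 2 v v < (1 / h)\<^sup>2" "\<forall>i\<in>I. inner_upto 2 (X i) v = 1" using sub by blast
        have "inner_upto 2 (X j) (X i) \<ge> 2 * h\<^sup>2 - 1"
          by (rule inner_ge_of_common_height[OF _ _ _ _ v(1) h(1)]) (use elim v ij in auto)
        then show "X \<in> ?Q" using elim ij by (simp add: s_def)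
      qed
    qed
    then have "emeasure ?M Q \<le> emeasure ?M ?Q" using Q' by (rule emeasure_mono_AE)
    also have "\<dots> = (\<integral>\<^sup>+X. indicator ?Q X \<partial>?M)" using Q' by simp
    also have "\<dots> = (\<integral>\<^sup>+X. (\<integral>\<^sup>+y. indicator ?Q (X(j := y)) \<partial>?S) \<partial>points 2 ({..<n} - {j}))"
    proof -
      have "insert j ({..<n} - {j}) = {..<n}" using I ij by auto
      then show ?thesis
        using product_nn_integral_insert[of "{..<n} - {j}" j "indicator ?Q"] Q' by simp
    qed
    also have "\<dots> \<le> (\<integral>\<^sup>+X. ennreal (2 * sqrt (1 - h\<^sup>2)) \<partial>points 2 ({..<n} - {j}))"
    proof (rule nn_integral_mono)
      fix X assume "X \<in> space (points 2 ({..<n} - {j}))"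
      show "(\<integral>\<^sup>+y. indicator ?Q (X(j := y)) \<partial>?S) \<le> ennreal (2 * sqrt (1 - h\<^sup>2))"
      proof (cases "inner_upto 2 (X i) (X i) = 1")
        case False
        then have "(\<integral>\<^sup>+y. indicator ?Q (X(j := y)) \<partial>?S) = (\<integral>\<^sup>+y. 0 \<partial>?S)"
          using ij by (intro nn_integral_cong) (auto simp: indicator_def)
        then show ?thesis by simp
      next
        case u: True
        let ?A = "{y \<in> space ?S. s \<le> inner_upto 2 y (X i)}"
        have A: "?A \<in> sets ?S" using sphere_inner_measurable[of 2 "X i"] by measurable
        have "(\<integral>\<^sup>+y. indicator ?Q (X(j := y)) \<partial>?S) \<le> (\<integral>\<^sup>+y. indicator ?A y \<partial>?S)"
          using ij by (intro nn_integral_mono) (auto simp: indicator_def)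
        also have "\<dots> = ennreal (measure ?S ?A)" using A by (simp add: M.emeasure_eq_measure)
        also have "ennreal (measure ?S ?A) \<le> ennreal (2 * sqrt (1 - h\<^sup>2))"
        proof (rule ennreal_leI)
          have "measure ?S ?A = cone_volume 1 s / unit_ball_vol 2"
            using cap_measure[of 1 "X i" s] u True s1 by (simp add: numeral_2_eq_2)
          also have "\<dots> \<le> 2 * sqrt (1 - h\<^sup>2)"
          proof -
            have "1 - s\<^sup>2 = 4 * h\<^sup>2 * (1 - h\<^sup>2)" by (simp add: s_def power2_eq_square algebra_simps)
            also have "\<dots> \<le> 4 * 1 * (1 - h\<^sup>2)" using h2 by (intro mult_right_mono mult_left_mono) auto
            finally have "1 - s\<^sup>2 \<le> 4 * (1 - h\<^sup>2)" by simp
            then have "sqrt (1 - s\<^sup>2) \<le> sqrt (4 * (1 - h\<^sup>2))" by (rule real_sqrt_le_mono)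
            also have "sqrt (4 * (1 - h\<^sup>2)) = 2 * sqrt (1 - h\<^sup>2)" unfolding real_sqrt_mult by simp
            finally have "sqrt (1 - s\<^sup>2) \<le> 2 * sqrt (1 - h\<^sup>2)" .
            then have "cone_volume 1 s \<le> 3 * (2 * sqrt (1 - h\<^sup>2))"
              using cone_volume_le_dim1[OF True s1] by linarith
            also have "\<dots> \<le> pi * (2 * sqrt (1 - h\<^sup>2))"
              using h2 pi_gt3 by (intro mult_right_mono) auto
            also have "pi = unit_ball_vol 2" by (simp add: eval_unit_ball_vol)
            finally show ?thesis by (simp add: eval_unit_ball_vol divide_le_eq mult.commute)
          qed
          finally show "measure ?S ?A \<le> 2 * sqrt (1 - h\<^sup>2)" .
        qed
        finally show ?thesis .
      qed
    qed
    also have "\<dots> = ennreal (2 * sqrt (1 - h\<^sup>2))"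
      by (simp add: prob_space.emeasure_space_1[OF prob_space_points])
    finally show ?thesis
      using h2 finite_measure.emeasure_eq_measure[OF prob_space.finite_measure[OF PM], of Q]
      by (simp add: ennreal_le_iff)
  qed
qed

section \<open>Volumes of unit balls and binomial coefficients\<close>

lemma Gamma_half_step:
  fixes x :: real
  assumes "x > 0"
  shows "(Gamma (x + 1/2))\<^sup>2 \<le> Gamma x * Gamma (x + 1)"
proof -
  have pos: "Gamma x > 0" "Gamma (x + 1) > 0" "Gamma (x + 1/2) > 0" using assms by auto
  have "(ln \<circ> Gamma) ((1 - 1/2) *\<^sub>R x + (1/2) *\<^sub>R (x + 1)) \<le> (1 - 1/2) * (ln \<circ> Gamma) x + (1/2) * (ln \<circ> Gamma) (x + 1)"
    using assms by (intro convex_onD[OF log_convex_Gamma_real]) auto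
  moreover have "(1 - 1/2) *\<^sub>R x + (1/2) *\<^sub>R (x + 1) = x + 1/2" by (simp add: field_simps)
  ultimately have "ln (Gamma (x + 1/2)) \<le> 1/2 * ln (Gamma x) + 1/2 * ln (Gamma (x + 1))" by simp
  then have "ln ((Gamma (x + 1/2))\<^sup>2) \<le> ln (Gamma x * Gamma (x + 1))"
    using pos by (simp add: ln_realpow ln_mult)
  then show ?thesis using pos by (subst (asm) ln_le_cancel_iff) auto
qed

text \<open>The normalising quotient of the slab probabilities. It is of order sqrt d.\<close>

definition ball_ratio :: "nat \<Rightarrow> real" where
  "ball_ratio d = unit_ball_vol (real (d - 1)) / unit_ball_vol (real d)"

lemma ball_ratio_eq:
  assumes "d \<ge> 1"
  shows "ball_ratio d = Gamma (real d / 2 + 1) / (sqrt pi * Gamma (real d / 2 + 1 / 2))"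
proof -
  have r: "real (d - 1) = real d - 1" using assms by simp
  have e1: "(real d - 1) / 2 + 1 = real d / 2 + 1 / 2" by (simp add: field_simps)
  have e2: "pi powr (real d / 2) = pi powr ((real d - 1) / 2) * sqrt pi"
  proof -
    have "real d / 2 = (real d - 1) / 2 + 1 / 2" by (simp add: field_simps)
    then have "pi powr (real d / 2) = pi powr ((real d - 1) / 2) * pi powr (1 / 2)" by (metis powr_add)
    then show ?thesis by (simp add: powr_half_sqrt)
  qed
  show ?thesis
    unfolding ball_ratio_def unit_ball_vol_def r e1 e2 by simp
qed

text \<open>The square of the quotient is a quotient of Gamma values half a unit apart.
  \<open>Gamma_half_step\<close> at d/2 gives the lower bound, at d/2 + 1/2 the upper one.\<close>

lemma ball_ratio_bounds:
  assumes "d \<ge> 1"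
  shows "(ball_ratio d)\<^sup>2 \<le> d" "real d / 9 \<le> (ball_ratio d)\<^sup>2" "ball_ratio d > 0"
proof -
  define x where "x = real d / 2"
  have x: "x > 0" "x \<ge> 1 / 2" using assms by (auto simp: x_def)
  let ?G = "Gamma (x + 1/2)"
  have pos: "?G > 0" "Gamma x > 0" "Gamma (x + 1) > 0" using x by auto
  have sq: "(ball_ratio d)\<^sup>2 = (Gamma (x + 1))\<^sup>2 / (pi * ?G\<^sup>2)"
    unfolding ball_ratio_eq[OF assms] by (simp add: x_def power_divide power_mult_distrib)
  have G1: "Gamma (x + 1) = x * Gamma x" using x by (intro Gamma_plus1) (auto elim!: nonpos_Ints_cases')
  have "?G\<^sup>2 * x \<le> (Gamma (x + 1))\<^sup>2"
    using mult_right_mono[OF Gamma_half_step[OF x(1)], of x] x by (simp add: G1 power2_eq_square mult_ac)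
  then have "x / pi \<le> (ball_ratio d)\<^sup>2"
    unfolding sq using pos by (simp add: field_simps)
  moreover have "real d / 9 \<le> x / pi"
    using pi_less_4 assms by (simp add: x_def field_simps)
  ultimately show "real d / 9 \<le> (ball_ratio d)\<^sup>2" by linarith
  have "(Gamma (x + 1))\<^sup>2 \<le> ?G * Gamma (x + 1/2 + 1)"
    using Gamma_half_step[of "x + 1/2"] x by (simp add: add.assoc)
  also have "Gamma (x + 1/2 + 1) = (x + 1/2) * ?G" using x by (intro Gamma_plus1) (auto elim!: nonpos_Ints_cases')
  finally have "(Gamma (x + 1))\<^sup>2 \<le> (x + 1/2) * ?G\<^sup>2" by (simp add: power2_eq_square mult_ac)
  also have "\<dots> \<le> (real d * pi) * ?G\<^sup>2"
  proof (rule mult_right_mono)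
    have "x + 1/2 \<le> real d * 1" using assms by (simp add: x_def)
    also have "\<dots> \<le> real d * pi" using pi_gt3 by (intro mult_left_mono) auto
    finally show "x + 1/2 \<le> real d * pi" .
  qed simp
  finally show "(ball_ratio d)\<^sup>2 \<le> d" unfolding sq using pos by (simp add: divide_le_eq mult_ac)
  show "ball_ratio d > 0" by (simp add: ball_ratio_def)
qed

text \<open>Iterates the lower bound d/9 on the squared ratio of consecutive volumes. The resulting
  decay like (d!)^(-1/2) is what compensates the d-th power of \<open>ball_ratio d\<close>.\<close>

lemma unit_ball_vol_sq_fact: "(unit_ball_vol (real d))\<^sup>2 * fact d \<le> 9 ^ d"
proof (induction d)
  case (Suc d)
  have q: "real (Suc d) / 9 \<le> (ball_ratio (Suc d))\<^sup>2" "ball_ratio (Suc d) > 0"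
    using ball_ratio_bounds[of "Suc d"] by auto
  have "unit_ball_vol (real (Suc d)) * ball_ratio (Suc d) = unit_ball_vol (real d)"
    using unit_ball_vol_pos[of "real (Suc d)"] by (simp add: ball_ratio_def del: of_nat_Suc unit_ball_vol_pos)
  then have eq: "(unit_ball_vol (real (Suc d)))\<^sup>2 * (ball_ratio (Suc d))\<^sup>2 = (unit_ball_vol (real d))\<^sup>2"
    by (metis power_mult_distrib)
  have "(unit_ball_vol (real (Suc d)))\<^sup>2 * (real (Suc d) / 9) \<le> (unit_ball_vol (real d))\<^sup>2"
    unfolding eq[symmetric] by (intro mult_left_mono q) simp
  then have "9 * fact d * ((unit_ball_vol (real (Suc d)))\<^sup>2 * (real (Suc d) / 9)) \<le> 9 * fact d * (unit_ball_vol (real d))\<^sup>2"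
    by (rule mult_left_mono) simp
  then have "(unit_ball_vol (real (Suc d)))\<^sup>2 * real (Suc d) * fact d \<le> 9 * ((unit_ball_vol (real d))\<^sup>2 * fact d)"
    by (simp add: mult_ac del: of_nat_Suc)
  also have "\<dots> \<le> 9 * 9 ^ d" using Suc by simp
  finally show ?case by (simp add: mult_ac del: of_nat_Suc)
qed simp

text \<open>A weak Stirling bound: a single term of the exponential series at d is at most its
  sum.\<close>

lemma power_le_exp_fact: "real d ^ d \<le> exp (real d) * fact d"
proof -
  have "(\<Sum>k\<in>{d}. real d ^ k /\<^sub>R fact k) \<le> (\<Sum>k. real d ^ k /\<^sub>R fact k)"
    using summable_exp_generic[of "real d"] by (intro sum_le_suminf) auto
  then have "real d ^ d / fact d \<le> exp (real d)" by (simp add: exp_def divide_inverse mult.commute)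
  then show ?thesis by (simp add: divide_le_eq mult.commute)
qed

lemma ball_ratio_power_le:
  assumes "d \<ge> 1"
  shows "ball_ratio d ^ d * unit_ball_vol (real d) \<le> 6 ^ d"
proof -
  note q = ball_ratio_bounds[OF assms]
  \<comment> \<open>The base 4 instead of 3 makes the product with 9 the square of 6.\<close>
  have e: "exp (real d) \<le> 4 ^ d"
  proof -
    have "exp (real d) = exp 1 ^ d" by (simp add: exp_of_nat_mult[symmetric])
    also have "\<dots> \<le> 4 ^ d" using exp_le by (intro power_mono) auto
    finally show ?thesis .
  qed
  have "(ball_ratio d ^ d * unit_ball_vol (real d))\<^sup>2 = ((ball_ratio d)\<^sup>2) ^ d * (unit_ball_vol (real d))\<^sup>2"
    by (simp add: power_mult_distrib power_mult[symmetric] mult.commute)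
  also have "\<dots> \<le> real d ^ d * (unit_ball_vol (real d))\<^sup>2"
    using q by (intro mult_right_mono power_mono) auto
  also have "\<dots> \<le> exp (real d) * fact d * (unit_ball_vol (real d))\<^sup>2"
    by (intro mult_right_mono power_le_exp_fact) simp
  also have "\<dots> = exp (real d) * ((unit_ball_vol (real d))\<^sup>2 * fact d)" by simp
  also have "\<dots> \<le> 4 ^ d * 9 ^ d" by (intro mult_mono e unit_ball_vol_sq_fact) auto
  also have "\<dots> = (6 ^ d)\<^sup>2" by (simp add: power2_eq_square flip: power_mult_distrib)
  finally show ?thesis by (rule power2_le_imp_le) simp
qed

lemma choose_le_exp:
  assumes "d \<ge> 1" "d \<le> n"
  shows "real (n choose d) \<le> (exp 1 * (real n / real d)) ^ d"
proof -
  have "real ((n choose d) * fact d) \<le> real (n ^ d)"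
    using binomial_fact_pow[of n d] by (simp only: of_nat_le_iff)
  then have c: "real (n choose d) * fact d \<le> real n ^ d" by simp
  have "real (n choose d) * real d ^ d \<le> real (n choose d) * (exp (real d) * fact d)"
    by (intro mult_left_mono power_le_exp_fact) simp
  also have "\<dots> = exp (real d) * (real (n choose d) * fact d)" by simp
  also have "\<dots> \<le> exp (real d) * real n ^ d" by (intro mult_left_mono c) simp
  also have "exp (real d) = exp 1 ^ d" by (simp add: exp_of_nat_mult[symmetric])
  finally have "real (n choose d) \<le> exp 1 ^ d * real n ^ d / real d ^ d"
    using assms by (simp add: le_divide_eq)
  then show ?thesis by (simp add: power_mult_distrib power_divide)
qed

text \<open>The exponent is the sum of d - 1 from Hadamard's bound, (d - 3) d from the d slab
  events, and 2 from the thin shell, through ln (1/h) \<le> \<rho>^2 / h. The constant is 24 = 2 * 2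
  * 6, where one power 2^d absorbs the factor d and 6^d is the bound of
  \<open>ball_ratio_power_le\<close>.\<close>

lemma high_facet_prob_le':
  assumes d: "d \<ge> 2" and I: "I \<subseteq> {..<n}" "card I = d" and h: "0 < h" "h < 1"
    and Q: "Q \<in> sets (points d {..<n})"
    and sub: "\<And>X. X \<in> Q \<Longrightarrow> \<exists>v. inner_upto d v v < (1 / h)\<^sup>2 \<and> (\<forall>i\<in>I. inner_upto d (X i) v = 1)"
  shows "measure (points d {..<n}) Q \<le> 24 ^ d * sqrt (1 - h\<^sup>2) ^ ((d - 1)\<^sup>2) / h"
proof -
  define \<rho> where "\<rho> = sqrt (1 - h\<^sup>2)"
  have h2: "h\<^sup>2 < 1" using h by (simp add: power_less_one_iff)
  then have \<rho>: "\<rho> > 0" "\<rho>\<^sup>2 = 1 - h\<^sup>2" by (auto simp: \<rho>_def)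
  show ?thesis
  proof (cases "d = 2")
    case True
    have "measure (points d {..<n}) Q \<le> 2 * \<rho>"
      unfolding \<rho>_def True using I Q sub h unfolding True by (intro high_facet_prob_le_dim2) auto
    also have "\<dots> \<le> 24 ^ d * \<rho> * (1 / h)"
      using h \<rho> True by (simp add: field_simps)
    finally show ?thesis using True by (simp add: \<rho>_def)
  next
    case False
    define k where "k = d - 3"
    have k: "d = Suc (Suc (Suc k))" using False d by (simp add: k_def)
    define e where "e = Suc (Suc k)"
    have de: "d = Suc e" "e \<ge> 2" by (simp_all add: k e_def)
    have "measure (points d {..<n}) Q \<le> 2 ^ e * \<rho> ^ e *
      ((unit_ball_vol e / unit_ball_vol (Suc e)) * \<rho> ^ (e - 2)) ^ Suc e *
      (2 * real (Suc e) * unit_ball_vol (Suc e) * ln (1 / h))"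
      unfolding \<rho>_def de(1) using I Q sub h unfolding de(1) by (intro high_facet_prob_le de(2)) auto
    also have "unit_ball_vol e / unit_ball_vol (Suc e) = ball_ratio d"
      by (simp add: ball_ratio_def de)
    also have "2 ^ e * \<rho> ^ e * (ball_ratio d * \<rho> ^ (e - 2)) ^ Suc e * (2 * real (Suc e) * unit_ball_vol (Suc e) * ln (1 / h)) =
        (2 ^ d * real d * (ball_ratio d ^ d * unit_ball_vol d)) * (\<rho> ^ (e + (e - 2) * d) * ln (1 / h))"
    proof -
      have p: "(ball_ratio d * \<rho> ^ (e - 2)) ^ Suc e = ball_ratio d ^ Suc e * \<rho> ^ ((e - 2) * d)"
        unfolding de(1) by (simp only: power_mult_distrib power_mult[symmetric])
      have "(2::real) ^ d = 2 ^ e * 2" "ball_ratio d ^ d = ball_ratio d ^ Suc e" by (simp_all add: de(1))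
      then show ?thesis unfolding p power_add by (simp only: de(1)[symmetric] mult_ac)
    qed
    also have "\<dots> \<le> (2 ^ d * 2 ^ d * 6 ^ d) * (\<rho> ^ (e + (e - 2) * d) * (\<rho>\<^sup>2 / h))"
    proof (intro mult_mono)
      show "real d \<le> 2 ^ d" using of_nat_less_two_power[of d, where 'a = real] by simp
      show "ball_ratio d ^ d * unit_ball_vol d \<le> 6 ^ d" using d by (intro ball_ratio_power_le) simp
      have "ln (1 / h) \<le> 1 / h - 1" using h by (intro ln_le_minus_one) simp
      also have "\<dots> = (1 - h) / h" using h by (simp add: field_simps)
      also have "\<dots> \<le> (1 - h\<^sup>2) / h"
        using h by (intro divide_right_mono) (auto simp: power2_eq_square mult_left_le)
      finally show "ln (1 / h) \<le> \<rho>\<^sup>2 / h" by (simp add: \<rho>)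
      show "0 \<le> ball_ratio d ^ d * unit_ball_vol d" by (simp add: ball_ratio_def)
    qed (use h \<rho> in \<open>auto simp: ball_ratio_def ln_ge_zero\<close>)
    also have "\<dots> = (2 * 2 * 6) ^ d * \<rho> ^ (e + (e - 2) * d + 2) / h"
      by (simp only: power_mult_distrib power_add) simp
    also have "e + (e - 2) * d + 2 = (d - 1)\<^sup>2"
      by (simp add: k e_def power2_eq_square)
    finally show ?thesis by (simp add: \<rho>_def)
  qed
qed

text \<open>From s = 1/2 on the cone alone suffices. Below 1/2 the zone between s and 2s is used: as
  s^2 (d + 1) \<ge> 1, the term at 2s is at most half the term at s. In both cases
  \<open>ball_ratio d\<close>, at least sqrt d / 3, turns a denominator of order d into sqrt
  d.\<close>

lemma cap_ratio_ge:
  assumes d: "d \<ge> 2" and s: "0 < s" "s \<le> 1" and s2: "s\<^sup>2 * (real d + 1) \<ge> 1"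
  shows "cone_volume (d - 1) s / unit_ball_vol d \<ge> sqrt (1 - s\<^sup>2) ^ (d - 1) / (32 * s * sqrt d)"
proof -
  define \<rho> where "\<rho> = sqrt (1 - s\<^sup>2)"
  have s21: "s\<^sup>2 \<le> 1" using s by (simp add: power_le_one)
  have \<rho>: "\<rho> \<ge> 0" "\<rho>\<^sup>2 = 1 - s\<^sup>2" using s21 by (auto simp: \<rho>_def)
  define q where "q = ball_ratio d"
  have d0: "real d > 0" using d by simp
  have q: "sqrt d / 3 \<le> q"
  proof (rule power2_le_imp_le)
    show "(sqrt d / 3)\<^sup>2 \<le> q\<^sup>2" using ball_ratio_bounds(2)[of d] d by (simp add: q_def power_divide)
    show "0 \<le> q" using ball_ratio_bounds(3)[of d] d by (simp add: q_def)
  qed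
  have sqd: "sqrt d * sqrt d = real d" "sqrt d > 0" using d0 by auto
  have d1: "real (d - 1) + 1 = real d" using d by simp
  have V: "unit_ball_vol (real d) > 0" by simp
  show ?thesis
  proof (cases "s \<ge> 1 / 2")
    case True
    have "\<rho> ^ (d - 1) / (32 * s * sqrt d) \<le> s * \<rho> ^ (d - 1) / (3 * sqrt d)"
    proof -
      have "1 / 2 * (1 / 2) \<le> s * s" using True by (intro mult_mono) auto
      then have "3 \<le> 32 * s * s" by simp
      then have "3 * \<rho> ^ (d - 1) \<le> 32 * s * s * \<rho> ^ (d - 1)" using \<rho> by (intro mult_right_mono) auto
      then show ?thesis using s sqd by (simp add: field_simps)
    qed
    also have "\<dots> = sqrt d / 3 * (s * \<rho> ^ (d - 1) / d)" using sqd by (simp add: field_simps)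
    also have "\<dots> \<le> q * (s * \<rho> ^ (d - 1) / d)" using q s \<rho> by (intro mult_right_mono) auto
    also have "\<dots> = unit_ball_vol (real (d - 1)) * (s * \<rho> ^ (d - 1) / (real (d - 1) + 1)) / unit_ball_vol d"
      unfolding d1 by (simp add: q_def ball_ratio_def)
    also have "\<dots> \<le> cone_volume (d - 1) s / unit_ball_vol d"
      unfolding \<rho>_def using s by (intro divide_right_mono cone_volume_ge_linear) auto
    finally show ?thesis by (simp add: \<rho>_def)
  next
    case False
    have s4: "s\<^sup>2 \<le> 1 / 4"
      using False s power_mono[of s "1/2" 2] by (simp add: power_divide)
    have dd: "d - 1 + 2 = d + 1" "real (d - 1) + 2 = real d + 1" using d by auto
    \<comment> \<open>From 1 - 4 s^2 \<le> (1 - s^2)(1 - 3 s^2): doubling the height costs a factor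
      exp (- 3/2 s^2), whose (d + 1)-st power is at most exp (-1) by \<open>s2\<close>.\<close>
    have "sqrt (1 - (2 * s)\<^sup>2) \<le> \<rho> * exp (- (3 / 2 * s\<^sup>2))"
    proof (rule real_le_lsqrt)
      have "1 - (2 * s)\<^sup>2 \<le> (1 - s\<^sup>2) * (1 - 3 * s\<^sup>2)"
      proof -
        have "(1 - s\<^sup>2) * (1 - 3 * s\<^sup>2) = 1 - (2 * s)\<^sup>2 + 3 * (s\<^sup>2)\<^sup>2"
          by (simp add: power2_eq_square algebra_simps)
        then show ?thesis by simp
      qed
      also have "\<dots> \<le> (1 - s\<^sup>2) * exp (- (3 * s\<^sup>2))"
        using exp_ge_add_one_self[of "- (3 * s\<^sup>2)"] s21 by (intro mult_left_mono) auto
      also have "\<dots> = (\<rho> * exp (- (3 / 2 * s\<^sup>2)))\<^sup>2"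
        unfolding power_mult_distrib \<rho>(2) by (simp add: exp_double[symmetric])
      finally show "1 - (2 * s)\<^sup>2 \<le> (\<rho> * exp (- (3 / 2 * s\<^sup>2)))\<^sup>2" .
    qed (use \<rho> in auto)
    then have "sqrt (1 - (2 * s)\<^sup>2) ^ (d + 1) \<le> (\<rho> * exp (- (3 / 2 * s\<^sup>2))) ^ (d + 1)"
      using s4 by (intro power_mono) (auto simp: power_mult_distrib)
    also have "\<dots> = \<rho> ^ (d + 1) * exp (- (3 / 2 * s\<^sup>2)) ^ (d + 1)" by (simp only: power_mult_distrib)
    also have "exp (- (3 / 2 * s\<^sup>2)) ^ (d + 1) = exp (- (3 / 2 * (s\<^sup>2 * (real d + 1))))"
      by (simp only: exp_of_nat_mult[symmetric]) (simp add: algebra_simps)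
    also have "\<rho> ^ (d + 1) * exp (- (3 / 2 * (s\<^sup>2 * (real d + 1)))) \<le> \<rho> ^ (d + 1) * (1 / 2)"
    proof (intro mult_left_mono)
      have "exp (- (3 / 2 * (s\<^sup>2 * (real d + 1)))) \<le> exp (- 1)" using s2 by simp
      also have "\<dots> = 1 / exp 1" by (simp add: exp_minus inverse_eq_divide)
      also have "\<dots> \<le> 1 / 2" using exp_ge_add_one_self[of 1] by (intro divide_left_mono) auto
      finally show "exp (- (3 / 2 * (s\<^sup>2 * (real d + 1)))) \<le> 1 / 2" .
    qed (use \<rho> in simp)
    finally have half: "\<rho> ^ (d + 1) / 2 \<le> \<rho> ^ (d + 1) - sqrt (1 - (2 * s)\<^sup>2) ^ (d + 1)" by simp
    have "\<rho> ^ (d - 1) / (32 * s * sqrt d) = sqrt d / 3 * (3 / 4 * \<rho> ^ (d - 1) / (4 * s * (2 * d)))"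
      using sqd s by (simp add: field_simps)
    also have "\<dots> \<le> q * (\<rho> ^ (d + 1) / 2 / (2 * s * (real d + 1)))"
    proof (rule mult_mono[OF q])
      have "\<rho> ^ (d + 1) = \<rho>\<^sup>2 * \<rho> ^ (d - 1)" using d by (simp flip: power_add)
      also have "\<dots> \<ge> 3 / 4 * \<rho> ^ (d - 1)" using s4 \<rho> by (intro mult_right_mono) auto
      finally have "3 / 4 * \<rho> ^ (d - 1) / (4 * s * (2 * d)) \<le> \<rho> ^ (d + 1) / (4 * s * (real d + 1))"
        using s d \<rho> by (intro frac_le mult_left_mono) auto
      then show "3 / 4 * \<rho> ^ (d - 1) / (4 * s * (2 * d)) \<le> \<rho> ^ (d + 1) / 2 / (2 * s * (real d + 1))" by (simp add: mult_ac)
    qed (use ball_ratio_bounds(3)[of d] d \<rho> s in \<open>auto simp: q_def\<close>)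
    also have "\<dots> \<le> q * ((\<rho> ^ (d + 1) - sqrt (1 - (2 * s)\<^sup>2) ^ (d + 1)) / (2 * s * (real d + 1)))"
      using ball_ratio_bounds(3)[of d] d s half by (intro mult_left_mono divide_right_mono) (auto simp: q_def)
    also have "\<dots> = unit_ball_vol (real (d - 1)) *
        ((sqrt (1 - s\<^sup>2) ^ (d - 1 + 2) - sqrt (1 - (2 * s)\<^sup>2) ^ (d - 1 + 2)) / (2 * s * (real (d - 1) + 2))) / unit_ball_vol d"
      unfolding dd by (simp add: q_def ball_ratio_def \<rho>_def)
    also have "\<dots> \<le> cone_volume (d - 1) s / unit_ball_vol d"
      using s False by (intro divide_right_mono cone_volume_ge_diff) auto
    finally show ?thesis by (simp add: \<rho>_def)
  qed
qed

text \<open>A height in [-1, 1] outside [h1, h2] is either at most h1 or larger than h2, whatever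
  the order of h1 and h2. Both cases are bounded for a single index set, and there are
  \<open>n choose d\<close> of them.\<close>

lemma facet_difference_le:
  assumes d: "d \<ge> 2" and h1: "0 \<le> h1" "h1 \<le> 1" and h2: "0 < h2" "h2 < 1"
  shows "\<bar>expected_facets n d (-1) 1 - expected_facets n d h1 h2\<bar> \<le> real (n choose d) *
    (2 * (1 - cone_volume (d - 1) h1 / unit_ball_vol d) ^ (n - d) + 24 ^ d * sqrt (1 - h2\<^sup>2) ^ ((d - 1)\<^sup>2) / h2)"
    (is "_ \<le> _ * (?lo + ?hi)")
proof -
  let ?M = "points d {..<n}" and ?T = "{I. I \<subseteq> {..<n} \<and> card I = d}"
  have d1: "d \<ge> 1" using d by simp
  interpret prob_space ?M using prob_space_points[OF d1] .
  let ?S = "\<lambda>a b I. {X \<in> space ?M. supports_at n d a b I X}"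
  have S: "?S a b I \<in> events" if "I \<in> ?T" for a b I using supports_at_measurable[of I n d] that d1 by auto
  have bound: "0 \<le> prob (?S (-1) 1 I) - prob (?S h1 h2 I) \<and> prob (?S (-1) 1 I) - prob (?S h1 h2 I) \<le> ?lo + ?hi"
    if I: "I \<in> ?T" for I
  proof -
    have I': "I \<subseteq> {..<n}" "card I = d" using I by auto
    have mono: "?S h1 h2 I \<subseteq> ?S (-1) 1 I"
    proof -
      have "{h1..h2} \<subseteq> {-1..1}" using h1 h2 by auto
      then show ?thesis unfolding supports_at_def by blast
    qed
    have diff: "prob (?S (-1) 1 I - ?S h1 h2 I) = prob (?S (-1) 1 I) - prob (?S h1 h2 I)"
      using S[OF I] mono by (intro finite_measure_Diff) auto
    let ?Q = "?S (-1) 1 I - ?S h1 h2 I - ?S (-1) h1 I"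
    have Q: "?Q \<in> events" using S[OF I] by (intro sets.Diff) auto
    have "?S (-1) 1 I - ?S h1 h2 I \<subseteq> ?S (-1) h1 I \<union> ?Q" by blast
    then have "prob (?S (-1) 1 I - ?S h1 h2 I) \<le> prob (?S (-1) h1 I \<union> ?Q)"
      using Q S[OF I] by (intro finite_measure_mono sets.Un) auto
    also have "\<dots> \<le> prob (?S (-1) h1 I) + prob ?Q"
      using Q S[OF I] by (intro measure_Un_le) auto
    also have "prob (?S (-1) h1 I) \<le> ?lo" using low_facet_prob_le[OF d I' h1] .
    also have "prob ?Q \<le> ?hi"
    proof (rule high_facet_prob_le'[OF d I' h2 Q])
      fix X assume X: "X \<in> ?Q"
      then obtain u h where u: "u \<in> topspace (nsphere (d - 1))" "h \<in> {-1..1}"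
        "\<forall>i\<in>I. inner_upto d (X i) u = h" "\<forall>j<n. inner_upto d (X j) u \<le> h"
        unfolding supports_at_def by blast
      have uu: "inner_upto d u u = 1" using u(1) nsphere_iff[OF d1] by blast
      have "\<not> h \<in> {h1..h2}" using X u unfolding supports_at_def by blast
      moreover have "\<not> h \<in> {-1..h1}" using X u unfolding supports_at_def by blast
      ultimately have h: "h2 < h" using u(2) by auto
      \<comment> \<open>The normal of the same hyperplane rescaled to height 1; its length 1/h is
        below 1/h2.\<close>
      let ?v = "\<lambda>k. 1 / h * u k"
      have "inner_upto d ?v ?v = (1 / h)\<^sup>2"
        unfolding inner_upto_scale uu by (simp add: power2_eq_square)
      also have "\<dots> < (1 / h2)\<^sup>2" using h h2 by (intro power_strict_mono) (auto simp: frac_less2)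
      finally have "inner_upto d ?v ?v < (1 / h2)\<^sup>2" .
      moreover have "\<forall>i\<in>I. inner_upto d (X i) ?v = 1"
        using u(3) h h2 unfolding inner_upto_scale by simp
      ultimately show "\<exists>v. inner_upto d v v < (1 / h2)\<^sup>2 \<and> (\<forall>i\<in>I. inner_upto d (X i) v = 1)" by blast
    qed
    finally show ?thesis unfolding diff[symmetric] by simp
  qed
  have eq: "expected_facets n d (-1) 1 - expected_facets n d h1 h2 = (\<Sum>I\<in>?T. prob (?S (-1) 1 I) - prob (?S h1 h2 I))"
    unfolding expected_facets_eq_sum[OF d] by (simp add: sum_subtractf)
  have "(\<Sum>I\<in>?T. prob (?S (-1) 1 I) - prob (?S h1 h2 I)) \<le> (\<Sum>I\<in>?T. ?lo + ?hi)"
    using bound by (intro sum_mono) blast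
  also have "\<dots> = real (n choose d) * (?lo + ?hi)" using n_subsets[of "{..<n}" d] by simp
  finally have "(\<Sum>I\<in>?T. prob (?S (-1) 1 I) - prob (?S h1 h2 I)) \<le> real (n choose d) * (?lo + ?hi)" .
  moreover have "(\<Sum>I\<in>?T. prob (?S (-1) 1 I) - prob (?S h1 h2 I)) \<ge> 0"
    using bound by (intro sum_nonneg) blast
  ultimately show ?thesis unfolding eq by linarith
qed

section \<open>Asymptotics\<close>

text \<open>With y = p ln (1/x) this is 1 - exp (-y) \<ge> y / (1 + y). Both heights have squares of
  the form 1 - x^p, so the lemma shows that they are not smaller than order 1/sqrt d.\<close>

lemma one_minus_powr_ge:
  fixes x p D :: real
  assumes "0 < x" "x < 1" "p > 0" "D > 0" "p * ln (1 / x) * D \<ge> 1"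
  shows "(1 - x powr p) * (D + 1) \<ge> 1"
proof -
  define y where "y = p * ln (1 / x)"
  have y: "y > 0" using assms by (simp add: y_def)
  have "x powr p = exp (- y)" using assms by (simp add: y_def powr_def ln_div)
  also have "\<dots> = 1 / exp y" by (simp add: exp_minus inverse_eq_divide)
  also have "\<dots> \<le> 1 / (1 + y)" using exp_ge_add_one_self[of y] y by (intro divide_left_mono) auto
  finally have "1 - x powr p \<ge> y / (1 + y)" using y by (simp add: field_simps)
  then have "(1 - x powr p) * (D + 1) \<ge> y / (1 + y) * (D + 1)" using assms by (intro mult_right_mono) auto
  moreover have "y / (1 + y) * (D + 1) \<ge> 1"
  proof -
    have "y * D \<ge> 1" using assms by (simp add: y_def)
    then have "1 + y \<le> y * (D + 1)" by (simp add: algebra_simps)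
    then show ?thesis using y by (simp add: le_divide_eq)
  qed
  ultimately show ?thesis by linarith
qed

text \<open>Here \<open>x\<close> is the power \<rho>^(d-1) with \<rho> = sqrt (1 - h^2), which up
  to the factor 32 h sqrt d is a lower bound for the cap. All conditions are on N = n/d, and the
  bound 2/N holds for every d.\<close>

lemma low_term_le:
  fixes n d :: nat and r :: real
  defines "N \<equiv> real n / real d"
  defines "x \<equiv> r * ln N powr (3/2) / N" and "h \<equiv> lower_height r n d"
  assumes d: "d \<ge> 2" and N: "N \<ge> 2" and r: "r \<ge> 384" and L: "ln N \<ge> 2"
    and x1: "x < 1" and lnx: "ln (1 / x) \<ge> ln N / 2"
  shows "0 < h" "h \<le> 1"
    "real (n choose d) * (2 * (1 - cone_volume (d - 1) h / unit_ball_vol d) ^ (n - d)) \<le> 2 / N"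
proof -
  define L where "L = ln N"
  have L2: "L \<ge> 2" using L by (simp add: L_def)
  have d0: "real d > 0" "real d \<ge> 2" "real (d - 1) = real d - 1" using d by auto
  have nd: "real n = N * real d" using d0 by (simp add: N_def)
  have "2 * real d \<le> N * real d" using N d0 by (intro mult_right_mono) auto
  then have n2: "2 * real d \<le> real n" using nd by simp
  have x0: "x > 0" using r N L by (auto simp: x_def intro!: divide_pos_pos mult_pos_pos)
  define p where "p = 2 / (real d - 1)"
  have p: "p > 0" using d0 by (simp add: p_def)
  have xp: "0 < x powr p" "x powr p < 1" using x0 x1 p powr_less_mono2[of p x 1] by auto
  have h_eq: "h = sqrt (1 - x powr p)"
    unfolding h_def lower_height_def p_def x_def N_def by (simp add: mult_ac)
  then have h2: "h\<^sup>2 = 1 - x powr p" using xp by simp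
  show h0: "0 < h" using xp by (simp add: h_eq)
  show h1: "h \<le> 1" using xp by (simp add: h_eq)
  have h2d: "h\<^sup>2 * (real d + 1) \<ge> 1"
    unfolding h2
  proof (rule one_minus_powr_ge[OF x0 x1 p d0(1)])
    have "1 * 1 \<le> ln (1 / x) * (2 * real d / (real d - 1))"
      using lnx L d0 by (intro mult_mono) auto
    then show "1 \<le> p * ln (1 / x) * real d" by (simp add: p_def mult_ac)
  qed
  have \<rho>: "sqrt (1 - h\<^sup>2) ^ (d - 1) = x"
  proof -
    have "sqrt (1 - h\<^sup>2) = x powr (p / 2)"
      unfolding h2 by (simp add: powr_half_sqrt[symmetric] powr_powr)
    also have "\<dots> ^ (d - 1) = x powr (p / 2 * real (d - 1))"
      using x0 by (simp add: powr_powr powr_realpow[symmetric])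
    also have "p / 2 * real (d - 1) = 1" using d0 by (simp add: p_def)
    finally show ?thesis using x0 by simp
  qed
  define cap where "cap = cone_volume (d - 1) h / unit_ball_vol d"
  have cap_ge: "cap \<ge> x / (32 * h * sqrt d)"
    using cap_ratio_ge[OF d h0 h1 h2d] unfolding cap_def \<rho> .
  have cap_le: "cap \<le> 1"
    using cone_volume_le_ball[of "d - 1" h] d h0 h1 by (simp add: cap_def divide_le_eq)
  have rL: "r * L powr (3/2) \<ge> 1"
  proof -
    have "1 * 1 \<le> r * L powr (3/2)" using r L2 by (intro mult_mono) (auto intro!: ge_one_powr_ge_zero)
    then show ?thesis by simp
  qed
  \<comment> \<open>The height is small: h^2 = 1 - exp (- p ln (1/x)) is at most p L, and p = 2/(d -
    1) is at most 4/d. This is where half of the exponent 3/2 of the logarithm is spent.\<close>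
  have "h * sqrt d \<le> 2 * sqrt L"
  proof (rule power2_le_imp_le)
    have "ln (1 / x) = L - ln (r * L powr (3/2))"
      using x0 N r rL unfolding x_def L_def by (simp add: ln_div)
    also have "\<dots> \<le> L" using rL by simp
    finally have lnx': "ln (1 / x) \<le> L" .
    have "h\<^sup>2 = 1 - exp (- (p * ln (1 / x)))" unfolding h2 using x0 by (simp add: powr_def ln_div)
    also have "\<dots> \<le> p * ln (1 / x)" using exp_ge_add_one_self[of "- (p * ln (1 / x))"] by linarith
    also have "\<dots> \<le> p * L" using lnx' p by (intro mult_left_mono) auto
    also have "\<dots> \<le> 4 / real d * L"
      using d0 L2 by (intro mult_right_mono) (auto simp: p_def field_simps)
    finally have "h\<^sup>2 * real d \<le> 4 / real d * L * real d" using d0 by (intro mult_right_mono) auto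
    then show "(h * sqrt d)\<^sup>2 \<le> (2 * sqrt L)\<^sup>2" using d0 L2 by (simp add: power_mult_distrib)
  qed (use L2 in simp)
  then have "x / (32 * (2 * sqrt L)) \<le> x / (32 * (h * sqrt d))"
    using x0 h0 d0 L2 by (intro divide_left_mono mult_pos_pos mult_left_mono) auto
  moreover have "x / (32 * (2 * sqrt L)) = r * L / (64 * N)"
  proof -
    have "L powr (3/2) = L powr (1 + 1/2)" by simp
    also have "\<dots> = L * sqrt L" using L2 by (subst powr_add) (simp add: powr_half_sqrt)
    finally show ?thesis using L2 by (simp add: x_def L_def[symmetric])
  qed
  ultimately have cap_ge': "cap \<ge> r * L / (64 * N)" using cap_ge by (simp add: mult.assoc)
  \<comment> \<open>The threshold is 384 = 3 * 128, where 128 consists of 64 = 32 * 2 from the cap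
    and 2 from n - d \<ge> n/2.\<close>
  have nd_cap: "real (n - d) * cap \<ge> 3 * real d * L"
  proof -
    have "real (n - d) \<ge> real n / 2" using n2 by simp
    moreover have "r * L / (64 * N) \<ge> 0" using r L2 N by simp
    ultimately have "real (n - d) * cap \<ge> real n / 2 * (r * L / (64 * N))"
      using cap_ge' by (intro mult_mono) auto
    also have "real n / 2 * (r * L / (64 * N)) = r / 128 * (real d * L)"
      using N by (simp add: nd)
    also have "\<dots> \<ge> 3 * (real d * L)" using r d0 L2 by (intro mult_right_mono) auto
    finally show ?thesis by simp
  qed
  have "(1 - cap) ^ (n - d) \<le> exp (- cap) ^ (n - d)"
    using cap_le exp_ge_add_one_self[of "- cap"] by (intro power_mono) auto
  also have "\<dots> = exp (- (real (n - d) * cap))" by (simp only: exp_of_nat_mult[symmetric]) simp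
  also have "\<dots> \<le> exp (- (3 * real d * L))" using nd_cap by simp
  finally have pow_le: "(1 - cap) ^ (n - d) \<le> exp (- (3 * real d * L))" .
  have "real (n choose d) \<le> (exp 1 * N) ^ d" unfolding N_def using d n2 by (intro choose_le_exp) auto
  also have "exp 1 * N = exp (1 + L)" using N by (simp add: L_def exp_add)
  also have "exp (1 + L) ^ d = exp (real d * (1 + L))" by (simp only: exp_of_nat_mult)
  finally have "real (n choose d) * (2 * (1 - cap) ^ (n - d)) \<le> exp (real d * (1 + L)) * (2 * exp (- (3 * real d * L)))"
    using pow_le cap_le by (intro mult_mono) auto
  also have "\<dots> = 2 * exp (real d * (1 - 2 * L))"
    by (simp add: exp_add[symmetric] algebra_simps)
  \<comment> \<open>The factor 3 leaves d (2 L - 1) after the binomial coefficient has used d (1 +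
    L); as d and L are at least 2, at least L remains.\<close>
  also have "\<dots> \<le> 2 * exp (- L)"
  proof -
    have "real d * (2 * L - 1) \<ge> 1 * L" using d0 L2 by (intro mult_mono) auto
    then show ?thesis by (simp add: algebra_simps)
  qed
  also have "exp (- L) = 1 / N" using N by (simp add: L_def exp_minus inverse_eq_divide)
  finally show "real (n choose d) * (2 * (1 - cone_volume (d - 1) h / unit_ball_vol d) ^ (n - d)) \<le> 2 / N"
    by (simp add: cap_def)
qed

text \<open>With z = r/N the exponent of the upper height gives \<rho>^((d-1)^2) = z^(d+1) for
  \<rho> = sqrt (1 - h^2). The binomial bound (e N)^d consumes d factors z and one is left
  over.\<close>

lemma high_term_le:
  fixes n d :: nat and r :: real
  defines "N \<equiv> real n / real d" and "h \<equiv> upper_height r n d"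
  assumes d: "d \<ge> 2" and r: "0 < r" "r \<le> 1 / 144" and N: "N \<ge> 3"
  shows "0 < h" "h < 1"
    "real (n choose d) * (24 ^ d * sqrt (1 - h\<^sup>2) ^ ((d - 1)\<^sup>2) / h) \<le> 1 / N"
proof -
  have d0: "real d > 0" "real d \<ge> 2" "real (d - 1) = real d - 1" using d by auto
  have nd: "real n = N * real d" using d0 by (simp add: N_def)
  have "1 * real d \<le> N * real d" using N d0 by (intro mult_right_mono) auto
  then have n2: "real d \<le> real n" using nd by simp
  define z where "z = r / N"
  have z: "0 < z" "z < 1" using r N by (auto simp: z_def divide_less_eq)
  have lnz: "ln (1 / z) \<ge> 1"
  proof -
    have "3 * r \<le> N" using r N by linarith
    then have "3 \<le> 1 / z" using r by (simp add: z_def le_divide_eq)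
    then have "exp 1 \<le> 1 / z" using exp_le by linarith
    then show ?thesis using z by (subst ln_ge_iff) auto
  qed
  define p where "p = 2 * (real d + 1) / (real d - 1)\<^sup>2"
  have p: "p > 0" using d0 by (simp add: p_def)
  have zp: "0 < z powr p" "z powr p < 1" using z p powr_less_mono2[of p z 1] by auto
  have h_eq: "h = sqrt (1 - z powr p)"
    unfolding h_def upper_height_def p_def z_def N_def by (simp add: mult_ac)
  then have h2: "h\<^sup>2 = 1 - z powr p" using zp by simp
  show h0: "0 < h" using zp by (simp add: h_eq)
  show h1: "h < 1" using zp by (simp add: h_eq)
  have h2d: "h\<^sup>2 * (real d + 1) \<ge> 1"
    unfolding h2
  proof (rule one_minus_powr_ge[OF z p d0(1)])
    have "(real d - 1)\<^sup>2 \<le> 2 * (real d + 1) * real d"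
    proof -
      have "2 * (real d + 1) * real d - (real d - 1)\<^sup>2 = real d * real d + 4 * real d - 1"
        by (simp add: power2_eq_square algebra_simps)
      moreover have "real d * real d \<ge> 0" by simp
      ultimately show ?thesis using d0 by linarith
    qed
    then have "1 \<le> p * real d" using d0 by (simp add: p_def le_divide_eq)
    then have "1 * 1 \<le> (p * real d) * ln (1 / z)" using lnz by (intro mult_mono) auto
    then show "1 \<le> p * ln (1 / z) * real d" by (simp add: mult_ac)
  qed
  \<comment> \<open>The denominator h is at worst of order 1/sqrt d and is crudely absorbed into the
    exponential constant.\<close>
  have hinv: "1 / h \<le> 2 ^ d"
  proof (rule power2_le_imp_le)
    have "(1 / h)\<^sup>2 \<le> real d + 1"
      using h2d h0 by (simp add: power_divide divide_le_eq mult.commute)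
    also have "\<dots> \<le> 2 ^ d * 2 ^ d"
    proof -
      have "real (Suc d) \<le> real (2 ^ d)" by (simp only: of_nat_le_iff) (rule Suc_leI[OF less_exp])
      also have "\<dots> \<le> 2 ^ d * 2 ^ d" by simp
      finally show ?thesis by simp
    qed
    finally show "(1 / h)\<^sup>2 \<le> (2 ^ d)\<^sup>2" by (simp add: power2_eq_square)
  qed simp
  have \<rho>: "sqrt (1 - h\<^sup>2) ^ ((d - 1)\<^sup>2) = z ^ (d + 1)"
  proof -
    have "sqrt (1 - h\<^sup>2) = z powr (p / 2)"
      unfolding h2 by (simp add: powr_half_sqrt[symmetric] powr_powr)
    also have "\<dots> ^ ((d - 1)\<^sup>2) = z powr (p / 2 * real ((d - 1)\<^sup>2))"
      using z by (simp add: powr_powr powr_realpow[symmetric])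
    also have "p / 2 * real ((d - 1)\<^sup>2) = real (d + 1)" using d0 by (simp add: p_def)
    also have "z powr real (d + 1) = z ^ (d + 1)" using z(1) by (rule powr_realpow)
    finally show ?thesis .
  qed
  have C: "real (n choose d) \<le> (exp 1 * N) ^ d" unfolding N_def using d n2 by (intro choose_le_exp) auto
  have "24 ^ d * sqrt (1 - h\<^sup>2) ^ ((d - 1)\<^sup>2) / h = 24 ^ d * z ^ (d + 1) * (1 / h)" unfolding \<rho> by simp
  also have "\<dots> \<le> 24 ^ d * z ^ (d + 1) * 2 ^ d" using hinv z by (intro mult_left_mono) auto
  finally have "real (n choose d) * (24 ^ d * sqrt (1 - h\<^sup>2) ^ ((d - 1)\<^sup>2) / h) \<le>
      (exp 1 * N) ^ d * (24 ^ d * z ^ (d + 1) * 2 ^ d)"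
    using C h0 h1 N by (intro mult_mono) (auto simp: power_le_one abs_square_le_1)
  also have "\<dots> = (exp 1 * N * 24 * z * 2) ^ d * z"
    by (simp only: power_mult_distrib power_add power_one_right mult_ac)
  \<comment> \<open>With e \<le> 3 this base is at most 144 r, which explains the threshold
    1/144.\<close>
  also have "exp 1 * N * 24 * z * 2 = 48 * exp 1 * r" using N by (simp add: z_def)
  also have "(48 * exp 1 * r) ^ d * z \<le> 1 * z"
  proof (intro mult_right_mono power_le_one)
    have "48 * exp 1 * r \<le> 48 * 3 * (1 / 144)" using exp_le r by (intro mult_mono) auto
    then show "48 * exp 1 * r \<le> 1" by simp
  qed (use r z in auto)
  also have "1 * z \<le> 1 / N" using r N by (simp add: z_def divide_right_mono)
  finally show "real (n choose d) * (24 ^ d * sqrt (1 - h\<^sup>2) ^ ((d - 1)\<^sup>2) / h) \<le> 1 / N" .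
qed

theorem theorem8:
  fixes d :: "nat \<Rightarrow> nat"
  assumes d_range: "\<forall>\<^sub>F n in sequentially. d n \<in> {2..n - 1}"
    and d_const_or_infinity:
      "(\<exists>c. \<forall>\<^sub>F n in sequentially. d n = c) \<or> filterlim d at_top sequentially"
    and n_dominates_d: "(\<lambda>n. real (d n) / real n) \<longlonglongrightarrow> 0"
  shows "\<exists>R1>0. \<exists>R2>0. \<forall>r1\<ge>R1. \<forall>r2. 0 < r2 \<and> r2 \<le> R2 \<longrightarrow>
    (\<lambda>n. expected_facets n (d n) (-1) 1
       - expected_facets n (d n) (lower_height r1 n (d n)) (upper_height r2 n (d n))) \<longlonglongrightarrow> 0"
proof -
  let ?D = "\<lambda>r1 r2 n. expected_facets n (d n) (-1) 1
       - expected_facets n (d n) (lower_height r1 n (d n)) (upper_height r2 n (d n))"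
  let ?N = "\<lambda>n. real n / real (d n)"
  have pos: "\<forall>\<^sub>F n in sequentially. real (d n) / real n > 0"
    using d_range by eventually_elim auto
  have "filterlim (\<lambda>n. inverse (real (d n) / real n)) at_top sequentially"
    using n_dominates_d pos by (rule filterlim_inverse_at_top)
  then have N_top: "filterlim ?N at_top sequentially" by simp
  have lim: "?D r1 r2 \<longlonglongrightarrow> 0" if r1: "r1 \<ge> 384" and r2: "0 < r2" "r2 \<le> 1 / 144" for r1 r2 :: real
  proof (rule Lim_null_comparison)
    \<comment> \<open>The side conditions of both estimates involve n and d only through N = n/d.
      They are therefore established for a single real variable tending to infinity and pulled back
      along \<open>N_top\<close>.\<close>
    have r1': "r1 > 0" using r1 by simp
    have "\<forall>\<^sub>F N in at_top. N \<ge> (3::real)" by (rule eventually_ge_at_top)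
    moreover have "\<forall>\<^sub>F N in at_top. ln N \<ge> (2::real)" by real_asymp
    moreover have "\<forall>\<^sub>F N in at_top. r1 * ln N powr (3/2) / N < 1" using r1' by real_asymp
    moreover have "\<forall>\<^sub>F N in at_top. ln (1 / (r1 * ln N powr (3/2) / N)) \<ge> ln N / 2" using r1' by real_asymp
    ultimately have "\<forall>\<^sub>F N in at_top. N \<ge> 3 \<and> ln N \<ge> 2 \<and> r1 * ln N powr (3/2) / N < 1 \<and>
        ln (1 / (r1 * ln N powr (3/2) / N)) \<ge> ln N / 2" by eventually_elim auto
    then have "\<forall>\<^sub>F n in sequentially. ?N n \<ge> 3 \<and> ln (?N n) \<ge> 2 \<and> r1 * ln (?N n) powr (3/2) / ?N n < 1 \<and>
        ln (1 / (r1 * ln (?N n) powr (3/2) / ?N n)) \<ge> ln (?N n) / 2"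
      using N_top by (rule eventually_compose_filterlim)
    then show "\<forall>\<^sub>F n in sequentially. norm (?D r1 r2 n) \<le> 3 * (real (d n) / real n)"
      using d_range
    proof eventually_elim
      case (elim n)
      have d: "d n \<ge> 2" using elim by simp
      have N2: "?N n \<ge> 2" using elim by simp
      note lo = low_term_le[OF d N2 r1] and hi = high_term_le[OF d r2, of n]
      have "\<bar>?D r1 r2 n\<bar> \<le> real (n choose d n) *
        (2 * (1 - cone_volume (d n - 1) (lower_height r1 n (d n)) / unit_ball_vol (d n)) ^ (n - d n) +
         24 ^ d n * sqrt (1 - (upper_height r2 n (d n))\<^sup>2) ^ ((d n - 1)\<^sup>2) / upper_height r2 n (d n))"
        using lo(1,2) hi(1,2) elim by (intro facet_difference_le d) auto
      also have "\<dots> \<le> 2 / ?N n + 1 / ?N n"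
        unfolding distrib_left using lo(3) hi(3) elim by (intro add_mono) auto
      also have "\<dots> = 3 * (real (d n) / real n)" by simp
      finally show ?case by simp
    qed
    show "(\<lambda>n. 3 * (real (d n) / real n)) \<longlonglongrightarrow> 0"
      using tendsto_mult_left[OF n_dominates_d, of 3] by simp
  qed
  show ?thesis
    using lim by (intro exI[of _ 384] exI[of _ "1 / 144"] conjI allI impI) auto
qed

end
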